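(* Let $A,B\in\mathcal M_n$ be accretive with $W(A),W(B)\subset S_\alpha$ for some $0\le\alpha<\pi/2$. Then for every $f\in\mathfrak m$ and $0<t<1$, $$\Re\big(f(A)\nabla_tf(B)\big)\le\sec^2(\alpha)\,\Re f(A\nabla_tB),$$ where $X\nabla_tY=(1-t)X+tY$.
   Context: A matrix $A$ is accretive if $\Re A=\frac{A+A^*}{2}$ is positive definite. $W(A)$ is the numerical range, $S_\alpha=\{z:\Re z>0,\ |\Im z|\le\tan(\alpha)\Re z\}$. $\le$ is the Löwner order. $\mathfrak m$ is the set of matrix monotone $f:(0,\infty)\to(0,\infty)$ with $f(1)=1$; each extends analytically to $\mathbb C\setminus(-\infty,0]$, and for $X$ with spectrum in $D=\mathbb C\setminus(-\infty,0]$, $f(X)=\frac1{2\pi i}\int_\Gamma f(z)(z\mathcal I-X)^{-1}dz$ with $\Gamma\subset D$ a simple closed curve winding once around each eigenvalue of $X$. *)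

theory Defs
  imports "Jordan_Normal_Form.Schur_Decomposition" "HOL-Complex_Analysis.Complex_Analysis"
begin

definition qform :: "complex Matrix.mat \<Rightarrow> complex Matrix.vec \<Rightarrow> complex" where
  "qform M x = scalar_prod (M *\<^sub>v x) (conjugate x)"

definition hermitian_mat :: "complex Matrix.mat \<Rightarrow> bool" where
  "hermitian_mat M \<longleftrightarrow> M \<in> carrier_mat (dim_row M) (dim_row M) \<and> mat_adjoint M = M"

definition pos_def_mat :: "complex Matrix.mat \<Rightarrow> bool" where
  "pos_def_mat M \<longleftrightarrow> hermitian_mat M \<and>
     (\<forall>x \<in> carrier_vec (dim_row M). x \<noteq> 0\<^sub>v (dim_row M) \<longrightarrow> Re (qform M x) > 0)"

definition pos_semidef_mat :: "complex Matrix.mat \<Rightarrow> bool" where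
  "pos_semidef_mat M \<longleftrightarrow> hermitian_mat M \<and>
     (\<forall>x \<in> carrier_vec (dim_row M). Re (qform M x) \<ge> 0)"

definition loewner_le :: "complex Matrix.mat \<Rightarrow> complex Matrix.mat \<Rightarrow> bool" where
  "loewner_le A B \<longleftrightarrow> hermitian_mat A \<and> hermitian_mat B \<and> dim_row A = dim_row B \<and>
     pos_semidef_mat (B - A)"

definition ReM :: "complex Matrix.mat \<Rightarrow> complex Matrix.mat" where
  "ReM A = (1/2 :: complex) \<cdot>\<^sub>m (A + mat_adjoint A)"

definition accretive :: "complex Matrix.mat \<Rightarrow> bool" where
  "accretive A \<longleftrightarrow> A \<in> carrier_mat (dim_row A) (dim_row A) \<and> pos_def_mat (ReM A)"

definition num_range :: "complex Matrix.mat \<Rightarrow> complex set" where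
  "num_range A = {qform A x | x. x \<in> carrier_vec (dim_row A) \<and> scalar_prod x (conjugate x) = 1}"

definition sector :: "real \<Rightarrow> complex set" where
  "sector \<alpha> = {z. Re z > 0 \<and> \<bar>Im z\<bar> \<le> tan \<alpha> * Re z}"

definition wam :: "real \<Rightarrow> complex Matrix.mat \<Rightarrow> complex Matrix.mat \<Rightarrow> complex Matrix.mat" where
  "wam t X Y = complex_of_real (1 - t) \<cdot>\<^sub>m X + complex_of_real t \<cdot>\<^sub>m Y"

definition unitary_mat :: "complex Matrix.mat \<Rightarrow> bool" where
  "unitary_mat U \<longleftrightarrow> U \<in> carrier_mat (dim_row U) (dim_row U) \<and>
     U * mat_adjoint U = 1\<^sub>m (dim_row U) \<and> mat_adjoint U * U = 1\<^sub>m (dim_row U)"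

definition herm_fun :: "(real \<Rightarrow> real) \<Rightarrow> complex Matrix.mat \<Rightarrow> complex Matrix.mat" where
  "herm_fun f A = (SOME M. \<exists>U d. unitary_mat U \<and> dim_row U = dim_row A \<and>
      A = U * mat_diag (dim_row A) (\<lambda>i. complex_of_real (d i)) * mat_adjoint U \<and>
      M = U * mat_diag (dim_row A) (\<lambda>i. complex_of_real (f (d i))) * mat_adjoint U)"

definition matrix_monotone :: "(real \<Rightarrow> real) \<Rightarrow> bool" where
  "matrix_monotone f \<longleftrightarrow> (\<forall>n A B. A \<in> carrier_mat n n \<and> B \<in> carrier_mat n n \<and>
      pos_def_mat A \<and> pos_def_mat B \<and> loewner_le A B \<longrightarrow> loewner_le (herm_fun f A) (herm_fun f B))"

definition mclass :: "(real \<Rightarrow> real) set" where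
  "mclass = {f. (\<forall>x>0. f x > 0) \<and> f 1 = 1 \<and> matrix_monotone f}"

definition slit_plane :: "complex set" where
  "slit_plane = - {z. Im z = 0 \<and> Re z \<le> 0}"

definition mat_inv :: "complex Matrix.mat \<Rightarrow> complex Matrix.mat" where
  "mat_inv N = (SOME M. M \<in> carrier_mat (dim_row N) (dim_row N) \<and>
      N * M = 1\<^sub>m (dim_row N) \<and> M * N = 1\<^sub>m (dim_row N))"

definition admissible_contour :: "complex Matrix.mat \<Rightarrow> (real \<Rightarrow> complex) \<Rightarrow> bool" where
  "admissible_contour X \<gamma> \<longleftrightarrow> valid_path \<gamma> \<and> simple_path \<gamma> \<and> pathfinish \<gamma> = pathstart \<gamma> \<and>
     path_image \<gamma> \<subseteq> slit_plane \<and>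
     (\<forall>w. eigenvalue X w \<longrightarrow> w \<notin> path_image \<gamma> \<and> winding_number \<gamma> w = 1)"

definition hol_fun :: "(complex \<Rightarrow> complex) \<Rightarrow> complex Matrix.mat \<Rightarrow> complex Matrix.mat" where
  "hol_fun g X = (SOME M. \<exists>\<gamma>. admissible_contour X \<gamma> \<and>
      M = Matrix.mat (dim_row X) (dim_row X) (\<lambda>(i,j).
         contour_integral \<gamma> (\<lambda>z. g z * mat_inv (z \<cdot>\<^sub>m 1\<^sub>m (dim_row X) - X) $$ (i,j)) / (2 * pi * \<i>)))"

end

theory Submission
  imports Defs
begin

text \<open>The kernels \<open>h\<^sub>s(z) = z / (s + (1 - s) z)\<close>, \<open>0 \<le> s \<le> 1\<close>, satisfy the inequality: writing
  \<open>x = s v + (1 - s) X v\<close> one has \<open>Re \<langle>h\<^sub>s(X) x, x\<rangle> = s Re \<langle>X v, v\<rangle> + (1 - s) |X v|\<^sup>2\<close>, while for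
  every decomposition \<open>x = s z + (1 - s) y\<close> a sectorial Cauchy--Schwarz inequality gives
  \<open>Re \<langle>h\<^sub>s(X) x, x\<rangle> \<le> sec\<^sup>2 \<alpha> (s Re \<langle>X z, z\<rangle> + (1 - s) |y|\<^sup>2)\<close>.  The bound is affine in \<open>X\<close>, so using for
  \<open>A\<close> and \<open>B\<close> the decomposition that belongs to \<open>A \<nabla>\<^sub>t B\<close> proves the claim for \<open>h\<^sub>s\<close>.

  The claim is linear in \<open>f\<close>, so it remains to approximate \<open>f\<close> by convex combinations of kernels (a
  finite form of Loewner's theorem).  On a finite set of nodes this is dual to the positivity of certain
  divided differences of \<open>f\<close> against squares of polynomials, which is matrix monotonicity tested on
  rank one perturbations of diagonal matrices.  Montel's theorem and the identity theorem turn
  approximation on finite sets into locally uniform approximation on the slit plane, and contour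
  integrals pass to the limit.\<close>

text \<open>The factor sec^2 \<alpha> = 1 + tan^2 \<alpha> is lost only once. For positive Hermitian
  X the kernel form is the minimum of the affine bound over all decompositions; for sectorial X it
  is bounded by it only up to that factor. The bound is applied to \<open>A\<close> and
  \<open>B\<close>, while \<open>wam t A B\<close> enters through its exact value. All kernels and
  \<open>f\<close> take the value 1 at 1, so convex combinations are the right family, rather than a
  cone. Both endpoints h_0 = 1 and h_1 = z belong to it: the parameter set is then compact, which
  gives the local boundedness behind Montel's theorem. The number of nodes is kept even, 2m. This
  splits them into two interlacing spectra, and clearing denominators in a combination of kernels
  leaves a polynomial of degree at most 2m - 1. Its generators r^2 and z r^2 have degree r < m, and
  each kind is matched by one family of divided difference inequalities. Both functional calculi are
  defined by choice. For \<open>herm_fun\<close> independence of the diagonalisation is proved; for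
  \<open>hol_fun\<close> the kernel forms are computed on every contour that may have been
  chosen.\<close>

no_notation Finite_Cartesian_Product.vec.vec_nth (infixl "$" 90)
no_notation fps_nth (infixl "$" 75)

section \<open>Polynomials nonnegative on the half line\<close>

text \<open>The parameter \<open>d\<close> bounds every generator separately, not just the sum: the
  duality argument evaluates a functional term by term and can handle only terms of small
  degree.\<close>

inductive half_line_sos :: "nat \<Rightarrow> real poly \<Rightarrow> bool" for d where
  square: "degree (r * r) \<le> d \<Longrightarrow> half_line_sos d (r * r)"
| x_square: "degree ([:0, 1:] * (r * r)) \<le> d \<Longrightarrow> half_line_sos d ([:0, 1:] * (r * r))"
| add: "half_line_sos d p \<Longrightarrow> half_line_sos d q \<Longrightarrow> half_line_sos d (p + q)"

lemma half_line_sos_mono: "half_line_sos d p \<Longrightarrow> d \<le> e \<Longrightarrow> half_line_sos e p"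
  by (induction rule: half_line_sos.induct) (auto intro: half_line_sos.intros simp del: mult_pCons_left)

text \<open>The product of two generators of either kind is again a generator, because
  \<open>x * x\<close> is itself a square.\<close>

lemma half_line_sos_mult:
  assumes "half_line_sos d p" "half_line_sos e q"
  shows "half_line_sos (d + e) (p * q)"
  using assms(1)
proof (induction rule: half_line_sos.induct)
  case (square r)
  show ?case using assms(2)
  proof (induction rule: half_line_sos.induct)
    case (square s)
    have "degree (r * s * (r * s)) \<le> d + e"
      using \<open>degree (r * r) \<le> d\<close> square degree_mult_le[of "r * r" "s * s"] by (simp add: mult_ac)
    from half_line_sos.square[OF this] show ?case by (simp add: mult_ac)
  next
    case (x_square s)
    have "degree ([:0, 1:] * (r * s * (r * s))) \<le> d + e"
      using \<open>degree (r * r) \<le> d\<close> x_square degree_mult_le[of "r * r" "[:0, 1:] * (s * s)"]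
      by (simp add: mult_ac del: mult_pCons_left mult_pCons_right)
    from half_line_sos.x_square[OF this] show ?case
      by (simp add: mult_ac del: mult_pCons_left mult_pCons_right)
  next
    case (add p q)
    then show ?case by (auto intro: half_line_sos.add simp: distrib_left)
  qed
next
  case (x_square r)
  show ?case using assms(2)
  proof (induction rule: half_line_sos.induct)
    case (square s)
    have "degree ([:0, 1:] * (r * s * (r * s))) \<le> d + e"
      using square x_square degree_mult_le[of "[:0, 1:] * (r * r)" "s * s"]
      by (simp add: mult_ac del: mult_pCons_left mult_pCons_right)
    from half_line_sos.x_square[OF this] show ?case
      by (simp add: mult_ac del: mult_pCons_left mult_pCons_right)
  next
    case (x_square s)
    have "degree ([:0, 1:] * r * s * ([:0, 1:] * r * s)) \<le> d + e"
      using \<open>degree ([:0, 1:] * (r * r)) \<le> d\<close> x_square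
        degree_mult_le[of "[:0, 1:] * (r * r)" "[:0, 1:] * (s * s)"]
      by (simp add: mult_ac del: mult_pCons_left mult_pCons_right)
    from half_line_sos.square[OF this] show ?case
      by (simp add: mult_ac del: mult_pCons_left mult_pCons_right)
  next
    case (add p q)
    then show ?case
      by (auto intro: half_line_sos.add simp: distrib_left simp del: mult_pCons_left mult_pCons_right)
  qed
next
  case (add p q)
  then show ?case by (auto intro: half_line_sos.add simp: distrib_right)
qed

lemma half_line_sos_const: "0 \<le> c \<Longrightarrow> half_line_sos d [:c:]"
  using half_line_sos.square[of "[:sqrt c:]" d] by simp

lemma half_line_sos_linear:
  assumes "a \<le> 0"
  shows "half_line_sos 1 [:- a, 1:]"
proof -
  have "half_line_sos 1 ([:0, 1:] * ([:1:] * [:1:]))"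
    by (rule half_line_sos.x_square) simp
  from half_line_sos.add[OF half_line_sos_const[of "- a"] this] assms show ?thesis by simp
qed

lemma half_line_sos_quadratic: "half_line_sos 2 [:b\<^sup>2 + c\<^sup>2, - 2 * b, 1:]"
proof -
  have "half_line_sos 2 ([:- b, 1:] * [:- b, 1:])"
    by (rule half_line_sos.square) simp
  from half_line_sos.add[OF half_line_sos_const[of "c\<^sup>2"] this] show ?thesis
    by (simp add: power2_eq_square add.commute)
qed

text \<open>Cancelling a factor that vanishes at \<open>a\<close> loses the sign of the quotient
  there; the limit from the right restores it and stays in the half line even when
  \<open>a = 0\<close>.\<close>

lemma poly_nonneg_except_point:
  fixes q :: "real poly"
  assumes "\<And>x. 0 \<le> x \<Longrightarrow> x \<noteq> a \<Longrightarrow> 0 \<le> poly q x" and "0 \<le> y"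
  shows "0 \<le> poly q y"
proof (cases "y = a")
  case True
  have "((\<lambda>x. poly q x) \<longlongrightarrow> poly q a) (at_right a)"
    using isCont_def poly_isCont filterlim_at_split by blast
  moreover have "eventually (\<lambda>x. 0 \<le> poly q x) (at_right a)"
    using assms True by (auto simp: eventually_at_filter)
  ultimately show ?thesis
    using True by (intro tendsto_lowerbound) auto
qed (use assms in auto)

text \<open>The remainder modulo the quadratic is \<open>b + c x\<close>; vanishing at a nonreal
  \<open>z\<close> forces \<open>c = 0\<close> through the imaginary part, and then
  \<open>b = 0\<close>.\<close>

lemma quadratic_dvd_of_complex_root:
  fixes p :: "real poly" and z :: complex
  assumes "poly (map_poly of_real p) z = 0" and "Im z \<noteq> 0"
  shows "[:(Re z)\<^sup>2 + (Im z)\<^sup>2, - 2 * Re z, 1:] dvd p"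
proof -
  define d where "d = [:(Re z)\<^sup>2 + (Im z)\<^sup>2, - 2 * Re z, 1:]"
  interpret mp: map_poly_comm_ring_hom "of_real :: real \<Rightarrow> complex" ..
  have "degree (p mod d) < 2"
    using degree_mod_less[of d p] by (auto simp: d_def)
  then have bc: "p mod d = [:b, c:]" if "b = coeff (p mod d) 0" "c = coeff (p mod d) 1" for b c
    using that by (auto intro!: poly_eqI simp: coeff_pCons coeff_eq_0 split: nat.split)
  define b c where "b = coeff (p mod d) 0" and "c = coeff (p mod d) 1"
  note bc = bc[OF this]
  have "poly (map_poly of_real d) z = 0"
    by (simp add: d_def complex_eq_iff power2_eq_square algebra_simps)
  moreover have "map_poly of_real p = map_poly of_real (p div d) * map_poly of_real d
      + (map_poly of_real (p mod d) :: complex poly)"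
    by (simp flip: mp.hom_mult mp.hom_add)
  ultimately have "poly (map_poly of_real (p mod d)) z = 0"
    using assms(1) by simp
  then have "b = 0 \<and> c = 0"
    using assms(2) by (auto simp: bc of_real_hom.map_poly_pCons_hom complex_eq_iff)
  then show ?thesis
    using bc by (auto simp: d_def dvd_eq_mod_eq_0)
qed

text \<open>Induction on the degree: split off a factor that lies in the cone and whose quotient
  stays nonnegative. A nonreal root yields a quadratic, a root \<open>a \<le> 0\<close> the linear
  factor, and a positive root is at least double.\<close>

theorem half_line_sos_if_nonneg:
  assumes "\<And>x. 0 \<le> x \<Longrightarrow> 0 \<le> poly p x"
  shows "half_line_sos (degree p) p"
  using assms
proof (induction "degree p" arbitrary: p rule: less_induct)
  case less
  show ?case
  proof (cases "degree p = 0")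
    case True
    then obtain c where "p = [:c:]" by (meson degree_eq_zeroE)
    with less.prems[of 0] show ?thesis by (auto intro: half_line_sos_const)
  next
    case False
    have "\<not> constant (poly (map_poly of_real p :: complex poly))"
      using False by (simp add: constant_degree)
    from Fundamental_Theorem_Algebra.fundamental_theorem_of_algebra[OF this]
    obtain z :: complex where z: "poly (map_poly of_real p) z = 0" ..
    \<comment> \<open>\<open>P d k\<close> describes a factor of degree \<open>k\<close> that can be
      split off; it is positive on the half line except possibly at one point
      \<open>a\<close>.\<close>
    define P where "P d k \<longleftrightarrow> (half_line_sos k d \<and> degree d = k \<and> k \<noteq> 0 \<and> d dvd p
       \<and> (\<exists>a. \<forall>x\<ge>0. x \<noteq> a \<longrightarrow> 0 < poly d x))" for d and k :: nat
    have step: "half_line_sos (degree p) p" if "P d k" for d k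
    proof -
      from that obtain q a where q: "p = d * q" and a: "\<And>x. 0 \<le> x \<Longrightarrow> x \<noteq> a \<Longrightarrow> 0 < poly d x"
        unfolding P_def dvd_def by blast
      have "0 \<le> poly q x" if "0 \<le> x" "x \<noteq> a" for x
        using less.prems[OF that(1)] a[OF that] q by (simp add: zero_le_mult_iff)
      then have nonneg: "0 \<le> poly q x" if "0 \<le> x" for x
        using poly_nonneg_except_point that by blast
      have "q \<noteq> 0" "d \<noteq> 0" using False q by auto
      then have deg: "degree p = k + degree q"
        using q that by (auto simp: P_def degree_mult_eq)
      have "half_line_sos (degree q) q"
        by (rule less.hyps) (use deg nonneg that in \<open>auto simp: P_def\<close>)
      then show ?thesis
        using half_line_sos_mult that unfolding q P_def by (metis q deg)
    qed
    consider "Im z \<noteq> 0" | a where "z = of_real a" "a \<le> 0" | a where "z = of_real a" "0 < a"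
      by (metis complex_is_Real_iff Reals_cases not_le)
    then show ?thesis
    proof cases
      case 1
      have "P [:(Re z)\<^sup>2 + (Im z)\<^sup>2, - 2 * Re z, 1:] 2"
        unfolding P_def
      proof (intro conjI half_line_sos_quadratic quadratic_dvd_of_complex_root z 1 exI allI impI)
        fix x :: real
        have "0 < (x - Re z)\<^sup>2 + (Im z)\<^sup>2" using 1 by (simp add: add_nonneg_pos)
        then show "0 < poly [:(Re z)\<^sup>2 + (Im z)\<^sup>2, - 2 * Re z, 1:] x"
          by (simp add: power2_eq_square algebra_simps)
      qed auto
      then show ?thesis by (rule step)
    next
      case 2
      have "poly p a = 0" using z 2 by (simp add: of_real_hom.poly_map_poly)
      then have "P [:- a, 1:] 1"
        unfolding P_def using 2 by (auto intro: half_line_sos_linear[unfolded One_nat_def] simp: poly_eq_0_iff_dvd intro!: exI[of _ a])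
      then show ?thesis by (rule step)
    next
      case 3
      have "poly p a = 0" using z 3 by (simp add: of_real_hom.poly_map_poly)
      then obtain q where q: "p = [:- a, 1:] * q" by (auto simp: poly_eq_0_iff_dvd)
      \<comment> \<open>A simple root would make \<open>p\<close> change sign at \<open>a\<close>.
        The left limit, available because \<open>a\<close> is positive, and the right limit pin the
        cofactor to zero.\<close>
      have "poly q a = 0"
      proof (rule antisym)
        have "((\<lambda>x. poly q x) \<longlongrightarrow> poly q a) (at_left a)"
          using isCont_def poly_isCont filterlim_at_split by blast
        moreover have "eventually (\<lambda>x. poly q x \<le> 0) (at_left a)"
          using eventually_at_left_real[OF 3(2)]
        proof eventually_elim
          case (elim x)
          have "0 \<le> (x - a) * poly q x" using less.prems[of x] elim by (simp add: q algebra_simps)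
          then show ?case using elim by (simp add: zero_le_mult_iff)
        qed
        ultimately show "poly q a \<le> 0" by (intro tendsto_upperbound) auto
        have "((\<lambda>x. poly q x) \<longlongrightarrow> poly q a) (at_right a)"
          using isCont_def poly_isCont filterlim_at_split by blast
        moreover have "eventually (\<lambda>x. 0 \<le> poly q x) (at_right a)"
          using eventually_at_right_less[of a]
        proof eventually_elim
          case (elim x)
          have "0 \<le> (x - a) * poly q x" using less.prems[of x] elim 3 by (simp add: q algebra_simps)
          then show ?case using elim by (simp add: zero_le_mult_iff)
        qed
        ultimately show "0 \<le> poly q a" by (intro tendsto_lowerbound) auto
      qed
      then obtain q' where "p = ([:- a, 1:] * [:- a, 1:]) * q'"
        using q by (metis poly_eq_0_iff_dvd dvdE mult.assoc)
      moreover have "half_line_sos 2 ([:- a, 1:] * [:- a, 1:])"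
        by (rule half_line_sos.square) simp
      moreover have "0 < poly ([:- a, 1:] * [:- a, 1:]) x" if "x \<noteq> a" for x
        using that by (simp only: poly_mult) (auto simp: zero_less_mult_iff)
      ultimately have "P ([:- a, 1:] * [:- a, 1:]) 2"
        unfolding P_def by (auto simp del: mult_pCons_left mult_pCons_right simp: degree_mult_eq)
      then show ?thesis by (rule step)
    qed
  qed
qed

section \<open>Sectorial matrices\<close>

lemma cscalar_prod_sum: "w \<in> carrier_vec n \<Longrightarrow> u \<bullet>c w = (\<Sum>i<n. u $ i * cnj (w $ i))"
  by (auto simp: scalar_prod_def atLeast0LessThan)

lemma cscalar_prod_add_left:
  "u \<in> carrier_vec n \<Longrightarrow> v \<in> carrier_vec n \<Longrightarrow> w \<in> carrier_vec n \<Longrightarrow>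
    (u + v) \<bullet>c w = u \<bullet>c w + v \<bullet>c (w :: complex Matrix.vec)"
  by (auto simp: cscalar_prod_sum[where n=n] algebra_simps sum.distrib)

lemma cscalar_prod_add_right:
  "u \<in> carrier_vec n \<Longrightarrow> v \<in> carrier_vec n \<Longrightarrow> w \<in> carrier_vec n \<Longrightarrow>
    u \<bullet>c (v + w) = u \<bullet>c v + u \<bullet>c (w :: complex Matrix.vec)"
  by (auto simp: cscalar_prod_sum[where n=n] algebra_simps sum.distrib)

lemma cscalar_prod_smult_left:
  "u \<in> carrier_vec n \<Longrightarrow> w \<in> carrier_vec n \<Longrightarrow> (c \<cdot>\<^sub>v u) \<bullet>c w = c * (u \<bullet>c (w :: complex Matrix.vec))"
  by (auto simp: cscalar_prod_sum[where n=n] algebra_simps sum_distrib_left)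

lemma cscalar_prod_smult_right:
  "u \<in> carrier_vec n \<Longrightarrow> w \<in> carrier_vec n \<Longrightarrow> u \<bullet>c (c \<cdot>\<^sub>v w) = cnj c * (u \<bullet>c (w :: complex Matrix.vec))"
  by (auto simp: cscalar_prod_sum[where n=n] algebra_simps sum_distrib_left)

lemmas cscalar_prod_simps = cscalar_prod_add_left cscalar_prod_add_right
  cscalar_prod_smult_left cscalar_prod_smult_right

lemma cscalar_prod_cnj:
  "u \<in> carrier_vec n \<Longrightarrow> w \<in> carrier_vec n \<Longrightarrow> cnj (u \<bullet>c w) = w \<bullet>c (u :: complex Matrix.vec)"
  by (auto simp: cscalar_prod_sum[where n=n] mult.commute)

lemma Re_cscalar_prod_self_nonneg: "0 \<le> Re (u \<bullet>c (u :: complex Matrix.vec))"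
  by (simp add: cscalar_prod_sum[OF carrier_vec_dim_vec] sum_nonneg)

lemma Re_cscalar_prod_self_pos:
  assumes "u \<in> carrier_vec n" "u \<noteq> 0\<^sub>v n"
  shows "0 < Re (u \<bullet>c (u :: complex Matrix.vec))"
proof -
  have "Im (u \<bullet>c u) = 0"
    by (simp add: cscalar_prod_sum[OF carrier_vec_dim_vec])
  moreover have "u \<bullet>c u \<noteq> 0" using assms by (simp add: conjugate_square_eq_0_vec)
  ultimately show ?thesis
    using Re_cscalar_prod_self_nonneg[of u] by (auto simp: complex_eq_iff less_le)
qed

lemma two_Re_cscalar_prod_le:
  assumes "u \<in> carrier_vec n" "w \<in> carrier_vec n"
  shows "2 * Re (u \<bullet>c w) \<le> Re (u \<bullet>c u) + Re (w \<bullet>c (w :: complex Matrix.vec))"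
proof -
  have "0 \<le> Re ((u + (-1) \<cdot>\<^sub>v w) \<bullet>c (u + (-1) \<cdot>\<^sub>v w))"
    by (rule Re_cscalar_prod_self_nonneg)
  moreover have "Re (w \<bullet>c u) = Re (u \<bullet>c w)"
    using assms by (metis cscalar_prod_cnj cnj.simps(1))
  ultimately show ?thesis
    using assms by (simp add: cscalar_prod_simps[where n=n])
qed

lemma wam_carrier: "A \<in> carrier_mat n n \<Longrightarrow> B \<in> carrier_mat n n \<Longrightarrow> wam t A B \<in> carrier_mat n n"
  by (simp add: wam_def)

lemma smult_mat_mult_vec:
  "A \<in> carrier_mat n m \<Longrightarrow> v \<in> carrier_vec m \<Longrightarrow> (c \<cdot>\<^sub>m A) *\<^sub>v v = c \<cdot>\<^sub>v (A *\<^sub>v (v :: complex Matrix.vec))"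
  by (intro eq_vecI) (auto simp: scalar_prod_def sum_distrib_left mult_ac)

lemma wam_mult_vec:
  assumes "A \<in> carrier_mat n n" "B \<in> carrier_mat n n" "v \<in> carrier_vec n"
  shows "wam t A B *\<^sub>v v = complex_of_real (1 - t) \<cdot>\<^sub>v (A *\<^sub>v v) + complex_of_real t \<cdot>\<^sub>v (B *\<^sub>v v)"
  unfolding wam_def using assms
  by (simp add: add_mult_distrib_mat_vec[where nr=n and nc=n] smult_mat_mult_vec)

lemma qform_wam:
  assumes "A \<in> carrier_mat n n" "B \<in> carrier_mat n n" "v \<in> carrier_vec n"
  shows "qform (wam t A B) v = of_real (1 - t) * qform A v + of_real t * qform B v"
  using assms by (simp add: qform_def wam_mult_vec cscalar_prod_simps[where n=n])

text \<open>The numerical range condition freed from normalisation, with \<open>T\<close> in the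
  role of tan \<alpha>. In this homogeneous form it passes to convex combinations.\<close>

definition sectorial :: "nat \<Rightarrow> real \<Rightarrow> complex Matrix.mat \<Rightarrow> bool" where
  "sectorial n T X \<longleftrightarrow> X \<in> carrier_mat n n \<and>
     (\<forall>x\<in>carrier_vec n. (x \<noteq> 0\<^sub>v n \<longrightarrow> 0 < Re (qform X x)) \<and> \<bar>Im (qform X x)\<bar> \<le> T * Re (qform X x))"

lemma sectorial_wam:
  assumes "sectorial n T A" "sectorial n T B" "0 < t" "t < 1"
  shows "sectorial n T (wam t A B)"
  unfolding sectorial_def
proof (intro conjI ballI impI)
  have car: "A \<in> carrier_mat n n" "B \<in> carrier_mat n n" using assms by (auto simp: sectorial_def)
  then show "wam t A B \<in> carrier_mat n n" by (rule wam_carrier)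
  fix x :: "complex Matrix.vec" assume x: "x \<in> carrier_vec n"
  have q: "Re (qform (wam t A B) x) = (1 - t) * Re (qform A x) + t * Re (qform B x)"
    "Im (qform (wam t A B) x) = (1 - t) * Im (qform A x) + t * Im (qform B x)"
    using x car by (simp_all add: qform_wam del: of_real_diff)
  show "0 < Re (qform (wam t A B) x)" if "x \<noteq> 0\<^sub>v n"
    unfolding q using assms x that by (intro add_pos_pos mult_pos_pos) (auto simp: sectorial_def)
  have "\<bar>Im (qform (wam t A B) x)\<bar> \<le> (1 - t) * \<bar>Im (qform A x)\<bar> + t * \<bar>Im (qform B x)\<bar>"
    unfolding q using assms by (intro order_trans[OF abs_triangle_ineq]) (simp add: abs_mult)
  also have "\<dots> \<le> (1 - t) * (T * Re (qform A x)) + t * (T * Re (qform B x))"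
    using assms x by (intro add_mono mult_left_mono) (auto simp: sectorial_def)
  finally show "\<bar>Im (qform (wam t A B) x)\<bar> \<le> T * Re (qform (wam t A B) x)"
    unfolding q by (simp add: algebra_simps)
qed

lemma sectorial_if_num_range:
  assumes "X \<in> carrier_mat n n" "accretive X" "num_range X \<subseteq> sector \<alpha>"
  shows "sectorial n (tan \<alpha>) X"
  unfolding sectorial_def
proof (intro conjI ballI impI assms)
  fix x :: "complex Matrix.vec" assume x: "x \<in> carrier_vec n"
  have *: "0 < Re (qform X x) \<and> \<bar>Im (qform X x)\<bar> \<le> tan \<alpha> * Re (qform X x)" if "x \<noteq> 0\<^sub>v n"
  proof -
    define N where "N = Re (x \<bullet>c x)"
    have N: "0 < N" using Re_cscalar_prod_self_pos[OF x that] by (simp add: N_def)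
    have NN: "x \<bullet>c x = of_real N"
      by (simp add: N_def complex_eq_iff cscalar_prod_sum[OF carrier_vec_dim_vec])
    define k where "k = 1 / sqrt N"
    have k: "k * k = 1 / N" using N by (simp add: k_def)
    define y where "y = complex_of_real k \<cdot>\<^sub>v x"
    have y: "y \<in> carrier_vec n" using x by (simp add: y_def)
    have "y \<bullet>c y = of_real (k * k * N)"
      using x by (simp add: y_def cscalar_prod_simps[where n=n] NN mult.assoc)
    then have "qform X y \<in> num_range X"
      using y assms(1) N k by (auto simp: num_range_def)
    then have "qform X y \<in> sector \<alpha>" using assms by blast
    moreover have "qform X y = of_real (k * k) * qform X x"
      using x assms(1) by (simp add: y_def qform_def mult_mat_vec cscalar_prod_simps[where n=n])
    ultimately have "0 < Re (qform X x) / N \<and> \<bar>Im (qform X x) / N\<bar> \<le> tan \<alpha> * (Re (qform X x) / N)"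
      unfolding k by (simp add: sector_def)
    then show ?thesis using N by (simp add: abs_div divide_le_cancel zero_less_divide_iff)
  qed
  then show "0 < Re (qform X x)" if "x \<noteq> 0\<^sub>v n" using that by blast
  show "\<bar>Im (qform X x)\<bar> \<le> tan \<alpha> * Re (qform X x)"
  proof (cases "x = 0\<^sub>v n")
    case True
    then have "qform X x = 0" using assms(1) by (simp add: qform_def scalar_prod_def)
    then show ?thesis by simp
  qed (use * in blast)
qed

text \<open>Expanding the sector condition \<open>0 \<le> T * Re (qform X x) \<mp> Im (qform X x)\<close> at
  \<open>x = v - (1 \<plusminus> iT) z\<close> and adding the two inequalities leaves exactly the claim multiplied by
  \<open>2 * T\<close>.  A larger \<open>T\<close> gives a weaker condition, so \<open>T = 0\<close> is reached as a limit.\<close>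
lemma sectorial_two_Re_le:
  assumes X: "sectorial n T X" and T: "0 \<le> T" and v: "v \<in> carrier_vec n" and z: "z \<in> carrier_vec n"
  shows "2 * Re ((X *\<^sub>v v) \<bullet>c z) \<le> Re (qform X v) + (1 + T\<^sup>2) * Re (qform X z)"
proof -
  have car: "X \<in> carrier_mat n n" using X by (simp add: sectorial_def)
  have nonneg: "0 \<le> Re (qform X x)" if "x \<in> carrier_vec n" for x
  proof (cases "x = 0\<^sub>v n")
    case True
    then have "qform X x = 0" using car by (simp add: qform_def scalar_prod_def)
    then show ?thesis by simp
  qed (use X that in \<open>auto simp: sectorial_def less_imp_le\<close>)
  define p q r w where "p = qform X v" and "q = (X *\<^sub>v v) \<bullet>c z"
    and "r = (X *\<^sub>v z) \<bullet>c v" and "w = qform X z"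
  have expand: "qform X (v + c \<cdot>\<^sub>v z) = p + cnj c * q + c * r + c * cnj c * w" for c
    using v z car unfolding p_def q_def r_def w_def qform_def
    by (simp add: mult_add_distrib_mat_vec[where nr=n and nc=n] mult_mat_vec cscalar_prod_simps[where n=n]
        algebra_simps)
  have ineq: "2 * Re q \<le> Re p + (1 + S\<^sup>2) * Re w" if S: "T < S" for S
  proof -
    have sec: "\<bar>Im (qform X x)\<bar> \<le> S * Re (qform X x)" if "x \<in> carrier_vec n" for x
    proof -
      have "\<bar>Im (qform X x)\<bar> \<le> T * Re (qform X x)"
        using X that by (simp add: sectorial_def)
      also have "\<dots> \<le> S * Re (qform X x)"
        using S nonneg[OF that] by (intro mult_right_mono) auto
      finally show ?thesis .
    qed
    have "\<bar>Im (qform X (v + c \<cdot>\<^sub>v z))\<bar> \<le> S * Re (qform X (v + c \<cdot>\<^sub>v z))" for c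
      by (rule sec) (use v z in auto)
    from this[of "- Complex 1 S"] this[of "- Complex 1 (- S)"]
    have "0 \<le> 2 * S * (Re p + (1 + S\<^sup>2) * Re w - 2 * Re q)"
      unfolding expand by (simp add: algebra_simps power2_eq_square abs_le_iff)
    then show ?thesis using S T by (simp add: zero_le_mult_iff)
  qed
  have "((\<lambda>S. Re p + (1 + S\<^sup>2) * Re w) \<longlongrightarrow> Re p + (1 + T\<^sup>2) * Re w) (at_right T)"
    by (intro tendsto_intros)
  moreover have "eventually (\<lambda>S. 2 * Re q \<le> Re p + (1 + S\<^sup>2) * Re w) (at_right T)"
    using eventually_at_right_less[of T] by eventually_elim (rule ineq)
  ultimately show ?thesis
    unfolding p_def q_def w_def by (intro tendsto_lowerbound) auto
qed

text \<open>Let Q be the left-hand side. Expanding \<open>x\<close> by \<open>x1\<close> gives Q = s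
  Re<Xv,v> + (1 - s)|Xv|^2, expanding it by \<open>x2\<close> gives cross terms. Estimating twice
  the cross terms yields 2Q <= Q + bound, and Q cancels. Only the \<open>z\<close> term needs the
  sectorial estimate; the coefficient of |y|^2 is enlarged so that the factor can be pulled
  out.\<close>

lemma Re_kernel_form_le:
  assumes X: "sectorial n T X" and T: "0 \<le> T" and s: "0 \<le> s" "s \<le> 1"
    and v: "v \<in> carrier_vec n" and z: "z \<in> carrier_vec n" and y: "y \<in> carrier_vec n"
    and x1: "x = of_real s \<cdot>\<^sub>v v + of_real (1 - s) \<cdot>\<^sub>v (X *\<^sub>v v)"
    and x2: "x = of_real s \<cdot>\<^sub>v z + of_real (1 - s) \<cdot>\<^sub>v y"
  shows "Re ((X *\<^sub>v v) \<bullet>c x) \<le> (1 + T\<^sup>2) * (s * Re (qform X z) + (1 - s) * Re (y \<bullet>c y))"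
proof -
  have Xv: "X *\<^sub>v v \<in> carrier_vec n" using X v by (auto simp: sectorial_def)
  have 1: "Re ((X *\<^sub>v v) \<bullet>c x) = s * Re (qform X v) + (1 - s) * Re ((X *\<^sub>v v) \<bullet>c (X *\<^sub>v v))"
    unfolding x1 using v Xv by (simp add: cscalar_prod_simps[where n=n] qform_def del: of_real_diff)
  have 2: "Re ((X *\<^sub>v v) \<bullet>c x) = s * Re ((X *\<^sub>v v) \<bullet>c z) + (1 - s) * Re ((X *\<^sub>v v) \<bullet>c y)"
    unfolding x2 using z y Xv by (simp add: cscalar_prod_simps[where n=n] del: of_real_diff)
  have "s * (2 * Re ((X *\<^sub>v v) \<bullet>c z)) \<le> s * (Re (qform X v) + (1 + T\<^sup>2) * Re (qform X z))"
    by (intro mult_left_mono sectorial_two_Re_le[OF X T v z] s)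
  moreover have "(1 - s) * (2 * Re ((X *\<^sub>v v) \<bullet>c y)) \<le> (1 - s) * (Re ((X *\<^sub>v v) \<bullet>c (X *\<^sub>v v)) + Re (y \<bullet>c y))"
    using s by (intro mult_left_mono two_Re_cscalar_prod_le[OF Xv y]) auto
  moreover have "0 \<le> T\<^sup>2 * ((1 - s) * Re (y \<bullet>c y))"
    using s by (intro mult_nonneg_nonneg Re_cscalar_prod_self_nonneg) auto
  ultimately show ?thesis using 1 2 by (simp add: algebra_simps)
qed

text \<open>The matrix s I + (1 - s) X has positive definite real part, so it is injective and the
  adjugate formula solves the equation. Strict positivity comes from X when \<open>s = 0\<close> and
  from the identity otherwise.\<close>

lemma kernel_equation_solvable:
  assumes X: "sectorial n T X" and s: "0 \<le> s" "s \<le> 1" and x: "x \<in> carrier_vec n"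
  obtains v where "v \<in> carrier_vec n" "x = of_real s \<cdot>\<^sub>v v + of_real (1 - s) \<cdot>\<^sub>v (X *\<^sub>v v)"
proof -
  have car: "X \<in> carrier_mat n n" using X by (simp add: sectorial_def)
  define Y where "Y = complex_of_real s \<cdot>\<^sub>m 1\<^sub>m n + complex_of_real (1 - s) \<cdot>\<^sub>m X"
  have Y: "Y \<in> carrier_mat n n" using car by (simp add: Y_def)
  have Yv: "Y *\<^sub>v v = of_real s \<cdot>\<^sub>v v + of_real (1 - s) \<cdot>\<^sub>v (X *\<^sub>v v)" if "v \<in> carrier_vec n" for v
    using that car unfolding Y_def
    by (simp add: add_mult_distrib_mat_vec[where nr=n and nc=n] smult_mat_mult_vec[where n=n and m=n] del: of_real_diff)
  have "Determinant.det Y \<noteq> 0"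
  proof
    assume "Determinant.det Y = 0"
    then obtain v where v: "v \<in> carrier_vec n" "v \<noteq> 0\<^sub>v n" "Y *\<^sub>v v = 0\<^sub>v n"
      using det_0_iff_vec_prod_zero_field[OF Y] by auto
    have "(Y *\<^sub>v v) \<bullet>c v = of_real s * (v \<bullet>c v) + of_real (1 - s) * qform X v"
      unfolding Yv[OF v(1)] using v(1) car
      by (simp add: cscalar_prod_simps[where n=n] qform_def del: of_real_diff)
    moreover have "(Y *\<^sub>v v) \<bullet>c v = 0" using v by (simp add: scalar_prod_def)
    ultimately have "0 = s * Re (v \<bullet>c v) + (1 - s) * Re (qform X v)"
      by (simp add: complex_eq_iff del: of_real_diff)
    also have "\<dots> > 0"
    proof (cases "s = 0")
      case False
      then show ?thesis
        using X v s Re_cscalar_prod_self_pos[OF v(1,2)]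
        by (intro add_pos_nonneg mult_pos_pos mult_nonneg_nonneg) (auto simp: sectorial_def less_imp_le)
    qed (use X v in \<open>auto simp: sectorial_def\<close>)
    finally show False by simp
  qed
  moreover define v where "v = (1 / Determinant.det Y) \<cdot>\<^sub>v (adj_mat Y *\<^sub>v x)"
  moreover have "adj_mat Y \<in> carrier_mat n n" "Y * adj_mat Y = Determinant.det Y \<cdot>\<^sub>m 1\<^sub>m n"
    using adj_mat[OF Y] by auto
  ultimately have "v \<in> carrier_vec n" "Y *\<^sub>v v = x"
    using Y x by (auto simp: mult_mat_vec smult_mat_mult_vec smult_smult_assoc simp flip: assoc_mult_mat_vec)
  with Yv that show ?thesis by metis
qed

section \<open>Resolvents and contour integrals\<close>

definition resolvent :: "complex Matrix.mat \<Rightarrow> complex \<Rightarrow> complex Matrix.mat" where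
  "resolvent X z = mat_inv (z \<cdot>\<^sub>m 1\<^sub>m (dim_row X) - X)"

definition eigenvalues :: "complex Matrix.mat \<Rightarrow> complex set" where
  "eigenvalues X = {w. eigenvalue X w}"

lemma eigenvalue_iff_det:
  assumes X: "X \<in> carrier_mat n n"
  shows "z \<in> eigenvalues X \<longleftrightarrow> Determinant.det (z \<cdot>\<^sub>m 1\<^sub>m n - X) = 0"
proof -
  have "char_matrix X z = - (z \<cdot>\<^sub>m 1\<^sub>m n - X)"
    using X by (intro eq_matI) (auto simp: char_matrix_def)
  then show ?thesis
    unfolding eigenvalues_def mem_Collect_eq eigenvalue_det[OF X]
    using det_0_negate[OF minus_carrier_mat[OF X]] by simp
qed

lemma finite_eigenvalues:
  assumes X: "X \<in> carrier_mat n n"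
  shows "finite (eigenvalues X)"
proof -
  have "char_poly X \<noteq> 0" using degree_monic_char_poly[OF X] by auto
  then have "finite {w. poly (char_poly X) w = 0}" by (rule poly_roots_finite)
  then show ?thesis by (simp add: eigenvalues_def eigenvalue_root_char_poly[OF X])
qed

lemma open_Compl_eigenvalues: "X \<in> carrier_mat n n \<Longrightarrow> open (- eigenvalues X)"
  using finite_eigenvalues finite_imp_closed by blast

text \<open>\<open>mat_inv\<close> is a choice; uniqueness of inverses identifies it with the
  adjugate quotient, which shows that the entries are rational functions of
  \<open>z\<close>.\<close>

lemma resolvent_eq_adj_mat:
  assumes X: "X \<in> carrier_mat n n" and z: "z \<notin> eigenvalues X"
  shows "resolvent X z = (1 / Determinant.det (z \<cdot>\<^sub>m 1\<^sub>m n - X)) \<cdot>\<^sub>m adj_mat (z \<cdot>\<^sub>m 1\<^sub>m n - X)"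
    (is "_ = ?R")
    and "resolvent X z \<in> carrier_mat n n"
    and "resolvent X z * (z \<cdot>\<^sub>m 1\<^sub>m n - X) = 1\<^sub>m n"
proof -
  define Y where "Y = z \<cdot>\<^sub>m 1\<^sub>m n - X"
  have Y: "Y \<in> carrier_mat n n" unfolding Y_def by (rule minus_carrier_mat[OF X])
  have det: "Determinant.det Y \<noteq> 0" using z eigenvalue_iff_det[OF X] by (simp add: Y_def)
  define R where "R = (1 / Determinant.det Y) \<cdot>\<^sub>m adj_mat Y"
  have adj: "adj_mat Y \<in> carrier_mat n n" using adj_mat[OF Y] by simp
  have one: "(1 / Determinant.det Y) \<cdot>\<^sub>m (Determinant.det Y \<cdot>\<^sub>m 1\<^sub>m n) = 1\<^sub>m n"
    using det by (intro eq_matI) auto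
  have R: "R \<in> carrier_mat n n" "Y * R = 1\<^sub>m n" "R * Y = 1\<^sub>m n"
    using adj adj_mat(2,3)[OF Y] one
    by (simp_all add: R_def mult_smult_distrib[OF Y adj] mult_smult_assoc_mat[OF adj Y])
  have dim: "dim_row X = n" "dim_row Y = n" using X Y by auto
  have "resolvent X z = (SOME M. M \<in> carrier_mat n n \<and> Y * M = 1\<^sub>m n \<and> M * Y = 1\<^sub>m n)"
    by (simp add: resolvent_def mat_inv_def dim flip: Y_def)
  also have "\<dots> = R"
  proof (rule some_equality)
    fix M assume M: "M \<in> carrier_mat n n \<and> Y * M = 1\<^sub>m n \<and> M * Y = 1\<^sub>m n"
    then have "M = M * (Y * R)" using R right_mult_one_mat[of M n n] by simp
    also have "\<dots> = M * Y * R" using M R Y assoc_mult_mat[of M n n Y n R n] by metis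
    also have "\<dots> = R" using M R by simp
    finally show "M = R" .
  qed (use R in simp)
  finally show "resolvent X z = ?R" "resolvent X z \<in> carrier_mat n n"
    "resolvent X z * (z \<cdot>\<^sub>m 1\<^sub>m n - X) = 1\<^sub>m n"
    using R by (simp_all add: R_def Y_def)
qed

lemma det_holomorphic:
  assumes "\<And>z. F z \<in> carrier_mat m m"
    and "\<And>i j. i < m \<Longrightarrow> j < m \<Longrightarrow> (\<lambda>z. F z $$ (i, j)) holomorphic_on S"
  shows "(\<lambda>z. Determinant.det (F z)) holomorphic_on S"
  unfolding det_def'[OF assms(1)]
  by (intro holomorphic_intros assms(2)) (auto dest: permutes_in_image)

lemma resolvent_holomorphic:
  assumes X: "X \<in> carrier_mat n n" and ij: "i < n" "j < n"
  shows "(\<lambda>z. resolvent X z $$ (i, j)) holomorphic_on - eigenvalues X"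
proof -
  define Y where "Y z = z \<cdot>\<^sub>m 1\<^sub>m n - X" for z
  have Y: "Y z \<in> carrier_mat n n" for z unfolding Y_def by (rule minus_carrier_mat[OF X])
  have entry: "(\<lambda>z. Y z $$ (k, l)) holomorphic_on S" if "k < n" "l < n" for k l S
    using that X by (cases "k = l") (auto simp: Y_def intro!: holomorphic_intros)
  have "(\<lambda>z. Determinant.det (mat_delete (Y z) j i)) holomorphic_on S" for S
  proof (rule det_holomorphic[where m = "n - 1"])
    show "mat_delete (Y z) j i \<in> carrier_mat (n - 1) (n - 1)" for z
      by (rule mat_delete_carrier[OF Y])
    show "(\<lambda>z. mat_delete (Y z) j i $$ (k, l)) holomorphic_on S" if "k < n - 1" "l < n - 1" for k l
    proof -
      have "mat_delete (Y z) j i $$ (k, l) = Y z $$ (if k < j then k else Suc k, if l < i then l else Suc l)" for z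
        using Y[of z] that by (auto simp: mat_delete_def)
      with entry[of "if k < j then k else Suc k" "if l < i then l else Suc l" S] that show ?thesis
        by (auto split: if_splits)
    qed
  qed
  moreover have "(\<lambda>z. Determinant.det (Y z)) holomorphic_on S" for S
    by (rule det_holomorphic[where m = n]) (use Y entry in auto)
  ultimately have "(\<lambda>z. (1 / Determinant.det (Y z)) * ((-1) ^ (j + i) * Determinant.det (mat_delete (Y z) j i)))
      holomorphic_on - eigenvalues X"
    by (intro holomorphic_intros) (auto simp: eigenvalue_iff_det[OF X] Y_def)
  then show ?thesis
    by (rule holomorphic_transform)
      (use X ij in \<open>auto simp: resolvent_eq_adj_mat(1)[OF X] adj_mat_def cofactor_def Y_def\<close>)
qed

definition resolvent_form ::
    "complex Matrix.mat \<Rightarrow> complex Matrix.vec \<Rightarrow> complex Matrix.vec \<Rightarrow> complex \<Rightarrow> complex" where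
  "resolvent_form X u y z = (resolvent X z *\<^sub>v u) \<bullet>c y"

lemma resolvent_form_sum:
  assumes X: "X \<in> carrier_mat n n" and z: "z \<notin> eigenvalues X"
    and "u \<in> carrier_vec n" "y \<in> carrier_vec n"
  shows "resolvent_form X u y z = (\<Sum>i<n. \<Sum>j<n. resolvent X z $$ (i, j) * (u $ j * cnj (y $ i)))"
  using resolvent_eq_adj_mat(2)[OF X z] assms(3,4)
  by (auto simp: resolvent_form_def cscalar_prod_sum[where n=n] scalar_prod_def atLeast0LessThan sum_distrib_left
    sum_distrib_right mult_ac intro!: sum.cong)

lemma resolvent_form_holomorphic:
  assumes X: "X \<in> carrier_mat n n" and "u \<in> carrier_vec n" "y \<in> carrier_vec n"
  shows "resolvent_form X u y holomorphic_on - eigenvalues X"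
proof -
  have "(\<lambda>z. \<Sum>i<n. \<Sum>j<n. resolvent X z $$ (i, j) * (u $ j * cnj (y $ i))) holomorphic_on - eigenvalues X"
    by (intro holomorphic_intros resolvent_holomorphic[OF X]) auto
  then show ?thesis
    by (rule holomorphic_transform) (use resolvent_form_sum[OF X] assms in auto)
qed

lemma resolvent_form_add:
  assumes X: "X \<in> carrier_mat n n" and z: "z \<notin> eigenvalues X"
    and "u \<in> carrier_vec n" "v \<in> carrier_vec n" "y \<in> carrier_vec n"
  shows "resolvent_form X (u + v) y z = resolvent_form X u y z + resolvent_form X v y z"
  using assms(3-) resolvent_eq_adj_mat(2)[OF X z]
  by (simp add: resolvent_form_def mult_add_distrib_mat_vec[where nr=n and nc=n] cscalar_prod_simps[where n=n])

lemma resolvent_form_smult: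
  assumes X: "X \<in> carrier_mat n n" and z: "z \<notin> eigenvalues X"
    and "u \<in> carrier_vec n" "y \<in> carrier_vec n"
  shows "resolvent_form X (c \<cdot>\<^sub>v u) y z = c * resolvent_form X u y z"
  using assms(3-) resolvent_eq_adj_mat(2)[OF X z]
  by (simp add: resolvent_form_def mult_mat_vec[where nr=n and nc=n] cscalar_prod_simps[where n=n])

text \<open>This is R(z) X = z R(z) - I. It drives the recursion along a triangularising basis and
  the reduction of kernel integrals to resolvent integrals.\<close>

lemma resolvent_form_mult:
  assumes X: "X \<in> carrier_mat n n" and z: "z \<notin> eigenvalues X"
    and u: "u \<in> carrier_vec n" and y: "y \<in> carrier_vec n"
  shows "resolvent_form X (X *\<^sub>v u) y z = z * resolvent_form X u y z - u \<bullet>c y"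
proof -
  note R = resolvent_eq_adj_mat(2,3)[OF X z]
  have Xu: "X *\<^sub>v u \<in> carrier_vec n" using X u by simp
  have Y: "z \<cdot>\<^sub>m 1\<^sub>m n - X \<in> carrier_mat n n" by (rule minus_carrier_mat[OF X])
  have "u = resolvent X z *\<^sub>v ((z \<cdot>\<^sub>m 1\<^sub>m n - X) *\<^sub>v u)"
    using R u Y by (simp flip: assoc_mult_mat_vec[of _ n n _ n])
  also have "(z \<cdot>\<^sub>m 1\<^sub>m n - X) *\<^sub>v u = z \<cdot>\<^sub>v u + (-1) \<cdot>\<^sub>v (X *\<^sub>v u)"
  proof -
    have "(z \<cdot>\<^sub>m 1\<^sub>m n) *\<^sub>v u = z \<cdot>\<^sub>v u"
      using u by (simp add: smult_mat_mult_vec[where n=n and m=n])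
    then show ?thesis
      using X u Xu by (simp add: minus_mult_distrib_mat_vec[where nr=n and nc=n] minus_add_uminus_vec[where n=n]
          uminus_vec_def smult_vec_def) (intro eq_vecI; auto)
  qed
  finally have "u \<bullet>c y = resolvent_form X (z \<cdot>\<^sub>v u + (-1) \<cdot>\<^sub>v (X *\<^sub>v u)) y z"
    by (simp add: resolvent_form_def)
  then show ?thesis
    using u y Xu by (simp add: resolvent_form_add[OF X z] resolvent_form_smult[OF X z])
qed

text \<open>Two distinct poles are separated by partial fractions; by induction the two resulting
  integrals depend only on the number of poles, hence cancel. If all poles coincide and there are at
  least two, the integrand has a primitive.\<close>

lemma has_contour_integral_inverse_product:
  assumes \<gamma>: "valid_path \<gamma>" "pathfinish \<gamma> = pathstart \<gamma>"
    and "\<And>u. u \<in># U \<Longrightarrow> u \<notin> path_image \<gamma> \<and> winding_number \<gamma> u = 1" and "U \<noteq> {#}"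
  shows "((\<lambda>z. \<Prod>u\<in>#U. 1 / (z - u)) has_contour_integral (if size U = 1 then 2 * pi * \<i> else 0)) \<gamma>"
  using assms(3,4)
proof (induction "size U" arbitrary: U rule: less_induct)
  case less
  show ?case
  proof (cases "\<exists>u\<in>#U. \<exists>u'\<in>#U. u \<noteq> u'")
    case True
    then obtain u u' where u: "u \<in># U" "u' \<in># U" "u \<noteq> u'" by blast
    then obtain V where V: "U = {#u, u'#} + V"
      by (metis add_mset_add_single insert_DiffM insert_noteq_member union_mset_add_mset_left
          add_cancel_left_left)
    let ?c = "if V = {#} then 2 * pi * \<i> else 0"
    have IH: "((\<lambda>z. \<Prod>u\<in>#add_mset a V. 1 / (z - u)) has_contour_integral ?c) \<gamma>" if "a = u \<or> a = u'" for a
    proof -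
      have "x \<notin> path_image \<gamma> \<and> winding_number \<gamma> x = 1" if "x \<in># add_mset a V" for x
        using less.prems(1)[of x] \<open>a = u \<or> a = u'\<close> that by (auto simp: V)
      from less.hyps[of "add_mset a V", OF _ this] show ?thesis
        by (simp add: V split del: if_split)
    qed
    have "((\<lambda>z. ((\<Prod>u\<in>#add_mset u V. 1 / (z - u)) - (\<Prod>u\<in>#add_mset u' V. 1 / (z - u))) / (u - u'))
        has_contour_integral (?c - ?c) / (u - u')) \<gamma>"
      by (intro has_contour_integral_div has_contour_integral_diff IH) auto
    moreover have "(?c - ?c) / (u - u') = (if size U = 1 then 2 * pi * \<i> else 0)"
      by (simp add: V)
    ultimately have "((\<lambda>z. ((\<Prod>u\<in>#add_mset u V. 1 / (z - u)) - (\<Prod>u\<in>#add_mset u' V. 1 / (z - u))) / (u - u'))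
        has_contour_integral (if size U = 1 then 2 * pi * \<i> else 0)) \<gamma>"
      by (simp only:)
    then show ?thesis
    proof (rule has_contour_integral_eq)
      fix z assume "z \<in> path_image \<gamma>"
      then have "z \<noteq> u" "z \<noteq> u'" using u less.prems by auto
      then have "1 / (z - u) - 1 / (z - u') = (u - u') * (1 / (z - u) * (1 / (z - u')))"
        by (simp add: field_simps)
      then have "(1 / (z - u) - 1 / (z - u')) * P / (u - u') = 1 / (z - u) * (1 / (z - u')) * P" for P
        using u(3) by simp
      then show "((\<Prod>u\<in>#add_mset u V. 1 / (z - u)) - (\<Prod>u\<in>#add_mset u' V. 1 / (z - u))) / (u - u')
          = (\<Prod>u\<in>#U. 1 / (z - u))"
        by (simp add: V left_diff_distrib)
    qed
  next
    case False
    obtain u where u: "u \<in># U" using less.prems by blast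
    with False have "U = replicate_mset (size U) u"
      by (metis set_mset_subset_singletonD subsetI singletonI)
    then obtain k where U: "U = replicate_mset (Suc k) u"
      using less.prems(2) by (metis not0_implies_Suc size_eq_0_iff_empty)
    have u: "u \<notin> path_image \<gamma>" "winding_number \<gamma> u = 1" using less.prems(1)[OF u] by auto
    show ?thesis
    proof (cases "k = 0")
      case True
      then show ?thesis
        using has_contour_integral_winding_number[OF \<gamma>(1) u(1)] u(2) by (simp add: U)
    next
      case False
      have "((\<lambda>z. (1 / (z - u)) ^ Suc k) has_contour_integral 0) \<gamma>"
      proof (rule Cauchy_theorem_primitive[OF _ \<gamma>(1) _ \<gamma>(2)])
        show "path_image \<gamma> \<subseteq> - {u}" using u by auto
        fix z assume "z \<in> - {u}"
        then have z: "z - u \<noteq> 0" by auto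
        obtain m where m: "k = Suc m" using False by (cases k) auto
        have "((\<lambda>z. 1 / (z - u)) has_field_derivative - 1 / (z - u)\<^sup>2) (at z within - {u})"
          using z by (auto intro!: derivative_eq_intros simp: power2_eq_square)
        from DERIV_cmult[OF DERIV_power[OF this, of k], of "- (1 / of_nat k)"]
        have "((\<lambda>z. - (1 / of_nat k) * (1 / (z - u)) ^ k) has_field_derivative
          - (1 / of_nat k) * (of_nat k * (- 1 / (z - u)\<^sup>2 * (1 / (z - u)) ^ m))) (at z within - {u})"
          by (simp add: m)
        moreover have "- (1 / of_nat k) * (of_nat k * (- 1 / (z - u)\<^sup>2 * (1 / (z - u)) ^ m)) = (1 / (z - u)) ^ Suc k"
          using False by (simp add: m power2_eq_square del: of_nat_Suc)
        ultimately show "((\<lambda>z. - (1 / of_nat k) * (1 / (z - u)) ^ k) has_field_derivative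
            (1 / (z - u)) ^ Suc k) (at z within - {u})" by metis
      qed
      then show ?thesis using False by (simp add: U)
    qed
  qed
qed

locale resolvent_contour =
  fixes X :: "complex Matrix.mat" and n :: nat and \<gamma> :: "real \<Rightarrow> complex"
  assumes X: "X \<in> carrier_mat n n" and valid: "valid_path \<gamma>" and closed: "pathfinish \<gamma> = pathstart \<gamma>"
    and eig: "\<And>w. w \<in> eigenvalues X \<Longrightarrow> w \<notin> path_image \<gamma> \<and> winding_number \<gamma> w = 1"
begin

lemma path_avoids: "z \<in> path_image \<gamma> \<Longrightarrow> z \<notin> eigenvalues X"
  using eig by blast

lemma path_image_subset: "path_image \<gamma> \<subseteq> - eigenvalues X"
  using path_avoids by blast

text \<open>Carrying the extra factors \<open>1 / (z - u)\<close> along makes the induction over the columns of a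
  triangularising basis go through: each step back in the basis produces one such factor, and any
  factor kills the integral of the lower columns.\<close>
lemma has_contour_integral_resolvent_column:
  assumes P: "P \<in> carrier_mat n n" and T: "T \<in> carrier_mat n n" "upper_triangular T" and XP: "X * P = P * T"
    and diag: "\<And>i. i < n \<Longrightarrow> T $$ (i, i) \<in> eigenvalues X" and y: "y \<in> carrier_vec n"
    and "j < n" and "set_mset U \<subseteq> eigenvalues X"
  shows "((\<lambda>z. (\<Prod>u\<in>#U. 1 / (z - u)) * resolvent_form X (col P j) y z) has_contour_integral
      (if U = {#} then 2 * pi * \<i> * (col P j \<bullet>c y) else 0)) \<gamma>"
  using assms(7,8)
proof (induction j arbitrary: U rule: less_induct)
  case (less j)
  define w where "w = T $$ (j, j)"
  have w: "w \<in> eigenvalues X" using diag less.prems by (simp add: w_def)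
  have p: "col P i \<in> carrier_vec n" for i using P by (simp add: carrier_vecI)
  define V where "V = add_mset w U"
  have V: "set_mset V \<subseteq> eigenvalues X" "V \<noteq> {#}" using w less.prems by (auto simp: V_def)
  have "((\<lambda>z. \<Prod>u\<in>#V. 1 / (z - u)) has_contour_integral (if size V = 1 then 2 * pi * \<i> else 0)) \<gamma>"
    by (rule has_contour_integral_inverse_product[OF valid closed]) (use V eig in auto)
  from has_contour_integral_lmul[OF this, of "col P j \<bullet>c y"]
  have 1: "((\<lambda>z. (col P j \<bullet>c y) * (\<Prod>u\<in>#V. 1 / (z - u))) has_contour_integral
      (if U = {#} then 2 * pi * \<i> * (col P j \<bullet>c y) else 0)) \<gamma>"
    by (simp add: V_def mult_ac split: if_splits)
  have "((\<lambda>z. T $$ (i, j) * ((\<Prod>u\<in>#V. 1 / (z - u)) * resolvent_form X (col P i) y z))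
      has_contour_integral (T $$ (i, j) * 0)) \<gamma>" if "i < j" for i
    using less.IH[OF that _ V(1)] that less.prems V by (intro has_contour_integral_lmul) auto
  then have 2: "((\<lambda>z. \<Sum>i<j. T $$ (i, j) * ((\<Prod>u\<in>#V. 1 / (z - u)) * resolvent_form X (col P i) y z))
      has_contour_integral (\<Sum>i<j. T $$ (i, j) * 0)) \<gamma>"
    by (intro has_contour_integral_sum) auto
  show ?case
  proof (rule has_contour_integral_eq)
    show "((\<lambda>z. (col P j \<bullet>c y) * (\<Prod>u\<in>#V. 1 / (z - u)) +
        (\<Sum>i<j. T $$ (i, j) * ((\<Prod>u\<in>#V. 1 / (z - u)) * resolvent_form X (col P i) y z)))
      has_contour_integral (if U = {#} then 2 * pi * \<i> * (col P j \<bullet>c y) else 0)) \<gamma>"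
      using has_contour_integral_add[OF 1 2] by simp
    fix z assume "z \<in> path_image \<gamma>"
    then have z: "z \<notin> eigenvalues X" by (rule path_avoids)
    with w have zw: "z - w \<noteq> 0" by auto
    note R = resolvent_eq_adj_mat(2)[OF X z]
    have "resolvent_form X (X *\<^sub>v col P j) y z = (\<Sum>i<n. T $$ (i, j) * resolvent_form X (col P i) y z)"
    proof -
      have "X *\<^sub>v col P j = col (P * T) j"
        using X P less.prems by (subst XP[symmetric]) (auto intro: eq_vecI)
      also have "\<dots> = P *\<^sub>v col T j"
        using P T less.prems by (auto intro: eq_vecI)
      finally have "resolvent_form X (X *\<^sub>v col P j) y z =
          (\<Sum>k<n. (\<Sum>l<n. resolvent X z $$ (k, l) * (\<Sum>i<n. P $$ (l, i) * T $$ (i, j))) * cnj (y $ k))"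
        using R P T y less.prems
        by (simp add: resolvent_form_def cscalar_prod_sum[where n=n] scalar_prod_def atLeast0LessThan)
      also have "\<dots> = (\<Sum>k<n. \<Sum>l<n. \<Sum>i<n. T $$ (i, j) * (resolvent X z $$ (k, l) * (P $$ (l, i) * cnj (y $ k))))"
        by (simp add: sum_distrib_left sum_distrib_right mult_ac)
      also have "\<dots> = (\<Sum>k<n. \<Sum>i<n. \<Sum>l<n. T $$ (i, j) * (resolvent X z $$ (k, l) * (P $$ (l, i) * cnj (y $ k))))"
        by (intro sum.cong refl sum.swap)
      also have "\<dots> = (\<Sum>i<n. \<Sum>k<n. \<Sum>l<n. T $$ (i, j) * (resolvent X z $$ (k, l) * (P $$ (l, i) * cnj (y $ k))))"
        by (rule sum.swap)
      also have "\<dots> = (\<Sum>i<n. T $$ (i, j) * resolvent_form X (col P i) y z)"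
        using P y p by (intro sum.cong refl) (simp add: resolvent_form_sum[OF X z] sum_distrib_left)
      finally show ?thesis .
    qed
    \<comment> \<open>Triangularity of \<open>T\<close> leaves only the rows up to \<open>j\<close>;
      moving the diagonal term to the other side produces the factor
      \<open>1 / (z - w)\<close>.\<close>
    also have "\<dots> = (\<Sum>i<Suc j. T $$ (i, j) * resolvent_form X (col P i) y z)"
      using T less.prems by (intro sum.mono_neutral_right) (auto simp: upper_triangular_def)
    finally have "z * resolvent_form X (col P j) y z - col P j \<bullet>c y =
        (\<Sum>i<j. T $$ (i, j) * resolvent_form X (col P i) y z) + w * resolvent_form X (col P j) y z"
      using p y by (simp add: resolvent_form_mult[OF X z] w_def)
    then have "resolvent_form X (col P j) y z =
        1 / (z - w) * (col P j \<bullet>c y + (\<Sum>i<j. T $$ (i, j) * resolvent_form X (col P i) y z))"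
      using zw by (simp add: field_simps)
    then show "(col P j \<bullet>c y) * (\<Prod>u\<in>#V. 1 / (z - u)) +
        (\<Sum>i<j. T $$ (i, j) * ((\<Prod>u\<in>#V. 1 / (z - u)) * resolvent_form X (col P i) y z))
      = (\<Prod>u\<in>#U. 1 / (z - u)) * resolvent_form X (col P j) y z"
      by (simp add: V_def sum_distrib_left sum_distrib_right algebra_simps sum_divide_distrib add_divide_distrib)
  qed
qed

text \<open>The functional calculus applied to the constant 1: the contour winds once around the
  whole spectrum. The vector \<open>u\<close> is expanded in the columns of a basis that
  triangularises \<open>X\<close>.\<close>

lemma has_contour_integral_resolvent:
  assumes u: "u \<in> carrier_vec n" and y: "y \<in> carrier_vec n"
  shows "(resolvent_form X u y has_contour_integral 2 * pi * \<i> * (u \<bullet>c y)) \<gamma>"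
proof -
  obtain es where "char_poly X = (\<Prod>a\<leftarrow>es. [:- a, 1:])" using char_poly_factorized[OF X] by blast
  from schur_decomposition_exists[OF X this] obtain T where
    T: "T \<in> carrier_mat n n" "upper_triangular T" and sim: "similar_mat X T" by blast
  then obtain P Q where "similar_mat_wit X T P Q" by (auto simp: similar_mat_def)
  from similar_mat_witD2[OF X this]
  have PQ: "P * Q = 1\<^sub>m n" "Q * P = 1\<^sub>m n" "X = P * T * Q" "P \<in> carrier_mat n n" "Q \<in> carrier_mat n n"
    by auto
  have XP: "X * P = P * T"
    using PQ T by (simp add: assoc_mult_mat[of _ n n _ n _ n])
  have diag: "T $$ (i, i) \<in> eigenvalues X" if "i < n" for i
  proof -
    have "poly (char_poly T) (T $$ (i, i)) = 0"
      using that T by (auto simp: char_poly_upper_triangular[OF T] poly_prod_list prod_list_zero_iff diag_mat_def image_iff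
          intro!: bexI[of _ i])
    then show ?thesis
      by (simp add: eigenvalues_def eigenvalue_root_char_poly[OF X] char_poly_similar[OF sim])
  qed
  define v where "v = Q *\<^sub>v u"
  have v: "v \<in> carrier_vec n" "u = P *\<^sub>v v"
    using PQ u by (simp_all add: v_def flip: assoc_mult_mat_vec[of _ n n _ n])
  have p: "col P i \<in> carrier_vec n" for i using PQ by (simp add: carrier_vecI)
  \<comment> \<open>The pairing of \<open>u = P *\<^sub>v v\<close> with an arbitrary row
    \<open>c\<close>; it serves once for the values of the integrals and once for the
    integrands.\<close>
  have comb: "(\<Sum>j<n. v $ j * (\<Sum>k<n. c k * (col P j $ k))) = (\<Sum>k<n. c k * u $ k)" for c :: "nat \<Rightarrow> complex"
  proof -
    have "(\<Sum>k<n. c k * u $ k) = (\<Sum>k<n. \<Sum>j<n. v $ j * (c k * P $$ (k, j)))"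
      using PQ(4) v by (simp add: scalar_prod_def atLeast0LessThan sum_distrib_left mult_ac)
    also have "\<dots> = (\<Sum>j<n. \<Sum>k<n. v $ j * (c k * P $$ (k, j)))" by (rule sum.swap)
    finally show ?thesis using PQ(4) by (simp add: sum_distrib_left)
  qed
  have "((\<lambda>z. \<Sum>j<n. v $ j * resolvent_form X (col P j) y z) has_contour_integral
      (\<Sum>j<n. v $ j * (2 * pi * \<i> * (col P j \<bullet>c y)))) \<gamma>"
    using has_contour_integral_resolvent_column[OF PQ(4) T XP diag y, of _ "{#}"]
    by (intro has_contour_integral_sum has_contour_integral_lmul) auto
  moreover have "(\<Sum>j<n. v $ j * (2 * pi * \<i> * (col P j \<bullet>c y))) = 2 * pi * \<i> * (u \<bullet>c y)"
    using comb[of "\<lambda>k. 2 * pi * \<i> * cnj (y $ k)"] y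
    by (simp add: cscalar_prod_sum[where n=n] sum_distrib_left mult_ac)
  moreover have "(\<Sum>j<n. v $ j * resolvent_form X (col P j) y z) = resolvent_form X u y z"
    if "z \<in> path_image \<gamma>" for z
  proof -
    have z: "z \<notin> eigenvalues X" using that by (rule path_avoids)
    have "resolvent_form X a y z = (\<Sum>k<n. (\<Sum>i<n. resolvent X z $$ (i, k) * cnj (y $ i)) * a $ k)"
      if "a \<in> carrier_vec n" for a
    proof -
      have "resolvent_form X a y z = (\<Sum>k<n. \<Sum>i<n. resolvent X z $$ (i, k) * (a $ k * cnj (y $ i)))"
        unfolding resolvent_form_sum[OF X z that y] by (rule sum.swap)
      then show ?thesis by (simp add: sum_distrib_left mult_ac)
    qed
    with comb[of "\<lambda>k. \<Sum>i<n. resolvent X z $$ (i, k) * cnj (y $ i)"] u p show ?thesis by simp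
  qed
  ultimately show ?thesis by (auto intro: has_contour_integral_eq)
qed

end

section \<open>Harmonic mean kernels on the slit plane\<close>

text \<open>For nonzero \<open>z\<close> this is the weighted harmonic mean of 1 and
  \<open>z\<close>, with reciprocal (1 - s) + s / z.\<close>

definition mean_kernel :: "real \<Rightarrow> complex \<Rightarrow> complex" where
  "mean_kernel s z = z / (of_real s + of_real (1 - s) * z)"

lemma kernel_denominator_nonzero:
  assumes "z \<in> slit_plane" "0 \<le> s" "s \<le> 1"
  shows "of_real s + of_real (1 - s) * z \<noteq> 0"
proof
  assume "of_real s + of_real (1 - s) * z = 0"
  then have eq: "s + (1 - s) * Re z = 0" "(1 - s) * Im z = 0"
    by (simp_all add: complex_eq_iff)
  then have "s \<noteq> 1" by auto
  with eq(2) have "Im z = 0" by simp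
  with assms(1) have "0 < Re z" by (auto simp: slit_plane_def)
  then have "0 < (1 - s) * Re z" using \<open>s \<noteq> 1\<close> assms by (intro mult_pos_pos) auto
  with eq(1) assms(2) show False by linarith
qed

lemma slit_plane_eq: "slit_plane = - complex_of_real ` {..0}"
  by (auto simp: slit_plane_def complex_eq_iff image_iff)

lemma open_slit_plane: "open slit_plane"
  unfolding slit_plane_def by (intro open_Compl closed_Collect_conj closed_Collect_eq closed_Collect_le continuous_intros)

lemma starlike_slit_plane: "starlike slit_plane"
  unfolding slit_plane_eq by (rule starlike_slotted_complex_plane_left)

lemma kernel_holomorphic: "0 \<le> s \<Longrightarrow> s \<le> 1 \<Longrightarrow> mean_kernel s holomorphic_on slit_plane"
  unfolding mean_kernel_def by (intro holomorphic_intros) (use kernel_denominator_nonzero in auto)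

locale slit_resolvent_contour = resolvent_contour +
  assumes slit: "path_image \<gamma> \<subseteq> slit_plane"
begin

text \<open>That is, h_s(X) x = X v. After pairing with \<open>y\<close>, h_s(z) R(z) x differs from
  R(z) X v by a function holomorphic on the whole slit plane, whose integral over a closed path
  vanishes because the slit plane is starlike.\<close>

lemma has_contour_integral_kernel:
  assumes s: "0 \<le> s" "s \<le> 1" and v: "v \<in> carrier_vec n" and y: "y \<in> carrier_vec n"
    and x: "x = of_real s \<cdot>\<^sub>v v + of_real (1 - s) \<cdot>\<^sub>v (X *\<^sub>v v)"
  shows "((\<lambda>z. mean_kernel s z * resolvent_form X x y z) has_contour_integral
      2 * pi * \<i> * ((X *\<^sub>v v) \<bullet>c y)) \<gamma>"
proof -
  define c where "c = v \<bullet>c y"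
  have Xv: "X *\<^sub>v v \<in> carrier_vec n" using X v by simp
  note cauchy = Cauchy_theorem_starlike_simple[OF open_slit_plane starlike_slit_plane _ valid slit closed]
  have "((\<lambda>z. resolvent_form X (X *\<^sub>v v) y z + (c - of_real (1 - s) * c * mean_kernel s z)) has_contour_integral
      2 * pi * \<i> * ((X *\<^sub>v v) \<bullet>c y) + 0) \<gamma>"
    by (intro has_contour_integral_add has_contour_integral_resolvent[OF Xv y] cauchy
        holomorphic_intros kernel_holomorphic s)
  then have "((\<lambda>z. resolvent_form X (X *\<^sub>v v) y z + (c - of_real (1 - s) * c * mean_kernel s z)) has_contour_integral
      2 * pi * \<i> * ((X *\<^sub>v v) \<bullet>c y)) \<gamma>" by simp
  then show ?thesis
  proof (rule has_contour_integral_eq)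
    fix z assume "z \<in> path_image \<gamma>"
    then have z: "z \<notin> eigenvalues X" "z \<in> slit_plane" using path_avoids slit by auto
    define r where "r = resolvent_form X v y z"
    have mult: "resolvent_form X (X *\<^sub>v v) y z = z * r - c"
      by (simp add: resolvent_form_mult[OF X z(1) v y] r_def c_def)
    have "resolvent_form X x y z = of_real s * r + of_real (1 - s) * (z * r - c)"
      unfolding x using v Xv y
      by (simp add: resolvent_form_add[OF X z(1)] resolvent_form_smult[OF X z(1)] mult del: of_real_diff)
        (simp add: r_def)
    also have "\<dots> = (of_real s + of_real (1 - s) * z) * r - of_real (1 - s) * c"
      by (simp add: algebra_simps)
    finally have rf: "resolvent_form X x y z = (of_real s + of_real (1 - s) * z) * r - of_real (1 - s) * c" .
    have "mean_kernel s z * resolvent_form X x y z =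
        mean_kernel s z * (of_real s + of_real (1 - s) * z) * r - of_real (1 - s) * c * mean_kernel s z"
      unfolding rf right_diff_distrib by (simp only: mult_ac)
    also have "mean_kernel s z * (of_real s + of_real (1 - s) * z) = z"
      using kernel_denominator_nonzero[OF z(2) s] by (simp add: mean_kernel_def)
    finally show "resolvent_form X (X *\<^sub>v v) y z + (c - of_real (1 - s) * c * mean_kernel s z) =
        mean_kernel s z * resolvent_form X x y z"
      by (simp add: mult)
  qed
qed

lemma path_image_subset': "path_image \<gamma> \<subseteq> slit_plane \<inter> - eigenvalues X"
  using slit path_image_subset by blast

lemma open_domain: "open (slit_plane \<inter> - eigenvalues X)"
  using open_slit_plane open_Compl_eigenvalues[OF X] by blast

lemma integrable_resolvent_form:
  assumes "e holomorphic_on slit_plane" "u \<in> carrier_vec n" "y \<in> carrier_vec n"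
  shows "(\<lambda>z. e z * resolvent_form X u y z) contour_integrable_on \<gamma>"
  by (rule contour_integrable_holomorphic_simple[OF _ open_domain valid path_image_subset'])
    (intro holomorphic_intros holomorphic_on_subset[OF assms(1)]
      holomorphic_on_subset[OF resolvent_form_holomorphic[OF X assms(2,3)]]; auto)

lemma qform_contour_integral:
  assumes e: "e holomorphic_on slit_plane" and x: "x \<in> carrier_vec n"
  shows "qform (Matrix.mat n n (\<lambda>(i,j). contour_integral \<gamma> (\<lambda>z. e z * resolvent X z $$ (i,j)) / (2 * pi * \<i>))) x
    = contour_integral \<gamma> (\<lambda>z. e z * resolvent_form X x x z) / (2 * pi * \<i>)"
proof -
  have int: "(\<lambda>z. e z * resolvent X z $$ (i, j)) contour_integrable_on \<gamma>" if "i < n" "j < n" for i j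
    by (rule contour_integrable_holomorphic_simple[OF _ open_domain valid path_image_subset'])
      (intro holomorphic_intros holomorphic_on_subset[OF e]
        holomorphic_on_subset[OF resolvent_holomorphic[OF X that]]; auto)
  let ?I = "\<lambda>i j. contour_integral \<gamma> (\<lambda>z. e z * resolvent X z $$ (i, j))"
  have "((\<lambda>z. \<Sum>i<n. \<Sum>j<n. (e z * resolvent X z $$ (i, j)) * (x $ j * cnj (x $ i)))
      has_contour_integral (\<Sum>i<n. \<Sum>j<n. ?I i j * (x $ j * cnj (x $ i)))) \<gamma>"
    by (intro has_contour_integral_sum has_contour_integral_rmul has_contour_integral_integral int) auto
  then have "((\<lambda>z. e z * resolvent_form X x x z)
      has_contour_integral (\<Sum>i<n. \<Sum>j<n. ?I i j * (x $ j * cnj (x $ i)))) \<gamma>"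
    by (rule has_contour_integral_eq)
      (simp add: resolvent_form_sum[OF X path_avoids x x] sum_distrib_left mult_ac)
  then have "contour_integral \<gamma> (\<lambda>z. e z * resolvent_form X x x z) = (\<Sum>i<n. \<Sum>j<n. ?I i j * (x $ j * cnj (x $ i)))"
    by (rule contour_integral_unique)
  moreover have "qform (Matrix.mat n n (\<lambda>(i,j). ?I i j / (2 * pi * \<i>))) x
      = (\<Sum>i<n. (\<Sum>j<n. ?I i j / (2 * pi * \<i>) * x $ j) * cnj (x $ i))"
    using x by (simp add: qform_def cscalar_prod_sum[where n=n] scalar_prod_def atLeast0LessThan)
  ultimately show ?thesis
    by (simp add: sum_divide_distrib sum_distrib_left sum_distrib_right mult_ac)
qed

lemma contour_integral_tendsto:
  assumes e: "\<And>k. e k holomorphic_on slit_plane" and g: "g holomorphic_on slit_plane"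
    and lim: "\<And>K. compact K \<Longrightarrow> K \<subseteq> slit_plane \<Longrightarrow> uniform_limit K e g sequentially"
    and u: "u \<in> carrier_vec n" and y: "y \<in> carrier_vec n"
  shows "(\<lambda>k. contour_integral \<gamma> (\<lambda>z. e k z * resolvent_form X u y z))
    \<longlonglongrightarrow> contour_integral \<gamma> (\<lambda>z. g z * resolvent_form X u y z)"
proof -
  let ?\<phi> = "resolvent_form X u y"
  \<comment> \<open>The estimate for contour integrals asks for a bound on an open neighbourhood of
    the path; hence the compact thickening \<open>K\<close>, kept away from both the slit and the
    spectrum.\<close>
  have "compact (path_image \<gamma>)" using valid by (simp add: compact_valid_path_image)
  from compact_subset_open_imp_cball_epsilon_subset[OF this open_domain path_image_subset']
  obtain \<epsilon> where \<epsilon>: "0 < \<epsilon>" "(\<Union>x\<in>path_image \<gamma>. cball x \<epsilon>) \<subseteq> slit_plane \<inter> - eigenvalues X" .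
  define S where "S = (\<Union>x\<in>path_image \<gamma>. ball x \<epsilon>)"
  define K where "K = (\<Union>x\<in>path_image \<gamma>. cball x \<epsilon>)"
  have S: "open S" "path_image \<gamma> \<subseteq> S" "S \<subseteq> K" using \<epsilon>(1) by (auto simp: S_def K_def)
  have "K = {x + y |x y. x \<in> path_image \<gamma> \<and> y \<in> cball 0 \<epsilon>}"
  proof (intro equalityI subsetI)
    fix z assume "z \<in> K"
    then obtain x where "x \<in> path_image \<gamma>" "z \<in> cball x \<epsilon>" by (auto simp: K_def)
    then show "z \<in> {x + y |x y. x \<in> path_image \<gamma> \<and> y \<in> cball 0 \<epsilon>}"
      by (intro CollectI exI[of _ x] exI[of _ "z - x"]) (auto simp: dist_norm norm_minus_commute)
  qed (force simp: K_def dist_norm)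
  then have K: "compact K"
    using compact_sums[OF \<open>compact (path_image \<gamma>)\<close> compact_cball[of 0 \<epsilon>]] by simp
  have KD: "K \<subseteq> slit_plane" "K \<subseteq> - eigenvalues X" using \<epsilon>(2) by (auto simp: K_def)
  have phi: "?\<phi> holomorphic_on K"
    using resolvent_form_holomorphic[OF X u y] KD(2) by (rule holomorphic_on_subset)
  then have "bounded (?\<phi> ` K)"
    by (intro compact_imp_bounded compact_continuous_image holomorphic_on_imp_continuous_on K)
  then obtain M where M: "0 < M" "\<And>z. z \<in> K \<Longrightarrow> norm (?\<phi> z) \<le> M"
    by (auto simp: bounded_pos)
  from contour_integral_bound_exists[OF S(1) valid S(2)]
  obtain L where L: "0 < L" "\<And>f B. f holomorphic_on S \<Longrightarrow> (\<And>z. z \<in> S \<Longrightarrow> norm (f z) \<le> B)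
      \<Longrightarrow> norm (contour_integral \<gamma> f) \<le> L * B"
    by blast
  have hol: "e k holomorphic_on S" "g holomorphic_on S" "?\<phi> holomorphic_on S" for k
    using e g phi KD S(3) by (meson holomorphic_on_subset order_trans)+
  show ?thesis
  proof (rule tendstoI)
    fix r :: real assume r: "0 < r"
    define \<eta> where "\<eta> = r / (2 * L * M)"
    have \<eta>: "0 < \<eta>" using r L M by (simp add: \<eta>_def)
    from uniform_limitD[OF lim[OF K KD(1)] \<eta>]
    show "eventually (\<lambda>k. dist (contour_integral \<gamma> (\<lambda>z. e k z * ?\<phi> z)) (contour_integral \<gamma> (\<lambda>z. g z * ?\<phi> z)) < r) sequentially"
    proof eventually_elim
      case (elim k)
      have "norm (contour_integral \<gamma> (\<lambda>z. (e k z - g z) * ?\<phi> z)) \<le> L * (\<eta> * M)"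
      proof (rule L(2))
        show "(\<lambda>z. (e k z - g z) * ?\<phi> z) holomorphic_on S"
          by (intro holomorphic_intros hol)
        fix z assume "z \<in> S"
        then show "norm ((e k z - g z) * ?\<phi> z) \<le> \<eta> * M"
          using elim M S(3) \<eta> unfolding norm_mult dist_norm
          by (intro mult_mono) (auto intro: less_imp_le)
      qed
      also have "L * (\<eta> * M) < r" using r L M by (simp add: \<eta>_def)
      also have "contour_integral \<gamma> (\<lambda>z. (e k z - g z) * ?\<phi> z) =
          contour_integral \<gamma> (\<lambda>z. e k z * ?\<phi> z) - contour_integral \<gamma> (\<lambda>z. g z * ?\<phi> z)"
        unfolding left_diff_distrib
        by (intro contour_integral_diff integrable_resolvent_form e g u y)
      finally show ?case by (simp add: dist_norm)
    qed
  qed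
qed

end

lemma sectorial_eigenvalue_Re_pos:
  assumes X: "sectorial n T X" and w: "w \<in> eigenvalues X"
  shows "0 < Re w"
proof -
  have car: "X \<in> carrier_mat n n" using X by (simp add: sectorial_def)
  obtain v where v: "v \<in> carrier_vec n" "v \<noteq> 0\<^sub>v n" "X *\<^sub>v v = w \<cdot>\<^sub>v v"
    using w car by (auto simp: eigenvalues_def eigenvalue_def eigenvector_def)
  have "Im (v \<bullet>c v) = 0" by (simp add: cscalar_prod_sum[OF carrier_vec_dim_vec])
  moreover have "qform X v = w * (v \<bullet>c v)"
    using v by (simp add: qform_def cscalar_prod_simps[where n=n])
  ultimately have "Re (qform X v) = Re w * Re (v \<bullet>c v)" by simp
  moreover have "0 < Re (qform X v)" using X v by (auto simp: sectorial_def)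
  ultimately show ?thesis
    using Re_cscalar_prod_self_pos[OF v(1,2)] by (simp add: zero_less_mult_iff)
qed

lemma finite_right_half_plane_in_ball:
  assumes "finite W" "\<And>w. w \<in> W \<Longrightarrow> 0 < Re w"
  obtains c r :: real where "0 < r" "r < c" "\<And>w. w \<in> W \<Longrightarrow> norm (w - of_real c) < r"
proof -
  obtain \<delta> :: real where \<delta>: "0 < \<delta>" "\<And>w. w \<in> W \<Longrightarrow> \<delta> \<le> Re w"
  proof (cases "W = {}")
    case False
    show ?thesis
      by (rule that[of "Min (Re ` W)"]) (use assms False in auto)
  qed (use that[of 1] in auto)
  obtain M where M: "0 < M" "\<And>w. w \<in> W \<Longrightarrow> norm w \<le> M"
    using finite_imp_bounded[OF assms(1)] by (auto simp: bounded_pos)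
  \<comment> \<open>A disc of centre c and radius c - \<delta>/2 stays \<delta>/2 away from the
    imaginary axis. It contains \<open>w\<close> once M^2 - 2c\<delta> + c^2 < (c - \<delta>/2)^2,
    that is M^2 < c\<delta> + \<delta>^2/4; this choice makes c\<delta> = \<delta>^2 + M^2.\<close>
  define c where "c = \<delta> + M\<^sup>2 / \<delta>"
  have c: "\<delta> \<le> c" "c * \<delta> = \<delta>\<^sup>2 + M\<^sup>2" using \<delta> M by (auto simp: c_def field_simps power2_eq_square)
  show ?thesis
  proof (rule that[of "c - \<delta> / 2" c])
    fix w assume w: "w \<in> W"
    have "(norm (w - of_real c))\<^sup>2 = (norm w)\<^sup>2 - 2 * c * Re w + c\<^sup>2"
      by (simp add: cmod_power2 power2_diff)
    also have "\<dots> \<le> M\<^sup>2 - 2 * c * \<delta> + c\<^sup>2"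
      using M(2)[OF w] \<delta> w c(1) by (intro add_right_mono diff_mono power_mono mult_left_mono) auto
    also have "\<dots> < (c - \<delta> / 2)\<^sup>2"
    proof -
      have "(c - \<delta> / 2)\<^sup>2 = c\<^sup>2 - c * \<delta> + \<delta>\<^sup>2 / 4" by (simp add: power2_eq_square field_simps)
      moreover have "0 < \<delta>\<^sup>2" using \<delta> by simp
      ultimately show ?thesis using c(2) by linarith
    qed
    finally show "norm (w - of_real c) < c - \<delta> / 2"
      by (rule power_less_imp_less_base) (use c \<delta> in auto)
  qed (use c \<delta> in auto)
qed

text \<open>Ensures that the choice in \<open>hol_fun\<close> is made from a nonempty set: the
  spectrum lies in a disc inside the right half plane.\<close>

lemma admissible_contour_exists:
  assumes X: "sectorial n T X"
  shows "\<exists>\<gamma>. admissible_contour X \<gamma>"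
proof -
  have "X \<in> carrier_mat n n" using X by (simp add: sectorial_def)
  then have "finite (eigenvalues X)" by (rule finite_eigenvalues)
  then obtain c r where cr: "0 < r" "r < c" "\<And>w. w \<in> eigenvalues X \<Longrightarrow> norm (w - of_real c) < r"
    using finite_right_half_plane_in_ball sectorial_eigenvalue_Re_pos[OF X] by metis
  have "admissible_contour X (circlepath (of_real c) r)"
    unfolding admissible_contour_def
  proof (intro conjI allI impI)
    show "path_image (circlepath (of_real c) r) \<subseteq> slit_plane"
    proof
      fix z assume "z \<in> path_image (circlepath (complex_of_real c) r)"
      then have "norm (of_real c - z) = r" using cr(1) by (simp add: dist_norm)
      then have "\<bar>c - Re z\<bar> \<le> r" using abs_Re_le_cmod[of "of_real c - z"] by simp
      then show "z \<in> slit_plane" using cr(2) by (auto simp: slit_plane_def)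
    qed
    fix w assume "eigenvalue X w"
    then have w: "norm (w - of_real c) < r" using cr(3) by (simp add: eigenvalues_def)
    then show "w \<notin> path_image (circlepath (of_real c) r)" by (rule notin_path_image_circlepath)
    show "winding_number (circlepath (of_real c) r) w = 1"
      by (rule winding_number_circlepath[OF w])
  qed (use cr in \<open>auto simp: simple_path_circlepath\<close>)
  then show ?thesis by blast
qed

text \<open>Nothing is retained about the chosen \<open>\<gamma>\<close> beyond the locale
  conditions, so the three matrices of the theorem may come with unrelated contours.\<close>

lemma hol_fun_qform:
  assumes X: "sectorial n T X" and g: "g holomorphic_on slit_plane"
  obtains \<gamma> where "slit_resolvent_contour X n \<gamma>" "hol_fun g X \<in> carrier_mat n n"
    "\<And>x. x \<in> carrier_vec n \<Longrightarrow>
      qform (hol_fun g X) x = contour_integral \<gamma> (\<lambda>z. g z * resolvent_form X x x z) / (2 * pi * \<i>)"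
proof -
  have car: "X \<in> carrier_mat n n" using X by (simp add: sectorial_def)
  then have dim: "dim_row X = n" by simp
  define M where "M \<gamma> = Matrix.mat n n (\<lambda>(i,j). contour_integral \<gamma> (\<lambda>z. g z * resolvent X z $$ (i,j)) / (2 * pi * \<i>))" for \<gamma>
  have "\<exists>\<gamma>. admissible_contour X \<gamma> \<and> hol_fun g X = M \<gamma>"
    unfolding hol_fun_def M_def resolvent_def dim
    by (rule someI_ex) (use admissible_contour_exists[OF X] in blast)
  then obtain \<gamma> where \<gamma>: "admissible_contour X \<gamma>" "hol_fun g X = M \<gamma>" by blast
  interpret slit_resolvent_contour X n \<gamma>
    by unfold_locales (use \<gamma> car in \<open>auto simp: admissible_contour_def eigenvalues_def\<close>)
  show ?thesis
  proof (rule that[OF slit_resolvent_contour_axioms])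
    show "hol_fun g X \<in> carrier_mat n n" by (simp add: \<gamma> M_def)
  qed (unfold \<gamma>(2) M_def, rule qform_contour_integral[OF g])
qed

section \<open>The inequality on the hull of the kernels\<close>

text \<open>Mixing in a single kernel at a time still generates all finite convex combinations, and
  it is exactly the move made by the descent argument below.\<close>

inductive_set kernel_hull :: "(complex \<Rightarrow> complex) set" where
  kernel: "0 \<le> s \<Longrightarrow> s \<le> 1 \<Longrightarrow> mean_kernel s \<in> kernel_hull"
| mix: "e \<in> kernel_hull \<Longrightarrow> 0 \<le> \<tau> \<Longrightarrow> \<tau> \<le> 1 \<Longrightarrow> 0 \<le> s \<Longrightarrow> s \<le> 1 \<Longrightarrow>
    (\<lambda>z. of_real (1 - \<tau>) * e z + of_real \<tau> * mean_kernel s z) \<in> kernel_hull"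

lemma kernel_hull_holomorphic: "e \<in> kernel_hull \<Longrightarrow> e holomorphic_on slit_plane"
  by (induction rule: kernel_hull.induct) (auto intro!: holomorphic_intros kernel_holomorphic simp del: of_real_diff)

lemma kernel_of_real: "mean_kernel s (of_real x) = of_real (x / (s + (1 - s) * x))"
  by (simp add: mean_kernel_def)

lemma kernel_hull_real: "e \<in> kernel_hull \<Longrightarrow> Im (e (of_real x)) = 0"
  by (induction rule: kernel_hull.induct) (simp_all add: kernel_of_real del: of_real_diff)

text \<open>The kernel is jointly continuous on the compact set [0,1] x K, and convex combinations
  keep the bound. Uniformity over the hull is what Montel's theorem asks for.\<close>

lemma kernel_hull_bounded:
  assumes "compact K" "K \<subseteq> slit_plane"
  shows "\<exists>B. \<forall>e\<in>kernel_hull. \<forall>z\<in>K. norm (e z) \<le> B"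
proof -
  have "compact ({0..1::real} \<times> K)" using assms by (intro compact_Times) auto
  moreover have "continuous_on ({0..1} \<times> K) (\<lambda>(s, z). mean_kernel s z)"
    unfolding mean_kernel_def case_prod_beta using assms(2) kernel_denominator_nonzero
    by (intro continuous_intros) (auto simp del: of_real_diff)
  ultimately have "bounded ((\<lambda>(s, z). mean_kernel s z) ` ({0..1} \<times> K))"
    by (intro compact_imp_bounded compact_continuous_image)
  then obtain B where B: "\<And>s z. 0 \<le> s \<Longrightarrow> s \<le> 1 \<Longrightarrow> z \<in> K \<Longrightarrow> norm (mean_kernel s z) \<le> B"
    by (force simp: bounded_iff)
  have "norm (e z) \<le> B" if "e \<in> kernel_hull" "z \<in> K" for e z
    using that(1)
  proof (induction rule: kernel_hull.induct)
    case (mix e \<tau> s)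
    have "norm (of_real (1 - \<tau>) * e z + of_real \<tau> * mean_kernel s z) \<le> (1 - \<tau>) * norm (e z) + \<tau> * norm (mean_kernel s z)"
      using mix by (intro order_trans[OF norm_triangle_ineq]) (simp add: norm_mult del: of_real_diff)
    also have "\<dots> \<le> (1 - \<tau>) * B + \<tau> * B"
      using mix B that(2) by (intro add_mono mult_left_mono) auto
    finally show ?case by (simp add: algebra_simps)
  qed (use B that in blast)
  then show ?thesis by blast
qed

definition contour_form ::
    "complex Matrix.mat \<Rightarrow> (real \<Rightarrow> complex) \<Rightarrow> complex Matrix.vec \<Rightarrow> (complex \<Rightarrow> complex) \<Rightarrow> complex" where
  "contour_form X \<gamma> x e = contour_integral \<gamma> (\<lambda>z. e z * resolvent_form X x x z) / (2 * pi * \<i>)"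

context slit_resolvent_contour begin

lemma contour_form_kernel:
  assumes "0 \<le> s" "s \<le> 1" "v \<in> carrier_vec n" "x \<in> carrier_vec n"
    and "x = of_real s \<cdot>\<^sub>v v + of_real (1 - s) \<cdot>\<^sub>v (X *\<^sub>v v)"
  shows "contour_form X \<gamma> x (mean_kernel s) = (X *\<^sub>v v) \<bullet>c x"
  using contour_integral_unique[OF has_contour_integral_kernel[OF assms(1-3) assms(4) assms(5)]]
  by (simp add: contour_form_def)

lemma contour_form_mix:
  assumes "e holomorphic_on slit_plane" "h holomorphic_on slit_plane" "x \<in> carrier_vec n"
  shows "contour_form X \<gamma> x (\<lambda>z. a * e z + b * h z) = a * contour_form X \<gamma> x e + b * contour_form X \<gamma> x h"
proof -
  have "((\<lambda>z. a * (e z * resolvent_form X x x z) + b * (h z * resolvent_form X x x z)) has_contour_integral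
      a * contour_integral \<gamma> (\<lambda>z. e z * resolvent_form X x x z) +
      b * contour_integral \<gamma> (\<lambda>z. h z * resolvent_form X x x z)) \<gamma>"
    by (intro has_contour_integral_add has_contour_integral_lmul has_contour_integral_integral
        integrable_resolvent_form assms)
  from contour_integral_unique[OF this] show ?thesis
    by (simp add: contour_form_def algebra_simps add_divide_distrib)
qed

end

lemma contour_form_wam_le:
  assumes A: "sectorial n T A" "slit_resolvent_contour A n \<gamma>\<^sub>A"
    and B: "sectorial n T B" "slit_resolvent_contour B n \<gamma>\<^sub>B"
    and M: "slit_resolvent_contour (wam t A B) n \<gamma>\<^sub>M"
    and T: "0 \<le> T" and t: "0 < t" "t < 1" and x: "x \<in> carrier_vec n" and e: "e \<in> kernel_hull"
  shows "(1 - t) * Re (contour_form A \<gamma>\<^sub>A x e) + t * Re (contour_form B \<gamma>\<^sub>B x e)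
    \<le> (1 + T\<^sup>2) * Re (contour_form (wam t A B) \<gamma>\<^sub>M x e)"
proof -
  interpret A: slit_resolvent_contour A n \<gamma>\<^sub>A by (rule A)
  interpret B: slit_resolvent_contour B n \<gamma>\<^sub>B by (rule B)
  interpret M: slit_resolvent_contour "wam t A B" n \<gamma>\<^sub>M by (rule M)
  have kernel: "(1 - t) * Re (contour_form A \<gamma>\<^sub>A x (mean_kernel s)) + t * Re (contour_form B \<gamma>\<^sub>B x (mean_kernel s))
    \<le> (1 + T\<^sup>2) * Re (contour_form (wam t A B) \<gamma>\<^sub>M x (mean_kernel s))" if s: "0 \<le> s" "s \<le> 1" for s
  proof -
    obtain a where a: "a \<in> carrier_vec n" "x = of_real s \<cdot>\<^sub>v a + of_real (1 - s) \<cdot>\<^sub>v (A *\<^sub>v a)"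
      by (rule kernel_equation_solvable[OF A(1) s x])
    obtain b where b: "b \<in> carrier_vec n" "x = of_real s \<cdot>\<^sub>v b + of_real (1 - s) \<cdot>\<^sub>v (B *\<^sub>v b)"
      by (rule kernel_equation_solvable[OF B(1) s x])
    obtain m where m: "m \<in> carrier_vec n" "x = of_real s \<cdot>\<^sub>v m + of_real (1 - s) \<cdot>\<^sub>v (wam t A B *\<^sub>v m)"
      by (rule kernel_equation_solvable[OF sectorial_wam[OF A(1) B(1) t] s x])
    \<comment> \<open>The decomposition of \<open>x\<close> into \<open>m\<close> and
      \<open>y\<close> is used for both \<open>A\<close> and \<open>B\<close>. It is the exact one
      for the mean, so after averaging the bracket collapses to
      \<open>Re (y \<bullet>c x)\<close>.\<close>
    define y where "y = wam t A B *\<^sub>v m"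
    have y: "y \<in> carrier_vec n" using M.X m by (simp add: y_def)
    note m2 = m(2)[folded y_def]
    have "(1 - t) * Re ((A *\<^sub>v a) \<bullet>c x) + t * Re ((B *\<^sub>v b) \<bullet>c x)
      \<le> (1 - t) * ((1 + T\<^sup>2) * (s * Re (qform A m) + (1 - s) * Re (y \<bullet>c y)))
        + t * ((1 + T\<^sup>2) * (s * Re (qform B m) + (1 - s) * Re (y \<bullet>c y)))"
      using t Re_kernel_form_le[OF A(1) T s a(1) m(1) y a(2) m2]
        Re_kernel_form_le[OF B(1) T s b(1) m(1) y b(2) m2]
      by (intro add_mono mult_left_mono) auto
    also have "\<dots> = (1 + T\<^sup>2) * (s * Re (qform (wam t A B) m) + (1 - s) * Re (y \<bullet>c y))"
      unfolding qform_wam[OF A.X B.X m(1)] by (simp add: algebra_simps)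
    also have "s * Re (qform (wam t A B) m) + (1 - s) * Re (y \<bullet>c y) = Re (y \<bullet>c x)"
    proof -
      have "Re (y \<bullet>c x) = Re (y \<bullet>c (of_real s \<cdot>\<^sub>v m + of_real (1 - s) \<cdot>\<^sub>v y))"
        using m2 by (rule arg_cong)
      also have "\<dots> = s * Re (y \<bullet>c m) + (1 - s) * Re (y \<bullet>c y)"
        using m(1) y by (simp add: cscalar_prod_simps[where n=n] del: of_real_diff)
      finally show ?thesis by (simp add: qform_def y_def)
    qed
    finally show ?thesis
      unfolding A.contour_form_kernel[OF s a(1) x a(2)] B.contour_form_kernel[OF s b(1) x b(2)]
        M.contour_form_kernel[OF s m(1) x m(2)] y_def .
  qed
  show ?thesis using e
  proof (induction rule: kernel_hull.induct)
    case (mix e \<tau> s)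
    note hol = kernel_hull_holomorphic[OF mix.hyps(1)] kernel_holomorphic[OF mix.hyps(4,5)]
    note form = A.contour_form_mix[OF hol x] B.contour_form_mix[OF hol x] M.contour_form_mix[OF hol x]
    have "(1 - \<tau>) * ((1 - t) * Re (contour_form A \<gamma>\<^sub>A x e) + t * Re (contour_form B \<gamma>\<^sub>B x e))
        + \<tau> * ((1 - t) * Re (contour_form A \<gamma>\<^sub>A x (mean_kernel s)) + t * Re (contour_form B \<gamma>\<^sub>B x (mean_kernel s)))
      \<le> (1 - \<tau>) * ((1 + T\<^sup>2) * Re (contour_form (wam t A B) \<gamma>\<^sub>M x e))
        + \<tau> * ((1 + T\<^sup>2) * Re (contour_form (wam t A B) \<gamma>\<^sub>M x (mean_kernel s)))"
      using mix kernel[OF mix.hyps(4,5)] by (intro add_mono mult_left_mono) auto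
    then show ?case unfolding form by (simp add: algebra_simps)
  qed (rule kernel)
qed

theorem kernel_limit_wam_le:
  assumes A: "sectorial n T A" and B: "sectorial n T B" and T: "0 \<le> T" and t: "0 < t" "t < 1"
    and e: "\<And>k. e k \<in> kernel_hull" and g: "g holomorphic_on slit_plane"
    and lim: "\<And>K. compact K \<Longrightarrow> K \<subseteq> slit_plane \<Longrightarrow> uniform_limit K e g sequentially"
  shows "hol_fun g A \<in> carrier_mat n n \<and> hol_fun g B \<in> carrier_mat n n \<and> hol_fun g (wam t A B) \<in> carrier_mat n n \<and>
    (\<forall>x\<in>carrier_vec n. Re (qform (wam t (hol_fun g A) (hol_fun g B)) x)
      \<le> (1 + T\<^sup>2) * Re (qform (hol_fun g (wam t A B)) x))"
proof -
  obtain \<gamma>\<^sub>A where A': "slit_resolvent_contour A n \<gamma>\<^sub>A" "hol_fun g A \<in> carrier_mat n n"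
    "\<And>x. x \<in> carrier_vec n \<Longrightarrow> qform (hol_fun g A) x = contour_form A \<gamma>\<^sub>A x g"
    using hol_fun_qform[OF A g] unfolding contour_form_def by metis
  obtain \<gamma>\<^sub>B where B': "slit_resolvent_contour B n \<gamma>\<^sub>B" "hol_fun g B \<in> carrier_mat n n"
    "\<And>x. x \<in> carrier_vec n \<Longrightarrow> qform (hol_fun g B) x = contour_form B \<gamma>\<^sub>B x g"
    using hol_fun_qform[OF B g] unfolding contour_form_def by metis
  obtain \<gamma>\<^sub>M where M': "slit_resolvent_contour (wam t A B) n \<gamma>\<^sub>M" "hol_fun g (wam t A B) \<in> carrier_mat n n"
    "\<And>x. x \<in> carrier_vec n \<Longrightarrow> qform (hol_fun g (wam t A B)) x = contour_form (wam t A B) \<gamma>\<^sub>M x g"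
    using hol_fun_qform[OF sectorial_wam[OF A B t] g] unfolding contour_form_def by metis
  have conv: "(\<lambda>k. Re (contour_form X \<gamma> x (e k))) \<longlonglongrightarrow> Re (contour_form X \<gamma> x g)"
    if "slit_resolvent_contour X n \<gamma>" "x \<in> carrier_vec n" for X \<gamma> x
    unfolding contour_form_def
    by (intro tendsto_intros slit_resolvent_contour.contour_integral_tendsto[OF that(1)]
        kernel_hull_holomorphic e g lim that(2)) auto
  have "Re (qform (wam t (hol_fun g A) (hol_fun g B)) x) \<le> (1 + T\<^sup>2) * Re (qform (hol_fun g (wam t A B)) x)"
    if x: "x \<in> carrier_vec n" for x
  proof -
    have "(1 - t) * Re (contour_form A \<gamma>\<^sub>A x g) + t * Re (contour_form B \<gamma>\<^sub>B x g)
      \<le> (1 + T\<^sup>2) * Re (contour_form (wam t A B) \<gamma>\<^sub>M x g)"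
    proof (rule tendsto_le[OF sequentially_bot])
      show "(\<lambda>k. (1 + T\<^sup>2) * Re (contour_form (wam t A B) \<gamma>\<^sub>M x (e k)))
        \<longlonglongrightarrow> (1 + T\<^sup>2) * Re (contour_form (wam t A B) \<gamma>\<^sub>M x g)"
        by (intro tendsto_intros conv M' x)
      show "(\<lambda>k. (1 - t) * Re (contour_form A \<gamma>\<^sub>A x (e k)) + t * Re (contour_form B \<gamma>\<^sub>B x (e k)))
        \<longlonglongrightarrow> (1 - t) * Re (contour_form A \<gamma>\<^sub>A x g) + t * Re (contour_form B \<gamma>\<^sub>B x g)"
        by (intro tendsto_intros conv A' B' x)
    qed (auto intro!: always_eventually contour_form_wam_le[OF A A'(1) B B'(1) M'(1) T t x e])
    then show ?thesis
      unfolding qform_wam[OF A'(2) B'(2) x] A'(3)[OF x] B'(3)[OF x] M'(3)[OF x] by simp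
  qed
  with A' B' M' show ?thesis by blast
qed

section \<open>Real parts and the Loewner order\<close>

lemma mat_adjoint_carrier: "M \<in> carrier_mat n m \<Longrightarrow> mat_adjoint M \<in> carrier_mat m n"
  by (auto simp: mat_adjoint_def)

lemma mat_adjoint_index: "i < dim_col M \<Longrightarrow> j < dim_row M \<Longrightarrow> mat_adjoint M $$ (i, j) = conjugate (M $$ (j, i))"
  by (simp add: mat_adjoint_def mat_of_rows_def)

lemma hermitian_matI:
  assumes "M \<in> carrier_mat n n" "\<And>i j. i < n \<Longrightarrow> j < n \<Longrightarrow> M $$ (i, j) = cnj (M $$ (j, i))"
  shows "hermitian_mat M"
proof -
  have "mat_adjoint M = M"
    using assms mat_adjoint_carrier[OF assms(1)]
    by (intro eq_matI) (auto simp: mat_adjoint_index simp flip: assms(2))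
  then show ?thesis using assms by (auto simp: hermitian_mat_def)
qed

lemma ReM_carrier: "M \<in> carrier_mat n n \<Longrightarrow> ReM M \<in> carrier_mat n n"
  using mat_adjoint_carrier[of M n n] by (auto simp: ReM_def)

lemma ReM_index:
  "M \<in> carrier_mat n n \<Longrightarrow> i < n \<Longrightarrow> j < n \<Longrightarrow> ReM M $$ (i, j) = (M $$ (i, j) + cnj (M $$ (j, i))) / 2"
  using mat_adjoint_carrier[of M n n] by (auto simp: ReM_def mat_adjoint_index)

lemma qform_sum:
  assumes "M \<in> carrier_mat n n" "x \<in> carrier_vec n"
  shows "qform M x = (\<Sum>i<n. \<Sum>j<n. M $$ (i, j) * x $ j * cnj (x $ i))"
  using assms by (simp add: qform_def cscalar_prod_sum[where n=n] scalar_prod_def atLeast0LessThan sum_distrib_right)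

lemma Re_qform_ReM:
  assumes M: "M \<in> carrier_mat n n" and x: "x \<in> carrier_vec n"
  shows "Re (qform (ReM M) x) = Re (qform M x)"
proof -
  have "cnj (qform M x) = (\<Sum>i<n. \<Sum>j<n. cnj (M $$ (i, j)) * cnj (x $ j) * x $ i)"
    by (simp add: qform_sum[OF M x])
  also have "\<dots> = (\<Sum>j<n. \<Sum>i<n. cnj (M $$ (i, j)) * cnj (x $ j) * x $ i)" by (rule sum.swap)
  finally have eq: "qform (ReM M) x = (qform M x + cnj (qform M x)) / 2"
    unfolding qform_sum[OF ReM_carrier[OF M] x] qform_sum[OF M x]
    by (simp add: ReM_index[OF M] sum.distrib sum_divide_distrib add_divide_distrib algebra_simps)
  show ?thesis unfolding eq by simp
qed

lemma loewner_le_ReM: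
  assumes M: "M \<in> carrier_mat n n" and N: "N \<in> carrier_mat n n"
    and le: "\<And>x. x \<in> carrier_vec n \<Longrightarrow> Re (qform M x) \<le> c * Re (qform N x)"
  shows "loewner_le (ReM M) (of_real c \<cdot>\<^sub>m ReM N)"
proof -
  let ?N = "complex_of_real c \<cdot>\<^sub>m ReM N"
  have M': "ReM M \<in> carrier_mat n n" and N': "?N \<in> carrier_mat n n" using ReM_carrier M N by auto
  have hM: "hermitian_mat (ReM M)"
    by (rule hermitian_matI[OF M']) (simp add: ReM_index[OF M])
  have hN: "hermitian_mat ?N"
    using ReM_carrier[OF N] by (intro hermitian_matI[OF N']) (simp add: ReM_index[OF N])
  have D: "?N - ReM M \<in> carrier_mat n n" using M' N' by auto
  have hD: "hermitian_mat (?N - ReM M)"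
    using ReM_carrier[OF N] ReM_carrier[OF M]
    by (intro hermitian_matI[OF D]) (simp add: ReM_index[OF N] ReM_index[OF M] add.commute)
  have nonneg: "0 \<le> Re (qform (?N - ReM M) x)" if x: "x \<in> carrier_vec n" for x
  proof -
    have "qform (?N - ReM M) x = of_real c * qform (ReM N) x - qform (ReM M) x"
      unfolding qform_sum[OF D x] qform_sum[OF ReM_carrier[OF M] x] qform_sum[OF ReM_carrier[OF N] x]
      using ReM_carrier[OF N] ReM_carrier[OF M]
      by (simp add: sum_distrib_left sum_subtractf algebra_simps)
    then show ?thesis using le[OF x] Re_qform_ReM[OF M x] Re_qform_ReM[OF N x] by simp
  qed
  show ?thesis
    unfolding loewner_le_def pos_semidef_mat_def carrier_matD(1)[OF D] carrier_matD(1)[OF M'] carrier_matD(1)[OF N']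
    using hM hN hD nonneg by blast
qed

section \<open>Rank one perturbations and divided differences\<close>

lemma lagrange_interpolation:
  fixes a :: "'i \<Rightarrow> real"
  assumes I: "finite I" "inj_on a I" and P: "degree P < card I"
  defines "D \<equiv> \<lambda>i. \<Prod>l\<in>I - {i}. a i - a l"
  shows "P = (\<Sum>i\<in>I. smult (poly P (a i) / D i) (\<Prod>l\<in>I - {i}. [:- a l, 1:]))" (is "P = ?Q")
proof -
  have D: "D i \<noteq> 0" if "i \<in> I" for i
    using that I by (auto simp: D_def inj_on_def)
  have "degree (\<Prod>l\<in>I - {i}. [:- a l, 1:]) \<le> card I - 1" if "i \<in> I" for i
    using degree_prod_sum_le[of "I - {i}" "\<lambda>l. [:- a l, 1:]"] I that by simp
  then have "degree ?Q \<le> card I - 1"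
    by (intro degree_sum_le I) (auto intro: order_trans[OF degree_smult_le])
  then have deg: "degree (P - ?Q) < card I"
    using P by (intro le_less_trans[OF degree_diff_le_max]) auto
  have root: "poly (P - ?Q) (a k) = 0" if k: "k \<in> I" for k
  proof -
    have "poly ?Q (a k) = (\<Sum>i\<in>I. poly P (a i) / D i * (\<Prod>l\<in>I - {i}. a k - a l))"
      by (simp add: poly_sum poly_prod)
    also have "\<dots> = (\<Sum>i\<in>I. if i = k then poly P (a k) else 0)"
    proof (rule sum.cong[OF refl])
      fix i assume "i \<in> I"
      show "poly P (a i) / D i * (\<Prod>l\<in>I - {i}. a k - a l) = (if i = k then poly P (a k) else 0)"
      proof (cases "i = k")
        case True
        then show ?thesis using D[OF k] by (simp add: D_def)
      next
        case False
        then have "(\<Prod>l\<in>I - {i}. a k - a l) = 0" using k I by (intro prod_zero) auto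
        then show ?thesis using False by simp
      qed
    qed
    finally show ?thesis using k I by simp
  qed
  have sub: "a ` I \<subseteq> {x. poly (P - ?Q) x = 0}" by (intro image_subsetI CollectI root)
  show ?thesis
  proof (rule ccontr)
    assume "P \<noteq> ?Q"
    then have nz: "P - ?Q \<noteq> 0" by simp
    have "card I = card (a ` I)" using I by (simp add: card_image)
    also have "\<dots> \<le> card {x. poly (P - ?Q) x = 0}"
      by (rule card_mono[OF poly_roots_finite[OF nz] sub])
    also have "\<dots> \<le> degree (P - ?Q)" by (rule card_poly_roots_bound[OF nz])
    finally show False using deg by simp
  qed
qed

text \<open>Comparison of coefficients in the interpolation formula: each nodal product is monic of
  degree \<open>card I - 1\<close>.\<close>

lemma lagrange_top_coeff:
  fixes a :: "'i \<Rightarrow> real"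
  assumes I: "finite I" "inj_on a I" and P: "degree P < card I"
  shows "coeff P (card I - 1) = (\<Sum>i\<in>I. poly P (a i) / (\<Prod>l\<in>I - {i}. a i - a l))"
proof -
  have c: "coeff (\<Prod>l\<in>I - {i}. [:- a l, 1:]) (card I - 1) = 1" if "i \<in> I" for i
  proof -
    have "degree (\<Prod>l\<in>I - {i}. [:- a l, 1:]) = card I - 1"
      using I that by (subst degree_prod_eq_sum_degree) auto
    moreover have "lead_coeff (\<Prod>l\<in>I - {i}. [:- a l, 1:]) = 1"
      by (simp add: lead_coeff_prod)
    ultimately show ?thesis by simp
  qed
  show ?thesis
    by (subst lagrange_interpolation[OF assms]) (simp add: coeff_sum c[unfolded One_nat_def])
qed

lemma lagrange_partial_fractions:
  fixes a :: "'i \<Rightarrow> real"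
  assumes I: "finite I" "inj_on a I" and P: "degree P < card I" and y: "\<And>i. i \<in> I \<Longrightarrow> y \<noteq> a i"
  shows "poly P y / (\<Prod>i\<in>I. y - a i) = (\<Sum>i\<in>I. poly P (a i) / ((\<Prod>l\<in>I - {i}. a i - a l) * (y - a i)))"
proof -
  have pr: "(\<Prod>i\<in>I. y - a i) = (y - a i) * (\<Prod>l\<in>I - {i}. y - a l)" if "i \<in> I" for i
    using I that by (simp add: prod.remove)
  have nz: "(\<Prod>l\<in>I - {i}. y - a l) \<noteq> 0" for i using I y by auto
  have "poly P y = (\<Sum>i\<in>I. poly P (a i) / (\<Prod>l\<in>I - {i}. a i - a l) * (\<Prod>l\<in>I - {i}. y - a l))"
    by (subst lagrange_interpolation[OF I P]) (simp add: poly_sum poly_prod)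
  then have "poly P y / (\<Prod>i\<in>I. y - a i) =
      (\<Sum>i\<in>I. poly P (a i) / (\<Prod>l\<in>I - {i}. a i - a l) * (\<Prod>l\<in>I - {i}. y - a l) / (\<Prod>i\<in>I. y - a i))"
    by (simp add: sum_divide_distrib)
  also have "\<dots> = (\<Sum>i\<in>I. poly P (a i) / ((\<Prod>l\<in>I - {i}. a i - a l) * (y - a i)))"
  proof (rule sum.cong[OF refl])
    fix i assume "i \<in> I"
    show "poly P (a i) / (\<Prod>l\<in>I - {i}. a i - a l) * (\<Prod>l\<in>I - {i}. y - a l) / (\<Prod>i\<in>I. y - a i) =
      poly P (a i) / ((\<Prod>l\<in>I - {i}. a i - a l) * (y - a i))"
      unfolding pr[OF \<open>i \<in> I\<close>] using nz[of i] by simp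
  qed
  finally show ?thesis .
qed

section \<open>Functions of Hermitian matrices and the rank one test\<close>

definition unitary_conj :: "nat \<Rightarrow> complex Matrix.mat \<Rightarrow> (nat \<Rightarrow> real) \<Rightarrow> complex Matrix.mat" where
  "unitary_conj N U d = U * mat_diag N (\<lambda>i. complex_of_real (d i)) * mat_adjoint U"

lemma unitary_conj_carrier: "U \<in> carrier_mat N N \<Longrightarrow> unitary_conj N U d \<in> carrier_mat N N"
  using mat_adjoint_carrier[of U N N] by (auto simp: unitary_conj_def)

lemma unitary_conj_index:
  assumes U: "U \<in> carrier_mat N N" and ij: "i < N" "j < N"
  shows "unitary_conj N U d $$ (i, j) = (\<Sum>k<N. U $$ (i, k) * of_real (d k) * cnj (U $$ (j, k)))"
  unfolding unitary_conj_def using assms mat_adjoint_carrier[OF U]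
  by (subst mat_diag_mult_right[OF U])
    (simp add: scalar_prod_def atLeast0LessThan mat_adjoint_index)

lemma unitary_conj_hermitian: "U \<in> carrier_mat N N \<Longrightarrow> hermitian_mat (unitary_conj N U d)"
  by (rule hermitian_matI[OF unitary_conj_carrier]) (auto simp: unitary_conj_index mult_ac)

lemma qform_unitary_conj:
  assumes U: "U \<in> carrier_mat N N" and x: "x \<in> carrier_vec N"
  shows "qform (unitary_conj N U d) x = of_real (\<Sum>k<N. d k * (cmod (\<Sum>i<N. cnj (U $$ (i, k)) * x $ i))\<^sup>2)"
proof -
  have "qform (unitary_conj N U d) x =
      (\<Sum>i<N. \<Sum>j<N. \<Sum>k<N. of_real (d k) * (cnj (U $$ (j, k)) * x $ j * (U $$ (i, k) * cnj (x $ i))))"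
    unfolding qform_sum[OF unitary_conj_carrier[OF U] x]
    by (simp add: unitary_conj_index[OF U] sum_distrib_right sum_distrib_left mult_ac)
  also have "\<dots> = (\<Sum>i<N. \<Sum>k<N. \<Sum>j<N. of_real (d k) * (cnj (U $$ (j, k)) * x $ j * (U $$ (i, k) * cnj (x $ i))))"
    by (intro sum.cong refl sum.swap)
  also have "\<dots> = (\<Sum>k<N. \<Sum>i<N. \<Sum>j<N. of_real (d k) * (cnj (U $$ (j, k)) * x $ j * (U $$ (i, k) * cnj (x $ i))))"
    by (rule sum.swap)
  also have "\<dots> = (\<Sum>k<N. of_real (d k) * ((\<Sum>i<N. cnj (U $$ (i, k)) * x $ i) * cnj (\<Sum>i<N. cnj (U $$ (i, k)) * x $ i)))"
    by (simp add: sum_distrib_left sum_distrib_right mult_ac)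
  also have "\<dots> = of_real (\<Sum>k<N. d k * (cmod (\<Sum>i<N. cnj (U $$ (i, k)) * x $ i))\<^sup>2)"
    by (simp add: complex_norm_square flip: of_real_power)
  finally show ?thesis .
qed

text \<open>Well-definedness of the choice. For two diagonalisations,
  \<open>W = mat_adjoint V * U\<close> satisfies d_i W_ij = W_ij a_j, so W_ij = 0 unless d_i = a_j.
  Hence the relation survives the application of an arbitrary \<open>f\<close> to both
  spectra.\<close>

lemma herm_fun_unitary_conj:
  assumes U: "unitary_mat U" "U \<in> carrier_mat N N"
  shows "herm_fun f (unitary_conj N U a) = unitary_conj N U (f \<circ> a)"
proof -
  let ?H = "unitary_conj N U a"
  have dim: "dim_row ?H = N" using unitary_conj_carrier[OF U(2)] by auto
  have UU: "mat_adjoint U * U = 1\<^sub>m N" "U * mat_adjoint U = 1\<^sub>m N" "mat_adjoint U \<in> carrier_mat N N"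
    using U mat_adjoint_carrier[OF U(2)] by (auto simp: unitary_mat_def)
  let ?spec = "\<lambda>M. \<exists>V d. unitary_mat V \<and> dim_row V = N \<and> ?H = unitary_conj N V d \<and> M = unitary_conj N V (f \<circ> d)"
  have "herm_fun f ?H = (SOME M. ?spec M)"
    unfolding herm_fun_def dim unfolding unitary_conj_def comp_def by (rule refl)
  also have "\<dots> = unitary_conj N U (f \<circ> a)"
  proof (rule some_equality)
    show "?spec (unitary_conj N U (f \<circ> a))"
      using U by (intro exI[of _ U] exI[of _ a]) auto
    fix M assume "?spec M"
    then obtain V d where V: "unitary_mat V" "dim_row V = N" "?H = unitary_conj N V d" "M = unitary_conj N V (f \<circ> d)"
      by blast
    have Vc: "V \<in> carrier_mat N N" using V by (auto simp: unitary_mat_def)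
    have VV: "mat_adjoint V * V = 1\<^sub>m N" "V * mat_adjoint V = 1\<^sub>m N" "mat_adjoint V \<in> carrier_mat N N"
      using V mat_adjoint_carrier[OF Vc] by (auto simp: unitary_mat_def)
    define W where "W = mat_adjoint V * U"
    have W: "W \<in> carrier_mat N N" using VV U by (simp add: W_def)
    have conj_eq: "unitary_conj N V d' = unitary_conj N U a' \<longleftrightarrow>
        mat_diag N (\<lambda>i. complex_of_real (d' i)) * W = W * mat_diag N (\<lambda>i. complex_of_real (a' i))" for d' a'
    proof -
      define \<Delta> where "\<Delta> = mat_diag N (\<lambda>i. complex_of_real (d' i))"
      define \<Lambda> where "\<Lambda> = mat_diag N (\<lambda>i. complex_of_real (a' i))"
      have c: "\<Delta> \<in> carrier_mat N N" "\<Lambda> \<in> carrier_mat N N" by (simp_all add: \<Delta>_def \<Lambda>_def)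
      note as = assoc_mult_mat[where n\<^sub>1=N and n\<^sub>2=N and n\<^sub>3=N and n\<^sub>4=N]
      have l: "mat_adjoint V * (V * \<Delta> * mat_adjoint V) * U = \<Delta> * W"
      proof -
        have "mat_adjoint V * (V * \<Delta> * mat_adjoint V) * U = (mat_adjoint V * V) * \<Delta> * (mat_adjoint V * U)"
          using c VV(3) Vc U(2) by (simp add: as mult_carrier_mat[where n=N])
        then show ?thesis using VV c W by (simp add: W_def)
      qed
      have r: "mat_adjoint V * (U * \<Lambda> * mat_adjoint U) * U = W * \<Lambda>"
      proof -
        have "mat_adjoint V * (U * \<Lambda> * mat_adjoint U) * U = (mat_adjoint V * U) * \<Lambda> * (mat_adjoint U * U)"
          using c VV(3) UU(3) Vc U(2) by (simp add: as mult_carrier_mat[where n=N])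
        then show ?thesis using UU c W right_mult_one_mat[of "W * \<Lambda>" N N] by (simp add: W_def)
      qed
      have l': "V * (\<Delta> * W) * mat_adjoint U = V * \<Delta> * mat_adjoint V"
      proof -
        have "V * (\<Delta> * W) * mat_adjoint U = (V * \<Delta> * mat_adjoint V) * (U * mat_adjoint U)"
          using c VV(3) UU(3) Vc U(2) by (simp add: as mult_carrier_mat[where n=N] W_def)
        then show ?thesis using UU c Vc VV right_mult_one_mat[of "V * \<Delta> * mat_adjoint V" N N] by simp
      qed
      have r': "V * (W * \<Lambda>) * mat_adjoint U = U * \<Lambda> * mat_adjoint U"
      proof -
        have "V * (W * \<Lambda>) * mat_adjoint U = (V * mat_adjoint V) * (U * \<Lambda> * mat_adjoint U)"
          using c VV(3) UU(3) Vc U(2) by (simp add: as mult_carrier_mat[where n=N] W_def)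
        then show ?thesis using VV c U UU left_mult_one_mat[of "U * \<Lambda> * mat_adjoint U" N N] by simp
      qed
      show ?thesis
        unfolding unitary_conj_def \<Delta>_def[symmetric] \<Lambda>_def[symmetric] using l r l' r' by metis
    qed
    have comm: "mat_diag N (\<lambda>i. complex_of_real (d' i)) * W = W * mat_diag N (\<lambda>i. complex_of_real (a' i)) \<longleftrightarrow>
        (\<forall>i<N. \<forall>j<N. of_real (d' i) * W $$ (i, j) = W $$ (i, j) * of_real (a' j))" for d' a'
      unfolding mat_diag_mult_left[OF W] mat_diag_mult_right[OF W] by (auto simp: mat_eq_iff)
    have "\<forall>i<N. \<forall>j<N. of_real (d i) * W $$ (i, j) = W $$ (i, j) * of_real (a j)"
      using V(3) conj_eq[of d a] comm[of d a] by simp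
    then have "\<forall>i<N. \<forall>j<N. of_real ((f \<circ> d) i) * W $$ (i, j) = W $$ (i, j) * of_real ((f \<circ> a) j)"
    proof (intro allI impI)
      fix i j assume "i < N" "j < N"
      then have "W $$ (i, j) = 0 \<or> d i = a j"
        using \<open>\<forall>i<N. \<forall>j<N. of_real (d i) * W $$ (i, j) = W $$ (i, j) * of_real (a j)\<close>
        by (metis mult.commute mult_cancel_left of_real_eq_iff)
      then show "of_real ((f \<circ> d) i) * W $$ (i, j) = W $$ (i, j) * of_real ((f \<circ> a) j)" by auto
    qed
    then show "M = unitary_conj N U (f \<circ> a)"
      using V(4) conj_eq[of "f \<circ> d" "f \<circ> a"] comm[of "f \<circ> d" "f \<circ> a"] by simp
  qed
  finally show ?thesis .
qed

lemma unitary_conj_pos_def: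
  assumes U: "unitary_mat U" "U \<in> carrier_mat N N" and d: "\<And>i. i < N \<Longrightarrow> 0 < d i"
  shows "pos_def_mat (unitary_conj N U d)"
proof -
  have "0 < Re (qform (unitary_conj N U d) x)" if x: "x \<in> carrier_vec N" "x \<noteq> 0\<^sub>v N" for x
  proof (rule ccontr)
    define y where "y k = (\<Sum>i<N. cnj (U $$ (i, k)) * x $ i)" for k
    have nonneg: "0 \<le> d k * (cmod (y k))\<^sup>2" if "k < N" for k using d[OF that] by simp
    assume "\<not> 0 < Re (qform (unitary_conj N U d) x)"
    then have "(\<Sum>k<N. d k * (cmod (y k))\<^sup>2) \<le> 0"
      unfolding qform_unitary_conj[OF U(2) x(1)] y_def by simp
    moreover have "0 \<le> (\<Sum>k<N. d k * (cmod (y k))\<^sup>2)" using nonneg by (intro sum_nonneg) auto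
    ultimately have "(\<Sum>k<N. d k * (cmod (y k))\<^sup>2) = 0" by linarith
    then have "\<forall>k<N. y k = 0"
      using nonneg d by (subst (asm) sum_nonneg_eq_0_iff) (auto simp: less_le)
    moreover have "(mat_adjoint U *\<^sub>v x) $ k = y k" if "k < N" for k
      using that U x mat_adjoint_carrier[OF U(2)]
      by (simp add: y_def scalar_prod_def atLeast0LessThan mat_adjoint_index)
    ultimately have "mat_adjoint U *\<^sub>v x = 0\<^sub>v N"
      using mat_adjoint_carrier[OF U(2)] by (intro eq_vecI) auto
    moreover have "x = U *\<^sub>v (mat_adjoint U *\<^sub>v x)"
      using U x mat_adjoint_carrier[OF U(2)]
      by (simp add: unitary_mat_def flip: assoc_mult_mat_vec[of _ N N _ N])
    moreover have "U *\<^sub>v 0\<^sub>v N = 0\<^sub>v N" using U by (intro eq_vecI) auto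
    ultimately show False using x by simp
  qed
  then show ?thesis
    using unitary_conj_hermitian[OF U(2)] unitary_conj_carrier[OF U(2), of d] by (auto simp: pos_def_mat_def)
qed

text \<open>The columns of \<open>U\<close> form an orthonormal eigenbasis of diag a + v v^T with
  eigenvalues \<open>b\<close>. The conclusion compares the quadratic forms of f(diag a) and f(diag
  a + v v^T) at \<open>w\<close>.\<close>

lemma matrix_monotone_rank_one:
  fixes U :: "nat \<Rightarrow> nat \<Rightarrow> real" and a b v w :: "nat \<Rightarrow> real"
  assumes f: "matrix_monotone f" and a: "\<And>i. i < N \<Longrightarrow> 0 < a i" and b: "\<And>i. i < N \<Longrightarrow> 0 < b i"
    and orth: "\<And>j k. j < N \<Longrightarrow> k < N \<Longrightarrow> (\<Sum>i<N. U i j * U i k) = (if j = k then 1 else 0)"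
    and eigen: "\<And>i j. i < N \<Longrightarrow> j < N \<Longrightarrow> a i * U i j + v i * (\<Sum>l<N. v l * U l j) = U i j * b j"
  shows "(\<Sum>i<N. f (a i) * (w i)\<^sup>2) \<le> (\<Sum>j<N. f (b j) * (\<Sum>i<N. U i j * w i)\<^sup>2)"
proof -
  define M where "M = Matrix.mat N N (\<lambda>(i, j). complex_of_real (U i j))"
  have M: "M \<in> carrier_mat N N" and adj: "mat_adjoint M \<in> carrier_mat N N"
    using mat_adjoint_carrier[of M N N] by (auto simp: M_def)
  have M_index: "M $$ (i, j) = of_real (U i j)" if "i < N" "j < N" for i j
    using that by (simp add: M_def)
  have MM: "mat_adjoint M * M = 1\<^sub>m N"
  proof (rule eq_matI)
    fix i j assume "i < dim_row (1\<^sub>m N :: complex Matrix.mat)" "j < dim_col (1\<^sub>m N :: complex Matrix.mat)"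
    then have ij: "i < N" "j < N" by auto
    then have "(mat_adjoint M * M) $$ (i, j) = of_real (\<Sum>k<N. U k i * U k j)"
      using M adj by (simp add: scalar_prod_def atLeast0LessThan mat_adjoint_index M_index)
    then show "(mat_adjoint M * M) $$ (i, j) = (1\<^sub>m N :: complex Matrix.mat) $$ (i, j)"
      using ij orth by simp
  qed (use M adj in auto)
  then have MM': "M * mat_adjoint M = 1\<^sub>m N" by (rule mat_mult_left_right_inverse[OF adj M])
  then have unitary: "unitary_mat M" using MM M by (auto simp: unitary_mat_def)
  have row_orth: "(\<Sum>k<N. U i k * U j k) = (if i = j then 1 else 0)" if "i < N" "j < N" for i j
  proof -
    have "complex_of_real (\<Sum>k<N. U i k * U j k) = (M * mat_adjoint M) $$ (i, j)"
      using that M adj by (simp add: scalar_prod_def atLeast0LessThan mat_adjoint_index M_index)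
    also have "\<dots> = complex_of_real (if i = j then 1 else 0)"
      unfolding MM' using that by simp
    finally show ?thesis by (simp only: of_real_eq_iff)
  qed
  have adj_one: "mat_adjoint (1\<^sub>m N) = (1\<^sub>m N :: complex Matrix.mat)"
    by (rule eq_matI) (auto simp: mat_adjoint_index mat_adjoint_carrier[of _ N N] carrier_matD[OF mat_adjoint_carrier[of "1\<^sub>m N" N N]])
  then have one: "unitary_mat (1\<^sub>m N)" "1\<^sub>m N \<in> carrier_mat N N" by (auto simp: unitary_mat_def)
  let ?A = "unitary_conj N (1\<^sub>m N) a" and ?B = "unitary_conj N M b"
  have A: "?A \<in> carrier_mat N N" and B: "?B \<in> carrier_mat N N"
    by (rule unitary_conj_carrier; fact)+
  have A_index: "?A $$ (i, j) = (if i = j then of_real (a i) else 0)" if "i < N" "j < N" for i j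
  proof -
    have "?A $$ (i, j) = (\<Sum>k<N. if k = i then (if i = j then of_real (a i) else 0) else 0)"
      by (subst unitary_conj_index[OF one(2) that]) (intro sum.cong refl; use that in auto)
    then show ?thesis using that by simp
  qed
  \<comment> \<open>The entries of U diag b U^T are recovered from the eigenvector equation and the
    orthonormality of the rows.\<close>
  have B_index: "?B $$ (i, j) = of_real ((if i = j then a i else 0) + v i * v j)" if ij: "i < N" "j < N" for i j
  proof -
    have "(\<Sum>k<N. U i k * b k * U j k) = (\<Sum>k<N. (a i * U i k + v i * (\<Sum>l<N. v l * U l k)) * U j k)"
      using ij by (simp add: eigen)
    also have "\<dots> = a i * (\<Sum>k<N. U i k * U j k) + v i * (\<Sum>k<N. \<Sum>l<N. v l * (U l k * U j k))"
      by (simp add: algebra_simps sum.distrib sum_distrib_left sum_distrib_right)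
    also have "(\<Sum>k<N. \<Sum>l<N. v l * (U l k * U j k)) = (\<Sum>l<N. v l * (\<Sum>k<N. U l k * U j k))"
      by (subst sum.swap) (simp add: sum_distrib_left)
    also have "\<dots> = (\<Sum>l<N. if l = j then v j else 0)"
      using ij by (intro sum.cong) (auto simp: row_orth)
    finally have "(\<Sum>k<N. U i k * b k * U j k) = (if i = j then a i else 0) + v i * v j"
      using ij by (simp add: row_orth)
    moreover have "?B $$ (i, j) = of_real (\<Sum>k<N. U i k * b k * U j k)"
      using ij by (simp add: unitary_conj_index[OF M] M_index)
    ultimately show ?thesis by simp
  qed
  have qdiff: "qform (P - Q) x = qform P x - qform Q x"
    if "P \<in> carrier_mat N N" "Q \<in> carrier_mat N N" "x \<in> carrier_vec N" for P Q x
  proof -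
    have D: "P - Q \<in> carrier_mat N N" using that by auto
    show ?thesis
      unfolding qform_sum[OF D that(3)] qform_sum[OF that(1,3)] qform_sum[OF that(2,3)]
      using that by (simp add: sum_subtractf algebra_simps)
  qed
  have "loewner_le ?A ?B"
    unfolding loewner_le_def pos_semidef_mat_def
  proof (intro conjI ballI)
    have D: "?B - ?A \<in> carrier_mat N N" using A B by auto
    have D_index: "(?B - ?A) $$ (i, j) = of_real (v i * v j)" if "i < N" "j < N" for i j
      using that A B by (simp add: A_index B_index)
    show "hermitian_mat (?B - ?A)" by (rule hermitian_matI[OF D]) (simp only: D_index, simp)
    fix x :: "complex Matrix.vec" assume "x \<in> carrier_vec (dim_row (?B - ?A))"
    then have x: "x \<in> carrier_vec N" using carrier_matD(1)[OF A] by simp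
    have "qform (?B - ?A) x = (\<Sum>i<N. \<Sum>j<N. of_real (v i * v j) * x $ j * cnj (x $ i))"
      unfolding qform_sum[OF D x] by (intro sum.cong refl) (simp only: D_index lessThan_iff)
    also have "\<dots> = (\<Sum>j<N. of_real (v j) * x $ j) * cnj (\<Sum>j<N. of_real (v j) * x $ j)"
      by (simp add: sum_distrib_left sum_distrib_right mult_ac)
    also have "\<dots> = of_real ((cmod (\<Sum>j<N. of_real (v j) * x $ j))\<^sup>2)"
      by (simp only: complex_norm_square)
    finally show "0 \<le> Re (qform (?B - ?A) x)" by simp
  qed (use A B unitary_conj_hermitian[OF M] unitary_conj_hermitian[OF one(2)] in auto)
  with A B unitary_conj_pos_def[OF one a] unitary_conj_pos_def[OF unitary M b]
  have "?A \<in> carrier_mat N N \<and> ?B \<in> carrier_mat N N \<and> pos_def_mat ?A \<and> pos_def_mat ?B \<and> loewner_le ?A ?B"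
    by (intro conjI)
  then have "loewner_le (herm_fun f ?A) (herm_fun f ?B)"
    by (rule f[unfolded matrix_monotone_def, rule_format])
  then have le: "loewner_le (unitary_conj N (1\<^sub>m N) (f \<circ> a)) (unitary_conj N M (f \<circ> b))"
    by (simp only: herm_fun_unitary_conj[OF one] herm_fun_unitary_conj[OF unitary M])
  define x where "x = Matrix.vec N (\<lambda>i. complex_of_real (w i))"
  have x: "x \<in> carrier_vec N" by (simp add: x_def)
  note car = unitary_conj_carrier[OF M, of "f \<circ> b"] unitary_conj_carrier[OF one(2), of "f \<circ> a"]
  have "0 \<le> Re (qform (unitary_conj N M (f \<circ> b) - unitary_conj N (1\<^sub>m N) (f \<circ> a)) x)"
    using le x car by (auto simp: loewner_le_def pos_semidef_mat_def)
  moreover have "(\<Sum>i<N. cnj (M $$ (i, k)) * x $ i) = of_real (\<Sum>i<N. U i k * w i)" if "k < N" for k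
    using that by (simp add: M_index x_def)
  moreover have "(\<Sum>i<N. cnj (1\<^sub>m N $$ (i, k)) * x $ i) = of_real (w k)" if "k < N" for k
  proof -
    have "(\<Sum>i<N. cnj (1\<^sub>m N $$ (i, k)) * x $ i) = (\<Sum>i<N. if i = k then of_real (w k) else 0)"
      using that by (intro sum.cong) (auto simp: x_def)
    then show ?thesis using that by simp
  qed
  ultimately show ?thesis
    unfolding qdiff[OF car x] qform_unitary_conj[OF M x] qform_unitary_conj[OF one(2) x]
    by (simp del: of_real_sum)
qed

text \<open>\<open>diag a\<close> and \<open>diag a + v v\<^sup>T\<close> have spectra \<open>a\<close> and \<open>b\<close> when \<open>v\<^sub>i\<^sup>2 = - \<Prod>\<^sub>l (a\<^sub>i - b\<^sub>l) / \<Prod>\<^sub>l\<^sub>\<noteq>\<^sub>i (a\<^sub>i - a\<^sub>l)\<close>,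
  which is positive by interlacing; the eigenvectors form a Cauchy matrix.  The test vector \<open>w\<close> is
  chosen so that its coefficients in both eigenbases are values of \<open>r\<close>, by Lagrange interpolation.\<close>
lemma interlacing_divided_difference:
  fixes a b :: "nat \<Rightarrow> real" and r :: "real poly"
  assumes f: "matrix_monotone f" and pos: "\<And>i. i < N \<Longrightarrow> 0 < a i"
    and ab: "\<And>i. i < N \<Longrightarrow> a i < b i" and ba: "\<And>i j. i < j \<Longrightarrow> j < N \<Longrightarrow> b i < a j"
    and r: "degree r < N"
  shows "0 \<le> (\<Sum>i<N. f (a i) * (poly r (a i))\<^sup>2 / ((\<Prod>l\<in>{..<N} - {i}. a i - a l) * (\<Prod>l<N. a i - b l)))
    + (\<Sum>j<N. f (b j) * (poly r (b j))\<^sup>2 / ((\<Prod>l\<in>{..<N} - {j}. b j - b l) * (\<Prod>l<N. b j - a l)))"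
proof -
  have aa: "a i < a j" "b i < b j" if "i < j" "j < N" for i j
    using that ab[of i] ab[of j] ba[of i j] by auto
  have inj: "inj_on a {..<N}"
    using aa by (auto simp: inj_on_def) (metis less_irrefl linorder_neqE_nat)
  have ne: "b j \<noteq> a i" if "i < N" "j < N" for i j
    using that ab[of i] ab[of j] ba[of i j] ba[of j i] aa by (metis less_asym linorder_neqE_nat order_less_irrefl less_trans)
  define D where "D i = (\<Prod>l\<in>{..<N} - {i}. a i - a l)" for i
  define V where "V i = - (\<Prod>l<N. a i - b l) / D i" for i
  define Q where "Q j = (\<Prod>i<N. b j - a i)" for j
  define E where "E j = (\<Prod>l\<in>{..<N} - {j}. b j - b l)" for j
  define P where "P j = (\<Prod>l\<in>{..<N} - {j}. [:- b l, 1:])" for j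
  have D: "D i \<noteq> 0" if "i < N" for i using that inj by (auto simp: D_def inj_on_def)
  have Q: "Q j \<noteq> 0" if "j < N" for j using that ne by (auto simp: Q_def)
  \<comment> \<open>By interlacing, a_i - b_l and a_i - a_l have the same sign for each l other than
    i, and the unpaired factor b_i - a_i is positive.\<close>
  have V_pos: "0 < V i" if i: "i < N" for i
  proof -
    have eq: "(\<Prod>l<N. a i - b l) = (a i - b i) * (\<Prod>l\<in>{..<N} - {i}. a i - b l)"
      using i by (simp add: prod.remove)
    have "- ((a i - b i) * R) / D' = (b i - a i) * (R / D')" for R D'
      by (cases "D' = 0") (simp_all add: field_simps)
    then have "V i = (b i - a i) * (\<Prod>l\<in>{..<N} - {i}. (a i - b l) / (a i - a l))"
      by (simp only: V_def D_def eq prod_dividef)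
    also have "0 < \<dots>"
    proof (intro mult_pos_pos prod_pos ballI)
      fix l assume "l \<in> {..<N} - {i}"
      then consider "l < i" | "i < l" "l < N" by force
      then show "0 < (a i - b l) / (a i - a l)"
      proof cases
        case 1
        then show ?thesis using ba[of l i] aa[of l i] i by simp
      next
        case 2
        then show ?thesis using aa[of i l] ab[of l] by (intro divide_neg_neg) auto
      qed
    qed (use ab i in simp)
    finally show ?thesis .
  qed
  have degP: "degree (P j) = N - 1" "coeff (P j) (N - 1) = 1" if "j < N" for j
  proof -
    show 1: "degree (P j) = N - 1"
      unfolding P_def using that by (subst degree_prod_eq_sum_degree) auto
    have "lead_coeff (P j) = 1" by (simp add: P_def lead_coeff_prod)
    with 1 show "coeff (P j) (N - 1) = 1" by simp
  qed
  have PV: "poly (P j) (a i) / D i = V i / (b j - a i)" if "i < N" "j < N" for i j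
  proof -
    have eq: "(\<Prod>l<N. a i - b l) = (a i - b j) * poly (P j) (a i)"
      unfolding P_def poly_prod using that by (subst prod.remove[of _ j]) auto
    show ?thesis unfolding V_def eq using ne[OF that] D[OF that(1)] by (simp add: field_simps)
  qed
  \<comment> \<open>The secular equation, saying that b_j is an eigenvalue of diag a + v v^T. By
    interpolation the sum equals the leading coefficient of the monic \<open>P j\<close>.\<close>
  have sum_V: "(\<Sum>i<N. V i / (b j - a i)) = 1" if j: "j < N" for j
    using lagrange_top_coeff[of "{..<N}" a "P j"] inj degP[OF j] j PV[OF _ j]
    by (simp flip: D_def)
  \<comment> \<open>Inner products of the unnormalised eigenvectors. For distinct \<open>j\<close>
    and \<open>k\<close> the value vanishes since b_k is a root of \<open>P j\<close>; for
    \<open>j = k\<close> it is the squared norm \<open>\<nu> j\<close>.\<close>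
  have sum_VV: "(\<Sum>i<N. V i / ((b j - a i) * (b k - a i))) = poly (P j) (b k) / Q k" if jk: "j < N" "k < N" for j k
  proof -
    have "poly (P j) (b k) / Q k = (\<Sum>i<N. poly (P j) (a i) / (D i * (b k - a i)))"
      unfolding Q_def D_def using jk degP[OF jk(1)] ne
      by (intro lagrange_partial_fractions inj) auto
    also have "\<dots> = (\<Sum>i<N. poly (P j) (a i) / D i / (b k - a i))" by simp
    also have "\<dots> = (\<Sum>i<N. V i / (b j - a i) / (b k - a i))"
      by (intro sum.cong refl) (simp only: PV jk lessThan_iff)
    finally show ?thesis by simp
  qed
  define \<nu> where "\<nu> j = E j / Q j" for j
  have nu: "(\<Sum>i<N. V i / (b j - a i)\<^sup>2) = \<nu> j" if "j < N" for j
    using sum_VV[OF that that] by (simp add: \<nu>_def P_def E_def poly_prod power2_eq_square)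
  have nu_pos: "0 < \<nu> j" if "j < N" for j
  proof -
    have "0 < (\<Sum>i<N. V i / (b j - a i)\<^sup>2)"
      using that V_pos ne by (intro sum_pos divide_pos_pos) auto
    then show ?thesis using nu[OF that] by simp
  qed
  define U where "U i j = sqrt (V i) / ((b j - a i) * sqrt (\<nu> j))" for i j
  define w where "w i = poly r (a i) / (sqrt (V i) * D i)" for i
  have "(\<Sum>i<N. f (a i) * (w i)\<^sup>2) \<le> (\<Sum>j<N. f (b j) * (\<Sum>i<N. U i j * w i)\<^sup>2)"
  proof (rule matrix_monotone_rank_one[OF f, where v = "\<lambda>i. sqrt (V i)"])
    show "0 < b i" if "i < N" for i using pos[OF that] ab[OF that] by simp
    show "(\<Sum>i<N. U i j * U i k) = (if j = k then 1 else 0)" if jk: "j < N" "k < N" for j k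
    proof -
      have "(\<Sum>i<N. U i j * U i k) = (\<Sum>i<N. V i / ((b j - a i) * (b k - a i)) / (sqrt (\<nu> j) * sqrt (\<nu> k)))"
        using V_pos by (intro sum.cong) (auto simp: U_def less_imp_le)
      also have "\<dots> = poly (P j) (b k) / Q k / (sqrt (\<nu> j) * sqrt (\<nu> k))"
        unfolding sum_divide_distrib[symmetric] sum_VV[OF jk] ..
      also have "\<dots> = (if j = k then 1 else 0)"
      proof (cases "j = k")
        case True
        then have "poly (P j) (b k) / Q k = \<nu> j" by (simp add: \<nu>_def P_def E_def poly_prod)
        then show ?thesis using True nu_pos[OF jk(1)] by simp
      next
        case False
        then have "poly (P j) (b k) = 0" using jk by (auto simp: P_def poly_prod)
        then show ?thesis using False by simp
      qed
      finally show ?thesis .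
    qed
    show "a i * U i j + sqrt (V i) * (\<Sum>l<N. sqrt (V l) * U l j) = U i j * b j" if ij: "i < N" "j < N" for i j
    proof -
      have "(\<Sum>l<N. sqrt (V l) * U l j) = (\<Sum>l<N. V l / (b j - a l) / sqrt (\<nu> j))"
        using V_pos by (intro sum.cong) (auto simp: U_def less_imp_le)
      also have "\<dots> = 1 / sqrt (\<nu> j)"
        unfolding sum_divide_distrib[symmetric] sum_V[OF ij(2)] ..
      finally have "(\<Sum>l<N. sqrt (V l) * U l j) = 1 / sqrt (\<nu> j)" .
      moreover have "sqrt (V i) * (1 / sqrt (\<nu> j)) = (b j - a i) * U i j"
        using ne[OF ij] by (simp add: U_def)
      ultimately show ?thesis by (simp add: algebra_simps)
    qed
  qed (use pos in auto)
  moreover have "(w i)\<^sup>2 = - ((poly r (a i))\<^sup>2 / (D i * (\<Prod>l<N. a i - b l)))" if i: "i < N" for i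
  proof -
    have "(w i)\<^sup>2 = (poly r (a i))\<^sup>2 / (V i * (D i)\<^sup>2)"
      using V_pos[OF i] by (simp add: w_def power_divide power_mult_distrib)
    also have "V i * (D i)\<^sup>2 = - ((\<Prod>l<N. a i - b l) * D i)"
      using D[OF i] by (simp add: V_def power2_eq_square)
    finally show ?thesis by (simp add: mult.commute)
  qed
  moreover have "(\<Sum>i<N. U i j * w i)\<^sup>2 = (poly r (b j))\<^sup>2 / (E j * Q j)" if j: "j < N" for j
  proof -
    have "(\<Sum>i<N. U i j * w i) = (\<Sum>i<N. poly r (a i) / (D i * (b j - a i)) / sqrt (\<nu> j))"
      using V_pos by (intro sum.cong) (auto simp: U_def w_def dest: less_imp_neq[OF V_pos])
    also have "\<dots> = poly r (b j) / Q j / sqrt (\<nu> j)"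
      unfolding sum_divide_distrib[symmetric] Q_def D_def
      using j r ne by (subst lagrange_partial_fractions[OF _ inj]) auto
    finally have "(\<Sum>i<N. U i j * w i)\<^sup>2 = (poly r (b j))\<^sup>2 / ((Q j)\<^sup>2 * \<nu> j)"
      using nu_pos[OF j] by (simp add: power_divide power_mult_distrib)
    also have "(Q j)\<^sup>2 * \<nu> j = E j * Q j"
      using Q[OF j] by (simp add: \<nu>_def power2_eq_square)
    finally show ?thesis .
  qed
  ultimately have "(\<Sum>i<N. - (f (a i) * (poly r (a i))\<^sup>2 / (D i * (\<Prod>l<N. a i - b l))))
      \<le> (\<Sum>j<N. f (b j) * (poly r (b j))\<^sup>2 / (E j * Q j))"
    by simp
  then show ?thesis unfolding D_def E_def Q_def by (simp add: sum_negf)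
qed

text \<open>The sum is the divided difference of f r^2 over \<open>X\<close>. Taking the sorted
  elements alternately as \<open>a\<close> and \<open>b\<close> produces the interlacing.\<close>

lemma matrix_monotone_divided_difference_nonneg:
  fixes X :: "real set" and r :: "real poly"
  assumes f: "matrix_monotone f" and X: "finite X" "X \<subseteq> {0<..}" "card X = 2 * N" and r: "degree r < N"
  shows "0 \<le> (\<Sum>x\<in>X. f x * (poly r x)\<^sup>2 / (\<Prod>y\<in>X - {x}. x - y))"
proof -
  define xs where "xs = sorted_list_of_set X"
  have xs: "set xs = X" "length xs = 2 * N" "sorted_wrt (<) xs"
    using X by (auto simp: xs_def)
  define a b where "a i = xs ! (2 * i)" and "b i = xs ! (2 * i + 1)" for i
  have lt: "xs ! i < xs ! j" if "i < j" "j < 2 * N" for i j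
    using sorted_wrt_nth_less[OF xs(3) that(1)] that xs(2) by simp
  have ab: "a i < b i" if "i < N" for i using that by (auto simp: a_def b_def intro!: lt)
  have ba: "b i < a j" if "i < j" "j < N" for i j using that by (auto simp: a_def b_def intro!: lt)
  have aX: "a i \<in> X" "b i \<in> X" if "i < N" for i
    using that xs by (auto simp: a_def b_def simp flip: xs(1))
  have inj: "inj_on a {..<N}" "inj_on b {..<N}"
    using ab ba by (auto simp: inj_on_def) (smt (verit) linorder_neqE_nat)+
  have disj: "a ` {..<N} \<inter> b ` {..<N} = {}"
    using ab ba by (auto) (smt (verit) linorder_neqE_nat)
  have XU: "X = a ` {..<N} \<union> b ` {..<N}"
  proof
    show "X \<subseteq> a ` {..<N} \<union> b ` {..<N}"
    proof
      fix x assume "x \<in> X"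
      then obtain k where k: "k < 2 * N" "x = xs ! k" using xs by (metis in_set_conv_nth)
      show "x \<in> a ` {..<N} \<union> b ` {..<N}"
      proof (cases "even k")
        case True
        then obtain i where "k = 2 * i" by blast
        then show ?thesis using k by (auto simp: a_def)
      next
        case False
        then obtain i where "k = 2 * i + 1" by (metis oddE)
        then show ?thesis using k by (auto simp: b_def)
      qed
    qed
  qed (use aX in auto)
  have split: "sum F X = (\<Sum>i<N. F (a i)) + (\<Sum>i<N. F (b i))" for F :: "real \<Rightarrow> real"
    unfolding XU using disj inj by (simp add: sum.union_disjoint sum.reindex)
  have pa: "(\<Prod>y\<in>X - {a i}. a i - y) = (\<Prod>l\<in>{..<N} - {i}. a i - a l) * (\<Prod>l<N. a i - b l)" if i: "i < N" for i
  proof -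
    have "X - {a i} = a ` ({..<N} - {i}) \<union> b ` {..<N}"
      using XU disj inj i by (auto simp: inj_on_def)
    moreover have "a ` ({..<N} - {i}) \<inter> b ` {..<N} = {}" using disj by auto
    ultimately show ?thesis
      using inj by (simp add: prod.union_disjoint prod.reindex inj_on_diff)
  qed
  have pb: "(\<Prod>y\<in>X - {b i}. b i - y) = (\<Prod>l\<in>{..<N} - {i}. b i - b l) * (\<Prod>l<N. b i - a l)" if i: "i < N" for i
  proof -
    have "X - {b i} = b ` ({..<N} - {i}) \<union> a ` {..<N}"
      using XU disj inj i by (auto simp: inj_on_def)
    moreover have "b ` ({..<N} - {i}) \<inter> a ` {..<N} = {}" using disj by auto
    ultimately show ?thesis
      using inj by (simp add: prod.union_disjoint prod.reindex inj_on_diff)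
  qed
  have "0 < a i" if "i < N" for i using aX[OF that] X(2) by auto
  from interlacing_divided_difference[OF f this ab ba r]
  show ?thesis unfolding split by (simp add: pa pb)
qed

section \<open>Matrix monotone functions as limits of the kernels\<close>

text \<open>A divided difference over 1/2, 1, R, 2R. A linear \<open>r\<close> vanishing at 2R
  removes that node, and the term at 1/2 is nonpositive, so \<open>f R\<close> is compared with
  \<open>f 1\<close> alone.\<close>

lemma matrix_monotone_linear_growth:
  assumes f: "matrix_monotone f" and pos: "\<And>x. 0 < x \<Longrightarrow> 0 < f x" and R: "1 < R"
  shows "f R \<le> 4 * R * f 1"
proof -
  define X where "X = {1/2, 1, R, 2 * R}"
  have ne: "1/2 \<noteq> (1::real)" "1/2 \<noteq> R" "1/2 \<noteq> 2 * R" "1 \<noteq> R" "1 \<noteq> 2 * R" "R \<noteq> 2 * R"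
    using R by auto
  then have "card X = 2 * 2" by (auto simp: X_def)
  then have "0 \<le> (\<Sum>x\<in>X. f x * (poly [:- 2 * R, 1:] x)\<^sup>2 / (\<Prod>y\<in>X - {x}. x - y))"
    using R by (intro matrix_monotone_divided_difference_nonneg[OF f, where N=2]) (auto simp: X_def)
  also have "\<dots> = (\<Sum>x\<in>X. f x * (x - 2 * R)\<^sup>2 / (\<Prod>y\<in>X - {x}. x - y))"
    by simp
  also have "\<dots> = f (1/2) * (1/2 - 2 * R)\<^sup>2 / ((1/2 - 1) * ((1/2 - R) * (1/2 - 2 * R)))
    + f 1 * (1 - 2 * R)\<^sup>2 / ((1 - 1/2) * ((1 - R) * (1 - 2 * R)))
    + f R * (R - 2 * R)\<^sup>2 / ((R - 1/2) * ((R - 1) * (R - 2 * R)))"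
  proof -
    have "X - {1/2} = {1, R, 2 * R}" "X - {1} = {1/2, R, 2 * R}" "X - {R} = {1/2, 1, 2 * R}"
      using ne by (auto simp: X_def)
    note this[unfolded X_def]
    then show ?thesis using ne by (simp add: X_def del: mult_eq_0_iff)
  qed
  finally have *: "0 \<le> \<dots>" .
  have 1: "f (1/2) * (1/2 - 2 * R)\<^sup>2 / ((1/2 - 1) * ((1/2 - R) * (1/2 - 2 * R))) \<le> 0"
    using R pos[of "1/2"] by (intro divide_nonneg_neg mult_nonneg_nonneg mult_neg_pos mult_neg_neg) auto
  have 2: "f 1 * (1 - 2 * R)\<^sup>2 / ((1 - 1/2) * ((1 - R) * (1 - 2 * R))) = 2 * f 1 * (2 * R - 1) / (R - 1)"
    using R by (simp add: divide_simps power2_eq_square) (simp add: algebra_simps)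
  have 3: "f R * (R - 2 * R)\<^sup>2 / ((R - 1/2) * ((R - 1) * (R - 2 * R))) = - (f R * R / ((R - 1/2) * (R - 1)))"
    using R by (simp add: divide_simps power2_eq_square)
  have "f R * R / ((R - 1/2) * (R - 1)) \<le> 2 * f 1 * (2 * R - 1) / (R - 1)"
    using * 1 unfolding 2 3 by linarith
  then have "f R * R / ((R - 1/2) * (R - 1)) * ((R - 1/2) * (R - 1)) \<le> 2 * f 1 * (2 * R - 1) / (R - 1) * ((R - 1/2) * (R - 1))"
    using R by (intro mult_right_mono) auto
  then have "f R * R \<le> 2 * f 1 * (2 * R - 1) * (R - 1/2)"
    using R by simp
  also have "\<dots> = f 1 * (2 * R - 1)\<^sup>2" by (simp add: power2_eq_square algebra_simps)
  also have "\<dots> \<le> f 1 * (2 * R)\<^sup>2"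
    using R pos[of 1] by (intro mult_left_mono power_mono) auto
  also have "\<dots> = 4 * R * f 1 * R" by (simp add: power2_eq_square)
  finally show ?thesis using R by (simp add: mult_ac)
qed

text \<open>Add the nodes \<open>1 / R\<close> and \<open>R\<close> to \<open>X\<close> and let \<open>R\<close> tend to infinity: the term at \<open>1 / R\<close> has a
  sign, and the one at \<open>R\<close> vanishes in the limit because \<open>f\<close> grows at most linearly.\<close>
lemma matrix_monotone_divided_difference_nonpos:
  fixes X :: "real set" and r :: "real poly"
  assumes f: "matrix_monotone f" and pos: "\<And>x. 0 < x \<Longrightarrow> 0 < f x"
    and X: "finite X" "X \<subseteq> {0<..}" "card X = 2 * m" and r: "degree r < m"
  shows "(\<Sum>x\<in>X. f x * (poly r x)\<^sup>2 / (x * (\<Prod>y\<in>X - {x}. x - y))) \<le> 0"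
proof -
  define \<omega> where "\<omega> x = (\<Prod>y\<in>X - {x}. x - y)" for x
  define \<Omega> where "\<Omega> = (\<Prod>y\<in>X. [:- y, 1:])"
  define c where "c x = f x * (poly r x)\<^sup>2 / \<omega> x" for x
  \<comment> \<open>The terms at the old nodes, multiplied by \<open>R\<close>: since (x - R)/R
    tends to -1, \<open>S R\<close> tends to minus the sum in the claim.\<close>
  define S where "S R = (\<Sum>x\<in>X. c x / ((x - 1 / R) * (x / R - 1)))" for R
  \<comment> \<open>Bounds \<open>R\<close> times the term at the node \<open>R\<close>, with
    \<open>f R\<close> replaced by \<open>4 * R * f 1\<close>. It tends to zero because the
    numerator has degree at most 2m - 1 and \<open>\<Omega>\<close> has degree 2m.\<close>
  define G where "G R = f 1 * (4 * (R / (R - 1 / R))) * (poly ([:0, 1:] * (r * r)) R / poly \<Omega> R)" for R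
  have even: "even (card X)" using X by simp
  have deg_\<Omega>: "degree \<Omega> = 2 * m"
    unfolding \<Omega>_def using X(3) by (subst degree_prod_eq_sum_degree) auto
  have poly_\<Omega>: "poly \<Omega> R = (\<Prod>y\<in>X. R - y)" for R by (simp add: \<Omega>_def poly_prod)
  \<comment> \<open>Beyond \<open>B\<close> the new nodes 1/R and R lie on either side of all of
    \<open>X\<close>.\<close>
  obtain B where B: "\<And>x. x \<in> X \<Longrightarrow> x < B" "\<And>x. x \<in> X \<Longrightarrow> 1 / B < x" "1 < B"
  proof -
    define B where "B = 2 + (\<Sum>x\<in>X. x + 1 / x)"
    have le: "x + 1 / x \<le> (\<Sum>x\<in>X. x + 1 / x)" if "x \<in> X" for x
      using X that by (intro member_le_sum) auto
    have nonneg: "0 \<le> (\<Sum>x\<in>X. x + 1 / x)" using X by (intro sum_nonneg) auto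
    show ?thesis
    proof (rule that[of B])
      fix x assume x: "x \<in> X"
      then have x0: "0 < x" using X by auto
      show "x < B" using le[OF x] x0 by (simp add: B_def) (smt (verit) divide_pos_pos)
      have "1 / x < B" using le[OF x] x0 by (simp add: B_def)
      then show "1 / B < x" using x0 nonneg by (simp add: B_def field_simps)
    qed (use nonneg in \<open>simp add: B_def\<close>)
  qed
  have SG: "0 \<le> S R + G R" if R: "B < R" for R
  proof -
    have R1: "1 < R" using R B(3) by simp
    define \<epsilon> where "\<epsilon> = 1 / R"
    have \<epsilon>: "0 < \<epsilon>" "\<epsilon> < 1" using R1 by (auto simp: \<epsilon>_def)
    have "\<epsilon> < 1 / B" using R B(3) by (simp add: \<epsilon>_def frac_less2)
    then have lt: "\<epsilon> < x" "x < R" if "x \<in> X" for x using B(1,2)[OF that] R by auto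
    define Y where "Y = insert \<epsilon> (insert R X)"
    have notin: "\<epsilon> \<notin> X" "R \<notin> X" "\<epsilon> \<noteq> R" using lt \<epsilon> R1 by force+
    have "0 \<le> (\<Sum>x\<in>Y. f x * (poly r x)\<^sup>2 / (\<Prod>y\<in>Y - {x}. x - y))"
      by (rule matrix_monotone_divided_difference_nonneg[OF f, where N="m + 1"])
        (use X r notin \<epsilon> R1 in \<open>auto simp: Y_def\<close>)
    also have "\<dots> = f \<epsilon> * (poly r \<epsilon>)\<^sup>2 / ((\<epsilon> - R) * (\<Prod>y\<in>X. \<epsilon> - y))
        + f R * (poly r R)\<^sup>2 / ((R - \<epsilon>) * (\<Prod>y\<in>X. R - y))
        + (\<Sum>x\<in>X. f x * (poly r x)\<^sup>2 / ((x - \<epsilon>) * ((x - R) * \<omega> x)))"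
    proof -
      have 1: "Y - {\<epsilon>} = insert R X" "Y - {R} = insert \<epsilon> X" using notin by (auto simp: Y_def)
      have 2: "Y - {x} = insert \<epsilon> (insert R (X - {x}))" if "x \<in> X" for x
        using notin that by (auto simp: Y_def)
      have "(\<Prod>y\<in>Y - {x}. x - y) = (x - \<epsilon>) * ((x - R) * \<omega> x)" if "x \<in> X" for x
        unfolding 2[OF that] using X notin by (simp add: \<omega>_def)
      then have "(\<Sum>x\<in>X. f x * (poly r x)\<^sup>2 / (\<Prod>y\<in>Y - {x}. x - y)) =
          (\<Sum>x\<in>X. f x * (poly r x)\<^sup>2 / ((x - \<epsilon>) * ((x - R) * \<omega> x)))"
        by (intro sum.cong) auto
      moreover have "(\<Sum>x\<in>Y. F x) = F \<epsilon> + F R + (\<Sum>x\<in>X. F x)" for F :: "real \<Rightarrow> real"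
        using X notin by (simp add: Y_def)
      ultimately show ?thesis
        using X notin by (simp add: 1)
    qed
    also have "f \<epsilon> * (poly r \<epsilon>)\<^sup>2 / ((\<epsilon> - R) * (\<Prod>y\<in>X. \<epsilon> - y)) \<le> 0"
    proof -
      \<comment> \<open>An even number of negative factors: the product is positive, and
        \<open>\<epsilon> - R\<close> decides the sign of the term.\<close>
      have "(\<Prod>y\<in>X. \<epsilon> - y) = (\<Prod>y\<in>X. (-1) * (y - \<epsilon>))" by simp
      also have "\<dots> = (-1) ^ card X * (\<Prod>y\<in>X. y - \<epsilon>)" unfolding prod.distrib by simp
      finally have "0 < (\<Prod>y\<in>X. \<epsilon> - y)" using even lt by (simp add: prod_pos)
      then show ?thesis
        using \<epsilon> R1 pos[of \<epsilon>] by (intro divide_nonneg_neg mult_nonneg_nonneg mult_neg_pos) auto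
    qed
    finally have "0 \<le> f R * (poly r R)\<^sup>2 / ((R - \<epsilon>) * poly \<Omega> R)
        + (\<Sum>x\<in>X. f x * (poly r x)\<^sup>2 / ((x - \<epsilon>) * ((x - R) * \<omega> x)))"
      by (simp add: poly_\<Omega>)
    then have "0 \<le> R * (f R * (poly r R)\<^sup>2 / ((R - \<epsilon>) * poly \<Omega> R)
        + (\<Sum>x\<in>X. f x * (poly r x)\<^sup>2 / ((x - \<epsilon>) * ((x - R) * \<omega> x))))"
      using R1 by simp
    also have "\<dots> = R * (f R * (poly r R)\<^sup>2 / ((R - \<epsilon>) * poly \<Omega> R)) + S R"
    proof -
      have "R * (f x * (poly r x)\<^sup>2 / ((x - \<epsilon>) * ((x - R) * \<omega> x))) = c x / ((x - 1 / R) * (x / R - 1))"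
        if "x \<in> X" for x
      proof -
        have "x - R = R * (x / R - 1)" using R1 by (simp add: field_simps)
        then have "R * (q / (e * ((x - R) * w))) = q / w / (e * (x / R - 1))" for q e w
          using R1 by simp
        then show ?thesis unfolding c_def \<epsilon>_def .
      qed
      then show ?thesis by (simp add: S_def distrib_left sum_distrib_left)
    qed
    also have "R * (f R * (poly r R)\<^sup>2 / ((R - \<epsilon>) * poly \<Omega> R)) \<le> G R"
    proof -
      have "0 < poly \<Omega> R" unfolding poly_\<Omega> using lt by (intro prod_pos) auto
      then have "0 \<le> R * (poly r R)\<^sup>2 / ((R - \<epsilon>) * poly \<Omega> R)"
        using \<epsilon> R1 by (intro divide_nonneg_nonneg mult_nonneg_nonneg) auto
      from mult_right_mono[OF matrix_monotone_linear_growth[OF f pos R1] this]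
      have "f R * (R * (poly r R)\<^sup>2 / ((R - \<epsilon>) * poly \<Omega> R)) \<le> 4 * R * f 1 * (R * (poly r R)\<^sup>2 / ((R - \<epsilon>) * poly \<Omega> R))"
        by simp
      also have "\<dots> = G R" by (simp add: G_def \<epsilon>_def power2_eq_square)
      finally show ?thesis by (simp add: mult.left_commute)
    qed
    finally show ?thesis by simp
  qed
  have inv0: "((\<lambda>R::real. 1 / R) \<longlongrightarrow> 0) at_top"
    using tendsto_inverse_0_at_top[OF filterlim_ident] by (simp add: inverse_eq_divide)
  have "((\<lambda>R. S R) \<longlongrightarrow> (\<Sum>x\<in>X. c x / ((x - 0) * (x * 0 - 1)))) at_top"
  proof -
    have "((\<lambda>R. \<Sum>x\<in>X. c x / ((x - 1 / R) * (x * (1 / R) - 1))) \<longlongrightarrow> (\<Sum>x\<in>X. c x / ((x - 0) * (x * 0 - 1)))) at_top"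
      using X(2) by (intro tendsto_intros inv0) auto
    then show ?thesis by (simp add: S_def)
  qed
  moreover have "(G \<longlongrightarrow> f 1 * (4 * (1 / (1 - 0))) * 0) at_top"
  proof -
    have lim1: "((\<lambda>R::real. R / (R - 1 / R)) \<longlongrightarrow> 1 / (1 - 0)) at_top"
    proof (rule Lim_transform_eventually)
      show "((\<lambda>R::real. 1 / (1 - 1 / R * (1 / R))) \<longlongrightarrow> 1 / (1 - 0)) at_top"
        by (rule tendsto_eq_intros refl inv0 | simp)+
      show "\<forall>\<^sub>F R::real in at_top. 1 / (1 - 1 / R * (1 / R)) = R / (R - 1 / R)"
        using eventually_gt_at_top[of 1] by eventually_elim (simp add: divide_simps)
    qed
    have lim2: "((\<lambda>R. poly ([:0, 1:] * (r * r)) R / poly \<Omega> R) \<longlongrightarrow> 0) at_top"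
    proof (rule tendsto_mono[OF at_top_le_at_infinity poly_divide_tendsto_0_at_infinity])
      have "degree ([:0, 1:] * (r * r)) \<le> 1 + (degree r + degree r)"
        by (intro order_trans[OF degree_mult_le] add_mono degree_mult_le) simp
      then show "degree ([:0, 1:] * (r * r)) < degree \<Omega>" using r deg_\<Omega> by linarith
    qed
    show ?thesis unfolding G_def by (intro tendsto_mult tendsto_const lim1 lim2)
  qed
  ultimately have "((\<lambda>R. S R + G R) \<longlongrightarrow> (\<Sum>x\<in>X. c x / ((x - 0) * (x * 0 - 1))) + f 1 * (4 * (1 / (1 - 0))) * 0) at_top"
    by (rule tendsto_add)
  moreover have "\<forall>\<^sub>F R in at_top. 0 \<le> S R + G R"
    using eventually_gt_at_top[of B] by eventually_elim (rule SG)
  ultimately have "0 \<le> (\<Sum>x\<in>X. c x / ((x - 0) * (x * 0 - 1))) + f 1 * (4 * (1 / (1 - 0))) * 0"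
    by (intro tendsto_lowerbound) auto
  then show ?thesis
    by (simp add: c_def \<omega>_def sum_negf mult.commute)
qed

text \<open>With \<open>s = z / (1 + z)\<close> the hypothesis says that the real polynomial \<open>q\<close> with
  \<open>q (- x) = c x * x * \<Prod>\<^sub>y\<^sub>\<noteq>\<^sub>x (y - x)\<close> for \<open>x \<in> X\<close> is nonnegative on the half line, so it suffices to treat the
  two kinds of generators \<open>r\<^sup>2\<close> and \<open>z r\<^sup>2\<close>.\<close>
lemma matrix_monotone_dual_cone:
  fixes X :: "real set" and c :: "real \<Rightarrow> real"
  assumes f: "matrix_monotone f" and pos: "\<And>x. 0 < x \<Longrightarrow> 0 < f x"
    and X: "finite X" "X \<subseteq> {0<..}" "card X = 2 * m" "0 < m"
    and c: "\<And>s. 0 \<le> s \<Longrightarrow> s \<le> 1 \<Longrightarrow> 0 \<le> (\<Sum>x\<in>X. c x * (x / (s + (1 - s) * x)))"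
  shows "0 \<le> (\<Sum>x\<in>X. c x * f x)"
proof -
  \<comment> \<open>The numerator of the kernel sum over a common denominator: q(z) is the sum in
    the hypothesis times the positive quantity \<Prod>(z + y) / (1 + z).\<close>
  define q where "q = (\<Sum>x\<in>X. smult (c x * x) (\<Prod>y\<in>X - {x}. [:y, 1:]))"
  have poly_q: "poly q z = (\<Sum>x\<in>X. c x * x * (\<Prod>y\<in>X - {x}. z + y))" for z
    by (simp add: q_def poly_sum poly_prod add.commute)
  have "degree (\<Prod>l\<in>X - {x}. [:l, 1:]) \<le> card X - 1" if "x \<in> X" for x
    using degree_prod_sum_le[of "X - {x}" "\<lambda>l. [:l, 1:]"] X that by simp
  then have deg: "degree q \<le> 2 * m - 1"
    unfolding q_def X(3)[symmetric] by (intro degree_sum_le X) (auto intro: order_trans[OF degree_smult_le])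
  have "0 \<le> poly q z" if z: "0 \<le> z" for z
  proof -
    define s where "s = z / (1 + z)"
    have s: "0 \<le> s" "s \<le> 1" using z by (auto simp: s_def)
    have "c x * x * (\<Prod>y\<in>X - {x}. z + y) = (\<Prod>y\<in>X. z + y) / (1 + z) * (c x * (x / (s + (1 - s) * x)))"
      if x: "x \<in> X" for x
    proof -
      have "0 < z + x" using X(2) x z by auto
      have "1 - s = 1 / (1 + z)" using z by (simp add: s_def field_simps)
      then have "s + (1 - s) * x = (z + x) / (1 + z)" by (simp add: s_def add_divide_distrib)
      moreover have "(\<Prod>y\<in>X. z + y) = (z + x) * (\<Prod>y\<in>X - {x}. z + y)"
        using X x by (simp add: prod.remove)
      ultimately show ?thesis using z \<open>0 < z + x\<close> by simp
    qed
    then have "poly q z = (\<Prod>y\<in>X. z + y) / (1 + z) * (\<Sum>x\<in>X. c x * (x / (s + (1 - s) * x)))"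
      unfolding poly_q sum_distrib_left by (intro sum.cong) auto
    moreover have "0 \<le> (\<Prod>y\<in>X. z + y)" using X z by (intro prod_nonneg) auto
    ultimately show ?thesis using c[OF s] z by simp
  qed
  then have sos: "half_line_sos (2 * m - 1) q"
    using half_line_sos_if_nonneg half_line_sos_mono[OF _ deg] by blast
  \<comment> \<open>Chosen so that \<open>\<Lambda> q\<close> is the sum in the claim, since at -x
    only one summand of \<open>q\<close> survives. On r^2 and z r^2 it becomes one of the two
    divided difference sums, with opposite signs.\<close>
  define \<Lambda> where "\<Lambda> p = (\<Sum>x\<in>X. f x * poly p (- x) / (x * (\<Prod>y\<in>X - {x}. y - x)))" for p
  have flip: "(\<Prod>y\<in>X - {x}. y - x) = - (\<Prod>y\<in>X - {x}. x - y)" if x: "x \<in> X" for x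
  proof -
    have "(\<Prod>y\<in>X - {x}. y - x) = (\<Prod>y\<in>X - {x}. (-1) * (x - y))" by simp
    also have "\<dots> = (-1) ^ card (X - {x}) * (\<Prod>y\<in>X - {x}. x - y)" unfolding prod.distrib by simp
    also have "odd (card (X - {x}))" using X x by simp
    then have "(-1 :: real) ^ card (X - {x}) = -1" by simp
    finally show ?thesis by simp
  qed
  have mirror: "\<exists>r'. degree r' < m \<and> (\<forall>x. poly r' x = poly r (- x))" if "degree r < m" for r :: "real poly"
    using that degree_pcompose_le[of r "[:0, -1:]"]
    by (intro exI[of _ "r \<circ>\<^sub>p [:0, -1:]"]) (auto simp: poly_pcompose)
  \<comment> \<open>The bound 2m - 1 forces degree r < m for r^2 (by parity) as well as for z r^2,
    exactly the range of the divided difference inequalities.\<close>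
  have "0 \<le> \<Lambda> p" if "half_line_sos (2 * m - 1) p" for p
    using that
  proof (induction rule: half_line_sos.induct)
    case (square r)
    have "degree r < m"
      using square X(4) by (cases "r = 0") (auto simp: degree_mult_eq)
    then obtain r' where r': "degree r' < m" "\<And>x. poly r' x = poly r (- x)" using mirror by blast
    have "\<Lambda> (r * r) = (\<Sum>x\<in>X. - (f x * (poly r' x)\<^sup>2 / (x * (\<Prod>y\<in>X - {x}. x - y))))"
      unfolding \<Lambda>_def by (intro sum.cong refl) (simp add: flip r' power2_eq_square)
    then show ?case
      using matrix_monotone_divided_difference_nonpos[OF f pos X(1-3) r'(1)] by (simp add: sum_negf)
  next
    case (x_square r)
    have "degree r < m"
    proof (cases "r = 0")
      case False
      then have "degree ([:0, 1:] * (r * r)) = 1 + (degree r + degree r)"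
        by (subst degree_mult_eq) (auto simp: degree_mult_eq)
      then show ?thesis using x_square by linarith
    qed (use X in auto)
    then obtain r' where r': "degree r' < m" "\<And>x. poly r' x = poly r (- x)" using mirror by blast
    have "\<Lambda> ([:0, 1:] * (r * r)) = (\<Sum>x\<in>X. f x * (poly r' x)\<^sup>2 / (\<Prod>y\<in>X - {x}. x - y))"
      unfolding \<Lambda>_def
    proof (intro sum.cong refl)
      fix x assume x: "x \<in> X"
      then have "x \<noteq> 0" using X by auto
      then show "f x * poly ([:0, 1:] * (r * r)) (- x) / (x * (\<Prod>y\<in>X - {x}. y - x)) =
          f x * (poly r' x)\<^sup>2 / (\<Prod>y\<in>X - {x}. x - y)"
        by (simp add: flip[OF x] r' power2_eq_square)
    qed
    then show ?case
      using matrix_monotone_divided_difference_nonneg[OF f X(1-3) r'(1)] by simp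
  next
    case (add p q)
    then show ?case by (simp add: \<Lambda>_def sum.distrib distrib_left add_divide_distrib)
  qed
  from this[OF sos] have "0 \<le> \<Lambda> q" .
  also have "\<Lambda> q = (\<Sum>x\<in>X. c x * f x)"
    unfolding \<Lambda>_def
  proof (intro sum.cong refl)
    fix x assume x: "x \<in> X"
    have "poly q (- x) = (\<Sum>z\<in>X. if z = x then c x * x * (\<Prod>y\<in>X - {x}. y - x) else 0)"
      unfolding poly_q
    proof (intro sum.cong refl)
      fix z assume "z \<in> X"
      show "c z * z * (\<Prod>y\<in>X - {z}. - x + y) = (if z = x then c x * x * (\<Prod>y\<in>X - {x}. y - x) else 0)"
      proof (cases "z = x")
        case False
        then have "(\<Prod>y\<in>X - {z}. - x + y) = 0" using x X by (intro prod_zero) auto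
        then show ?thesis using False by simp
      qed simp
    qed
    then have "poly q (- x) = c x * (x * (\<Prod>y\<in>X - {x}. y - x))" using x X by simp
    moreover have "x * (\<Prod>y\<in>X - {x}. y - x) \<noteq> 0" using x X by auto
    ultimately show "f x * poly q (- x) / (x * (\<Prod>y\<in>X - {x}. y - x)) = c x * f x" by simp
  qed
  finally show ?thesis .
qed

text \<open>No separation theorem is needed: by duality every \<open>e\<close> in the hull admits a kernel \<open>h\<close> with
  \<open>\<langle>e - f, h - f\<rangle> \<le> 0\<close> up to an arbitrarily small error, and a short step from \<open>e\<close> towards \<open>h\<close>
  decreases the squared distance to \<open>f\<close> unless its infimum is zero.\<close>
lemma matrix_monotone_kernel_hull_dense:
  fixes X :: "real set"
  assumes f: "matrix_monotone f" and pos: "\<And>x. 0 < x \<Longrightarrow> 0 < f x" and f1: "f 1 = 1"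
    and X: "finite X" "X \<subseteq> {0<..}" "card X = 2 * m" "1 \<in> X" and \<epsilon>: "0 < \<epsilon>"
  obtains e where "e \<in> kernel_hull" "\<And>x. x \<in> X \<Longrightarrow> \<bar>Re (e (of_real x)) - f x\<bar> < \<epsilon>"
proof -
  define k where "k s x = x / (s + (1 - s) * x)" for s x :: real
  have m: "0 < m" using X by (metis card_gt_0_iff empty_iff mult_0_right neq0_conv)
  have descent: "\<exists>s. 0 \<le> s \<and> s \<le> 1 \<and> (\<Sum>x\<in>X. c x * k s x) < (\<Sum>x\<in>X. c x * f x) + \<eta>"
    if \<eta>: "0 < \<eta>" for c and \<eta> :: real
  proof (rule ccontr)
    assume contra: "\<not> ?thesis"
    define b where "b = (\<Sum>x\<in>X. c x * f x) + \<eta>"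
    \<comment> \<open>All kernels and \<open>f\<close> equal 1 at the node 1, so lowering its
      coefficient by \<open>b\<close> subtracts \<open>b\<close> from every such sum. This makes the
      affine inequality homogeneous, as the dual cone statement requires.\<close>
    define c' where "c' x = c x - (if x = 1 then b else 0)" for x
    have sum_c': "(\<Sum>x\<in>X. c' x * h x) = (\<Sum>x\<in>X. c x * h x) - b * h 1" for h
    proof -
      have "(\<Sum>x\<in>X. c' x * h x) = (\<Sum>x\<in>X. c x * h x - (if x = 1 then b * h 1 else 0))"
        by (intro sum.cong) (auto simp: c'_def left_diff_distrib)
      then show ?thesis using X by (simp add: sum_subtractf)
    qed
    have "0 \<le> (\<Sum>x\<in>X. c' x * f x)"
    proof (rule matrix_monotone_dual_cone[OF f pos X(1-3) m])
      fix s :: real assume s: "0 \<le> s" "s \<le> 1"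
      then have "b \<le> (\<Sum>x\<in>X. c x * k s x)" using contra by (auto simp: b_def not_less)
      then show "0 \<le> (\<Sum>x\<in>X. c' x * (x / (s + (1 - s) * x)))"
        using sum_c'[of "k s"] by (simp add: k_def)
    qed
    then show False using \<eta> by (simp add: sum_c' f1 b_def)
  qed
  define err where "err e = (\<Sum>x\<in>X. (Re (e (complex_of_real x)) - f x)\<^sup>2)" for e
  define d where "d = Inf (err ` kernel_hull)"
  have err_nonneg: "0 \<le> err e" for e by (simp add: err_def sum_nonneg)
  have bdd: "bdd_below (err ` kernel_hull)" using err_nonneg by (intro bdd_belowI2[of _ 0])
  have d_le: "d \<le> err e" if "e \<in> kernel_hull" for e
    unfolding d_def by (intro cInf_lower bdd imageI that)
  have ne: "err ` kernel_hull \<noteq> {}" using kernel_hull.kernel[of 0] by auto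
  have d_nonneg: "0 \<le> d" unfolding d_def using ne err_nonneg by (intro cInf_greatest) auto
  \<comment> \<open>A bound, uniform in \<open>s\<close>, for the squared distance of a kernel to
    \<open>f\<close>, based on 0 <= h_s(x) <= 1 + x.\<close>
  define C where "C = (\<Sum>x\<in>X. (1 + x + \<bar>f x\<bar>)\<^sup>2)"
  have C: "0 \<le> C" "(\<Sum>x\<in>X. (k s x - f x)\<^sup>2) \<le> C" if "0 \<le> s" "s \<le> 1" for s
  proof -
    show "0 \<le> C" by (simp add: C_def sum_nonneg)
    show "(\<Sum>x\<in>X. (k s x - f x)\<^sup>2) \<le> C"
      unfolding C_def
    proof (rule sum_mono)
      fix x assume "x \<in> X"
      then have x: "0 < x" using X by auto
      have den: "0 < s + (1 - s) * x"
        using that x by (cases "s = 0") (auto intro!: add_pos_nonneg)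
      have "x \<le> (1 + x) * (s + (1 - s) * x)"
      proof -
        have "(1 + x) * (s + (1 - s) * x) = x + s + (1 - s) * (x * x)" by (simp add: algebra_simps)
        then show ?thesis using that x by simp
      qed
      then have "0 \<le> k s x" "k s x \<le> 1 + x" using den x by (simp_all add: k_def divide_le_eq)
      then have "\<bar>k s x - f x\<bar> \<le> \<bar>1 + x + \<bar>f x\<bar>\<bar>" using x by linarith
      then show "(k s x - f x)\<^sup>2 \<le> (1 + x + \<bar>f x\<bar>)\<^sup>2" by (simp add: abs_le_square_iff)
    qed
  qed
  have "d = 0"
  proof (rule ccontr)
    assume "d \<noteq> 0"
    then have d: "0 < d" using d_nonneg by simp
    have C0: "0 \<le> C" using C(1)[of 0] by simp
    \<comment> \<open>The minimiser of (1 - \<tau>)^2 d + \<tau>^2 C, which bounds the new error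
      when the old one is \<open>d\<close> and the cross term is not positive. \<open>gap\<close> is
      the decrease obtained; \<open>gap / 4\<close> is granted to each of these two idealisations,
      and the total excess stays below \<open>gap\<close>.\<close>
    define \<tau> where "\<tau> = d / (C + d)"
    have \<tau>: "0 < \<tau>" "\<tau> \<le> 1" using d C0 by (auto simp: \<tau>_def)
    define gap where "gap = d - ((1 - \<tau>)\<^sup>2 * d + \<tau>\<^sup>2 * C)"
    have "\<tau> * C < d"
      using d C0 by (simp add: \<tau>_def divide_less_eq)
    moreover have "d * \<tau> \<le> d" using d \<tau> by simp
    ultimately have "0 < \<tau> * (2 * d - d * \<tau> - \<tau> * C)" using \<tau> by (intro mult_pos_pos) auto
    also have "\<dots> = gap" by (simp add: gap_def power2_eq_square algebra_simps)
    finally have gap: "0 < gap" .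
    obtain e where e: "e \<in> kernel_hull" "err e < d + gap / 4"
      using cInf_lessD[OF ne, of "d + gap / 4"] gap by (auto simp: d_def)
    define a where "a x = Re (e (complex_of_real x)) - f x" for x
    from descent[of "gap / 4" a] gap obtain s where
      s: "0 \<le> s" "s \<le> 1" "(\<Sum>x\<in>X. a x * k s x) < (\<Sum>x\<in>X. a x * f x) + gap / 4" by auto
    define b where "b x = k s x - f x" for x
    define e' where "e' z = of_real (1 - \<tau>) * e z + of_real \<tau> * mean_kernel s z" for z
    have e': "e' \<in> kernel_hull"
      unfolding e'_def using kernel_hull.mix[OF e(1) _ \<tau>(2) s(1,2)] \<tau> by simp
    have diff: "Re (e' (complex_of_real x)) - f x = (1 - \<tau>) * a x + \<tau> * b x" for x
      unfolding e'_def kernel_of_real a_def b_def k_def by (simp add: algebra_simps)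
    have "err e' = (\<Sum>x\<in>X. (1 - \<tau>)\<^sup>2 * (a x)\<^sup>2 + \<tau>\<^sup>2 * (b x)\<^sup>2 + 2 * \<tau> * (1 - \<tau>) * (a x * b x))"
      unfolding err_def diff by (intro sum.cong refl) (simp add: power2_eq_square algebra_simps)
    also have "\<dots> = (1 - \<tau>)\<^sup>2 * err e + \<tau>\<^sup>2 * (\<Sum>x\<in>X. (b x)\<^sup>2) + 2 * \<tau> * (1 - \<tau>) * (\<Sum>x\<in>X. a x * b x)"
      by (simp add: sum.distrib sum_distrib_left err_def a_def)
    also have "\<dots> \<le> (1 - \<tau>)\<^sup>2 * (d + gap / 4) + \<tau>\<^sup>2 * C + 2 * \<tau> * (1 - \<tau>) * (gap / 4)"
    proof (intro add_mono mult_left_mono)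
      have "(\<Sum>x\<in>X. a x * b x) = (\<Sum>x\<in>X. a x * k s x) - (\<Sum>x\<in>X. a x * f x)"
        by (simp add: b_def right_diff_distrib sum_subtractf)
      then show "(\<Sum>x\<in>X. a x * b x) \<le> gap / 4" using s(3) by simp
      show "(\<Sum>x\<in>X. (b x)\<^sup>2) \<le> C" unfolding b_def by (rule C(2)[OF s(1,2)])
    qed (use e \<tau> in auto)
    also have "\<dots> = ((1 - \<tau>)\<^sup>2 * d + \<tau>\<^sup>2 * C) + ((1 - \<tau>)\<^sup>2 + 2 * \<tau> * (1 - \<tau>)) * (gap / 4)"
      by (simp only: distrib_left distrib_right add_ac)
    also have "(1 - \<tau>)\<^sup>2 * d + \<tau>\<^sup>2 * C = d - gap" by (simp add: gap_def)
    also have "(1 - \<tau>)\<^sup>2 + 2 * \<tau> * (1 - \<tau>) = 1 - \<tau>\<^sup>2" by (simp add: power2_eq_square algebra_simps)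
    also have "(1 - \<tau>\<^sup>2) * (gap / 4) \<le> 1 * (gap / 4)"
      using gap by (intro mult_right_mono) auto
    finally have "err e' < d" using gap by simp
    with d_le[OF e'] show False by simp
  qed
  then obtain e where e: "e \<in> kernel_hull" "err e < \<epsilon>\<^sup>2"
    using cInf_lessD[OF ne, of "\<epsilon>\<^sup>2"] \<epsilon> by (auto simp: d_def)
  show ?thesis
  proof (rule that[OF e(1)])
    fix x assume "x \<in> X"
    then have "(Re (e (of_real x)) - f x)\<^sup>2 \<le> err e"
      unfolding err_def using X by (intro member_le_sum) auto
    then have "\<bar>Re (e (of_real x)) - f x\<bar>\<^sup>2 < \<epsilon>\<^sup>2" using e(2) by simp
    then show "\<bar>Re (e (of_real x)) - f x\<bar> < \<epsilon>"
      by (rule power_less_imp_less_base) (use \<epsilon> in simp)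
  qed
qed

theorem mclass_kernel_hull_limit:
  assumes f: "f \<in> mclass" and g: "g holomorphic_on slit_plane"
    and gf: "\<forall>x>0. g (complex_of_real x) = complex_of_real (f x)"
  obtains e where "\<And>k. e k \<in> kernel_hull"
    "\<And>K. compact K \<Longrightarrow> K \<subseteq> slit_plane \<Longrightarrow> uniform_limit K e g sequentially"
proof -
  have mono: "matrix_monotone f" and pos: "\<And>x. 0 < x \<Longrightarrow> 0 < f x" and f1: "f 1 = 1"
    using f by (auto simp: mclass_def)
  \<comment> \<open>The points accumulate at 1, in the interior of the slit plane, as the identity
    theorem requires.\<close>
  define p where "p i = 1 + 1 / real (Suc i)" for i
  have p_pos: "0 < p i" "p i \<noteq> 1" for i by (auto simp: p_def add_pos_pos)
  have "inj p" by (auto simp: inj_def p_def)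
  have "\<exists>e\<in>kernel_hull. \<forall>i\<le>2 * m. \<bar>Re (e (of_real (p i))) - f (p i)\<bar> < 1 / real (Suc m)" for m
  proof -
    \<comment> \<open>The sequence contributes 2m + 1 points; adding the node 1 makes the number
      even and includes the node of normalisation.\<close>
    define X where "X = insert 1 (p ` {..2 * m})"
    have card: "card X = 2 * (m + 1)"
      using p_pos(2) \<open>inj p\<close> by (auto simp: X_def card_image inj_on_subset image_iff)
    have X: "finite X" "X \<subseteq> {0<..}" "1 \<in> X" using p_pos(1) by (auto simp: X_def)
    obtain e where "e \<in> kernel_hull" "\<And>x. x \<in> X \<Longrightarrow> \<bar>Re (e (of_real x)) - f x\<bar> < 1 / real (Suc m)"
      by (rule matrix_monotone_kernel_hull_dense[OF mono pos f1 X(1,2) card X(3), of "1 / real (Suc m)"]) auto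
    then show ?thesis by (auto simp: X_def)
  qed
  then obtain e where e: "\<And>m. e m \<in> kernel_hull"
    "\<And>m i. i \<le> 2 * m \<Longrightarrow> \<bar>Re (e m (of_real (p i))) - f (p i)\<bar> < 1 / real (Suc m)" by metis
  obtain G \<rho> where G: "G holomorphic_on slit_plane" "strict_mono (\<rho> :: nat \<Rightarrow> nat)"
    "\<And>z. z \<in> slit_plane \<Longrightarrow> (\<lambda>n. e (\<rho> n) z) \<longlonglongrightarrow> G z"
    "\<And>K. compact K \<Longrightarrow> K \<subseteq> slit_plane \<Longrightarrow> uniform_limit K (e \<circ> \<rho>) G sequentially"
    by (rule Montel[OF open_slit_plane, of kernel_hull e])
      (use kernel_hull_holomorphic kernel_hull_bounded e(1) in auto)
  have p_slit: "complex_of_real (p i) \<in> slit_plane" for i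
    using p_pos(1)[of i] by (simp add: slit_plane_def)
  have Gp: "G (of_real (p i)) = g (of_real (p i))" for i
  proof -
    have "(\<lambda>m. e m (of_real (p i))) \<longlonglongrightarrow> of_real (f (p i))"
    proof (rule LIM_zero_cancel, rule Lim_null_comparison)
      show "\<forall>\<^sub>F m in sequentially. norm (e m (of_real (p i)) - of_real (f (p i))) \<le> 1 / real (Suc m)"
      proof (rule eventually_mono[OF eventually_ge_at_top[of i]])
        fix m assume "i \<le> m"
        \<comment> \<open>Members of the hull are real at real points, so control of the real part
          is full control.\<close>
        have "e m (of_real (p i)) - of_real (f (p i)) = of_real (Re (e m (of_real (p i))) - f (p i))"
          using kernel_hull_real[OF e(1)] by (simp add: complex_eq_iff)
        then have "norm (e m (of_real (p i)) - of_real (f (p i))) = \<bar>Re (e m (of_real (p i))) - f (p i)\<bar>"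
          by (simp only: norm_of_real)
        then show "norm (e m (of_real (p i)) - of_real (f (p i))) \<le> 1 / real (Suc m)"
          using e(2)[of i m] \<open>i \<le> m\<close> by simp
      qed
      show "(\<lambda>m. 1 / real (Suc m)) \<longlonglongrightarrow> 0"
        by (rule LIMSEQ_Suc) (rule lim_1_over_n)
    qed
    from LIMSEQ_subseq_LIMSEQ[OF this G(2)]
    have "(\<lambda>n. e (\<rho> n) (of_real (p i))) \<longlonglongrightarrow> g (of_real (p i))"
      using gf p_pos(1)[of i] by (simp add: comp_def)
    with G(3)[OF p_slit] show ?thesis by (rule LIMSEQ_unique)
  qed
  have "G z = g z" if z: "z \<in> slit_plane" for z
  proof -
    have "G z - g z = 0"
    proof (rule analytic_continuation[of "\<lambda>z. G z - g z" slit_plane "range (\<lambda>i. complex_of_real (p i))" 1])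
      show "connected slit_plane" by (rule starlike_imp_connected[OF starlike_slit_plane])
      show "(1::complex) islimpt range (\<lambda>i. complex_of_real (p i))"
      proof -
        have "(\<lambda>i. complex_of_real (1 + 1 / real (Suc i))) \<longlonglongrightarrow> of_real (1 + 0)"
          by (intro tendsto_intros LIMSEQ_Suc lim_1_over_n)
        then have "(\<lambda>i. complex_of_real (p i)) \<longlonglongrightarrow> 1" by (simp add: p_def)
        then show ?thesis
          unfolding islimpt_sequential using p_pos(2) by (intro exI[of _ "\<lambda>i. complex_of_real (p i)"]) auto
      qed
      show "1 \<in> slit_plane" by (simp add: slit_plane_def)
    qed (use Gp p_slit z in \<open>auto intro!: holomorphic_intros G(1) g open_slit_plane\<close>)
    then show ?thesis by simp
  qed
  then have "uniform_limit K (e \<circ> \<rho>) g sequentially" if "compact K" "K \<subseteq> slit_plane" for K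
    using G(4)[OF that] that(2) by (subst uniform_limit_cong'[of _ _ "e \<circ> \<rho>" g G]) auto
  with e(1) show ?thesis by (intro that[of "e \<circ> \<rho>"]) auto
qed

text \<open>The analytic extension is supplied as \<open>g\<close>, which its values on the positive
  axis determine on the slit plane. With \<open>T = tan \<alpha>\<close> the factor
  \<open>1 + T\<^sup>2\<close> of the kernel inequality becomes sec^2 \<alpha>.\<close>

theorem mainTheorem16:
  fixes A B :: "complex Matrix.mat" and n :: nat and \<alpha> t :: real
    and f :: "real \<Rightarrow> real" and g :: "complex \<Rightarrow> complex"
  assumes "A \<in> carrier_mat n n" and "B \<in> carrier_mat n n"
    and "accretive A" and "accretive B"
    and "0 \<le> \<alpha>" and "\<alpha> < pi / 2"
    and "num_range A \<subseteq> sector \<alpha>" and "num_range B \<subseteq> sector \<alpha>"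
    and "f \<in> mclass"
    and "g holomorphic_on slit_plane"
    and "\<forall>x>0. g (complex_of_real x) = complex_of_real (f x)"
    and "0 < t" and "t < 1"
  shows "loewner_le (ReM (wam t (hol_fun g A) (hol_fun g B)))
           (complex_of_real (1 / (cos \<alpha>)\<^sup>2) \<cdot>\<^sub>m ReM (hol_fun g (wam t A B)))"
proof -
  have A: "sectorial n (tan \<alpha>) A" and B: "sectorial n (tan \<alpha>) B"
    using assms by (auto intro: sectorial_if_num_range)
  have T: "0 \<le> tan \<alpha>" unfolding tan_def
    using sin_ge_zero[of \<alpha>] cos_gt_zero_pi[of \<alpha>] assms(5,6) by (intro divide_nonneg_pos) auto
  have "cos \<alpha> \<noteq> 0" using cos_gt_zero_pi[of \<alpha>] assms(5,6) by auto
  then have sec: "1 + (tan \<alpha>)\<^sup>2 = 1 / (cos \<alpha>)\<^sup>2"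
    using tan_sec[of \<alpha>] by (simp add: inverse_eq_divide power_divide)
  obtain e where "\<And>k. e k \<in> kernel_hull"
    "\<And>K. compact K \<Longrightarrow> K \<subseteq> slit_plane \<Longrightarrow> uniform_limit K e g sequentially"
    using mclass_kernel_hull_limit[OF assms(9-11)] by blast
  from kernel_limit_wam_le[OF A B T assms(12,13) this(1) assms(10) this(2)]
  show ?thesis
    unfolding sec by (intro loewner_le_ReM[of _ n]) (auto intro: wam_carrier)
qed

end
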